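(* Let $\{\mathcal T_h\}_{h\in(0,h_0)}$ be conforming triangulations of $\Omega$, let $u(x_1,x_2)=x_1^2+x_2^2$, let $\alpha\in[0,1]$, and for each $h$ let $U\in X_h$ be a discrete function coinciding on $\partial\Omega$ with the piecewise linear Lagrange interpolation of $u$, such that $|u-U|_{H^1(\Omega)}\le C(u)h^\alpha$ for all $h\in(0,h_0)$, with $C(u)$ independent of $h$. Let the band $\mathcal B=(\bigcup_{i=0}^N K_i)\cup(\bigcup_{i=1}^N\tilde K_i)\subset\mathcal T_h$ be such that there exist constants $C_K,C_\alpha$ independent of $h$ such that for all $i=1,\dots,N$ $$|\tilde K_i|\le C_K|K_i|,\qquad |\tilde K_i|\le C_K|K_{i-1}|,\qquad \sin(\pi-\alpha_{i-1})\le C_\alpha\sin(\pi-\tilde\alpha_i).$$ Finally, let $L\ge C_Lh^{2\alpha/5}$, where $C_L$ is sufficiently large with respect to $C(u)$. Then $$|u-U|_{H^1(\mathcal B)}\ge \mathcal A_1-\mathcal A_2,$$ where the real numbers $\mathcal A_1,\mathcal A_2$ satisfy $$\mathcal A_1\ge C_1\min_{i=1,\dots,N}\frac{1}{\sin(\pi-\tilde\alpha_i)}\ \min_{i=1,\dots,N}|\tilde K_i|^{1/2}\,L\,N^{-1/2},\qquad |\mathcal A_2|\le C_2h^\alpha,$$ with constants $C_1,C_2>0$ independent of $h$ and of the geometry of $\mathcal T_h$ and of $\mathcal B$ (they may depend on $\Omega$, $h_0$, $C(u)$, $C_K$, $C_\alpha$).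
   Context: $\Omega\subset\mathbb R^2$ is a bounded polygonal domain with Lipschitz boundary; $h$ is the maximal diameter of elements of $\mathcal T_h$; $X_h\subset H^1(\Omega)$ is the space of globally continuous functions that are linear on every $K\in\mathcal T_h$. $|\cdot|_{H^1(M)}$ is the $H^1(M)$-seminorm, $|K|$ the area of $K$. Band: for $N\ge1$, a band $\mathcal B\subset\mathcal T_h$ is a union of distinct elements $K_0,\dots,K_N,\tilde K_1,\dots,\tilde K_N$ of $\mathcal T_h$ of the following form. There are consecutive points $P_0,\dots,P_{N+1}$ on a straight line and points $Q_0,\dots,Q_N$ on one side of it such that $K_i$ is the triangle $P_iP_{i+1}Q_i$, whose longest edge is $P_iP_{i+1}$ (so its maximum angle is at $Q_i$), and $\tilde K_i$ is the triangle $Q_{i-1}Q_iP_i$, whose maximum angle is at $P_i$; thus $K_{i-1},\tilde K_i$ share the edge $Q_{i-1}P_i$ and $\tilde K_i,K_i$ share the edge $Q_iP_i$. $\alpha_i,\tilde\alpha_i$ denote the maximum angles of $K_i,\tilde K_i$; $\Gamma=\bigcup_{i=0}^N P_iP_{i+1}$ is the edge of the band and $L$ is the length of $\Gamma$. "$C_L$ sufficiently large with respect to $C(u)$" means: larger than a threshold that depends only on $\Omega$, $h_0$, $\alpha$ and the constant $C(u)$ in the error estimate, and not on $h$, the triangulation or the band. *)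

theory Defs
  imports "HOL-Analysis.Analysis"
begin

type_synonym plane = "real^2"

definition lipschitz_boundary :: "plane set \<Rightarrow> bool" where
  "lipschitz_boundary \<Omega> \<longleftrightarrow>
     (\<forall>p \<in> frontier \<Omega>. \<exists>e \<nu> r s C g.
        norm e = 1 \<and> norm \<nu> = 1 \<and> e \<bullet> \<nu> = 0 \<and> 0 < r \<and> 0 < s \<and>
        C-lipschitz_on (UNIV :: real set) (g :: real \<Rightarrow> real) \<and>
        (\<forall>x. \<bar>(x - p) \<bullet> e\<bar> < r \<and> \<bar>(x - p) \<bullet> \<nu>\<bar> < s \<longrightarrow>
             (x \<in> \<Omega> \<longleftrightarrow> g ((x - p) \<bullet> e) < (x - p) \<bullet> \<nu>)))"

definition polygonal_lipschitz_domain :: "plane set \<Rightarrow> bool" where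
  "polygonal_lipschitz_domain \<Omega> \<longleftrightarrow>
     open \<Omega> \<and> connected \<Omega> \<and> \<Omega> \<noteq> {} \<and> bounded \<Omega> \<and>
     (\<exists>S. finite S \<and> frontier \<Omega> = (\<Union>(a, b) \<in> S. closed_segment a b)) \<and>
     lipschitz_boundary \<Omega>"

definition conforming_triangulation :: "plane set \<Rightarrow> plane set set \<Rightarrow> bool" where
  "conforming_triangulation \<Omega> \<T> \<longleftrightarrow>
     triangulation \<T> \<and> (\<forall>K \<in> \<T>. 2 simplex K) \<and> \<Union>\<T> = closure \<Omega>"

definition mesh_size :: "plane set set \<Rightarrow> real" where
  "mesh_size \<T> = Max (diameter ` \<T>)"

text \<open>Functions are total on the plane, but only their values on the closed domain
  \<open>\<Union>\<T>\<close> are constrained.\<close>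

definition fe_space :: "plane set set \<Rightarrow> (plane \<Rightarrow> real) set" where
  "fe_space \<T> = {v. continuous_on (\<Union>\<T>) v \<and>
                    (\<forall>K \<in> \<T>. \<exists>a b. \<forall>x \<in> K. v x = a \<bullet> x + b)}"

definition lagrange_interpolant ::
    "plane set set \<Rightarrow> (plane \<Rightarrow> real) \<Rightarrow> (plane \<Rightarrow> real) \<Rightarrow> bool" where
  "lagrange_interpolant \<T> f v \<longleftrightarrow>
     v \<in> fe_space \<T> \<and> (\<forall>K \<in> \<T>. \<forall>p. p extreme_point_of K \<longrightarrow> v p = f p)"

text \<open>Weak gradient on an open set \<open>M\<close>. As usual for first-order derivatives of locally
  integrable functions, the test functions are those of class \<open>C\<^sup>1\<close> with compact support
  in \<open>M\<close>; by mollification this is the same as testing with smooth functions. The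
  integration by parts formula is vector valued, so it comprises both partial derivatives.\<close>

definition has_weak_gradient ::
    "(plane \<Rightarrow> real) \<Rightarrow> (plane \<Rightarrow> plane) \<Rightarrow> plane set \<Rightarrow> bool" where
  "has_weak_gradient w G M \<longleftrightarrow>
     (\<forall>K. compact K \<and> K \<subseteq> M \<longrightarrow> w absolutely_integrable_on K \<and> G absolutely_integrable_on K) \<and>
     (\<forall>\<phi> D. (\<forall>x. GDERIV \<phi> x :> D x) \<and> continuous_on UNIV D \<and>
            (\<exists>K. compact K \<and> K \<subseteq> M \<and> (\<forall>x. x \<notin> K \<longrightarrow> \<phi> x = 0)) \<longrightarrow>
        (LINT x:M|lebesgue. w x *\<^sub>R D x) = - (LINT x:M|lebesgue. \<phi> x *\<^sub>R G x))"

text \<open>The weak gradient is unique almost everywhere, so the choice does not affect the value.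
  For a union of closed elements, \<open>M\<close> is to be taken as its interior.\<close>

definition h1_seminorm :: "plane set \<Rightarrow> (plane \<Rightarrow> real) \<Rightarrow> real" where
  "h1_seminorm M w =
     sqrt (LINT x:M|lebesgue. (norm ((SOME G. has_weak_gradient w G M) x))\<^sup>2)"

definition vertex_angle :: "plane \<Rightarrow> plane \<Rightarrow> plane \<Rightarrow> real" where
  \<comment> \<open>the angle at the middle argument\<close>
  "vertex_angle a b c = arccos (((a - b) \<bullet> (c - b)) / (norm (a - b) * norm (c - b)))"

definition tri_K :: "(nat \<Rightarrow> plane) \<Rightarrow> (nat \<Rightarrow> plane) \<Rightarrow> nat \<Rightarrow> plane set" where
  "tri_K P Q i = convex hull {P i, P (Suc i), Q i}"

definition tri_Kt :: "(nat \<Rightarrow> plane) \<Rightarrow> (nat \<Rightarrow> plane) \<Rightarrow> nat \<Rightarrow> plane set" where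
  "tri_Kt P Q i = convex hull {Q (i - 1), Q i, P i}"

definition ang_K :: "(nat \<Rightarrow> plane) \<Rightarrow> (nat \<Rightarrow> plane) \<Rightarrow> nat \<Rightarrow> real" where
  "ang_K P Q i = vertex_angle (P i) (Q i) (P (Suc i))"

definition ang_Kt :: "(nat \<Rightarrow> plane) \<Rightarrow> (nat \<Rightarrow> plane) \<Rightarrow> nat \<Rightarrow> real" where
  "ang_Kt P Q i = vertex_angle (Q (i - 1)) (P i) (Q i)"

text \<open>By \<open>is_band\<close>, \<open>ang_K\<close> and \<open>ang_Kt\<close> are the maximum angles of the respective
  triangles; non-degeneracy of the triangles comes from their membership in \<open>\<T>\<close>.\<close>

definition is_band ::
    "plane set set \<Rightarrow> nat \<Rightarrow> (nat \<Rightarrow> plane) \<Rightarrow> (nat \<Rightarrow> plane) \<Rightarrow> bool" where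
  "is_band \<T> N P Q \<longleftrightarrow>
     1 \<le> N \<and>
     (\<exists>d \<nu> t. norm d = 1 \<and> norm \<nu> = 1 \<and> d \<bullet> \<nu> = 0 \<and>
        strict_mono_on {..Suc N} (t :: nat \<Rightarrow> real) \<and>
        (\<forall>i \<le> Suc N. P i = P 0 + t i *\<^sub>R d) \<and>
        (\<forall>i \<le> N. 0 < (Q i - P 0) \<bullet> \<nu>)) \<and>
     (\<forall>i \<le> N. tri_K P Q i \<in> \<T>) \<and>
     (\<forall>i \<in> {1..N}. tri_Kt P Q i \<in> \<T>) \<and>
     inj_on (tri_K P Q) {..N} \<and> inj_on (tri_Kt P Q) {1..N} \<and>
     tri_K P Q ` {..N} \<inter> tri_Kt P Q ` {1..N} = {} \<and>
     (\<forall>i \<le> N. dist (P i) (Q i) \<le> dist (P i) (P (Suc i)) \<and>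
               dist (P (Suc i)) (Q i) \<le> dist (P i) (P (Suc i))) \<and>
     (\<forall>i \<in> {1..N}. vertex_angle (P i) (Q (i - 1)) (Q i) \<le> ang_Kt P Q i \<and>
                    vertex_angle (P i) (Q i) (Q (i - 1)) \<le> ang_Kt P Q i)"

definition band_union :: "nat \<Rightarrow> (nat \<Rightarrow> plane) \<Rightarrow> (nat \<Rightarrow> plane) \<Rightarrow> plane set" where
  "band_union N P Q = (\<Union>i \<in> {..N}. tri_K P Q i) \<union> (\<Union>i \<in> {1..N}. tri_Kt P Q i)"

definition band_length :: "nat \<Rightarrow> (nat \<Rightarrow> plane) \<Rightarrow> real" where
  "band_length N P = (\<Sum>i \<le> N. dist (P i) (P (Suc i)))"

text \<open>The area and angle conditions on a band.\<close>

definition band_regular ::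
    "real \<Rightarrow> real \<Rightarrow> nat \<Rightarrow> (nat \<Rightarrow> plane) \<Rightarrow> (nat \<Rightarrow> plane) \<Rightarrow> bool" where
  "band_regular CK Ca N P Q \<longleftrightarrow>
     (\<forall>i \<in> {1..N}.
        measure lebesgue (tri_Kt P Q i) \<le> CK * measure lebesgue (tri_K P Q i) \<and>
        measure lebesgue (tri_Kt P Q i) \<le> CK * measure lebesgue (tri_K P Q (i - 1)) \<and>
        sin (pi - ang_K P Q (i - 1)) \<le> Ca * sin (pi - ang_Kt P Q i))"

definition u_quad :: "plane \<Rightarrow> real" where
  "u_quad x = (x $ 1)\<^sup>2 + (x $ 2)\<^sup>2"

text \<open>A family of triangulations, indexed by the mesh size, with discrete functions that
  interpolate \<open>u_quad\<close> on the boundary and satisfy the error estimate of order \<open>\<alpha>\<close>.\<close>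

definition discrete_family ::
    "plane set \<Rightarrow> real \<Rightarrow> real \<Rightarrow> real \<Rightarrow> (real \<Rightarrow> plane set set) \<Rightarrow> (real \<Rightarrow> plane \<Rightarrow> real) \<Rightarrow> bool"
  where
  "discrete_family \<Omega> h0 Cu \<alpha> \<T> U \<longleftrightarrow>
     (\<forall>h \<in> {0<..<h0}.
        conforming_triangulation \<Omega> (\<T> h) \<and> mesh_size (\<T> h) = h \<and>
        U h \<in> fe_space (\<T> h) \<and>
        (\<exists>v. lagrange_interpolant (\<T> h) u_quad v \<and> (\<forall>x \<in> frontier \<Omega>. U h x = v x)) \<and>
        h1_seminorm \<Omega> (\<lambda>x. u_quad x - U h x) \<le> Cu * h powr \<alpha>)"

end

theory Submission
  imports Defs
begin

text \<open>Write \<open>v = u - U\<close>. Second differences of \<open>u\<close> along the edge \<open>\<Gamma>\<close> of the band are exactly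
  \<open>2 a\<^sup>2\<close> for step \<open>a\<close>, whereas those of \<open>U\<close> are at most \<open>2 a\<close> times the total variation \<open>V\<close> of the slope
  of \<open>U\<close> along \<open>\<Gamma>\<close>. If \<open>V < L / 6\<close>, then \<open>\<bar>v\<bar>\<close> is of order \<open>L\<^sup>2\<close> on a large part of \<open>\<Gamma>\<close>; but moving from \<open>\<Gamma>\<close>
  orthogonally to the boundary of the domain, where \<open>\<bar>v\<bar> \<le> h\<^sup>2\<close>, shows that the integral of \<open>\<bar>v\<bar>\<close> over \<open>\<Gamma>\<close>
  is at most of order \<open>L\<^sup>1\<^sup>/\<^sup>2 h\<^sup>\<alpha>\<close>, which is impossible for \<open>L \<ge> C\<^sub>L h\<^sup>2\<^sup>\<alpha>\<^sup>/\<^sup>5\<close>. Hence \<open>V \<ge> L / 6\<close>.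

  At \<open>P\<^sub>i\<close> the slope can only jump because the gradients of \<open>U\<close> jump across the two edges
  \<open>Q\<^sub>i\<^sub>-\<^sub>1 P\<^sub>i\<close> and \<open>Q\<^sub>i P\<^sub>i\<close>. These jumps are normal to the edges, so only the sine of the angle between edge and
  \<open>\<Gamma>\<close>, which is controlled by the sine of the maximum angle of the triangle in between,
  enters the slope. Each gradient is compared with \<open>\<nabla>u(P\<^sub>i)\<close>, which costs the energy of \<open>v\<close> on
  the element and an error of order \<open>h\<close>; summation by Cauchy-Schwarz gives the estimate.\<close>

text \<open>The exponent 2/5 balances the two sizes of the integral of the error over \<Gamma>:
  order L^3 from below against L^(1/2) h^\<alpha> from above, so L^(5/2) wins as soon as L is a
  large multiple of h^(2\<alpha>/5).

  One obstacle is that \<open>h1_seminorm\<close> selects some weak gradient. Every statement about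
  energies therefore rests on two facts: weak gradients agree almost everywhere, and a continuous
  piecewise C^1 function has its elementwise gradient as a weak gradient.

  The other obstacle is that the path orthogonal to \<Gamma> may leave the domain and enter it
  again. Extending the truncated error by zero makes this harmless, and only a bound on the diameter
  of the domain enters.

  Integration by parts and the trace estimate share one mechanism: translation invariance of the
  Lebesgue integral applied to difference quotients, then dominated convergence. No boundary terms
  on single elements arise.\<close>

section \<open>Gluing Lipschitz functions and integrating a gradient over the plane\<close>

lemma lipschitz_on_finite_closed_cover:
  fixes f :: "'a::real_normed_vector \<Rightarrow> 'b::metric_space"
  assumes fin: "finite \<C>" and cl: "\<And>S. S \<in> \<C> \<Longrightarrow> closed S"
    and lip: "\<And>S. S \<in> \<C> \<Longrightarrow> C-lipschitz_on S f"
    and cov: "\<Union>\<C> = UNIV" and C: "0 \<le> C"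
  shows "C-lipschitz_on UNIV f"
proof (rule lipschitz_onI[OF _ C])
  fix x y :: 'a
  define \<gamma> where "\<gamma> t = x + t *\<^sub>R (y - x)" for t :: real
  have cont: "continuous_on UNIV \<gamma>"
    unfolding \<gamma>_def by (intro continuous_intros)
  have d\<gamma>: "dist (\<gamma> s) (\<gamma> t) = dist x y * dist s t" for s t
  proof -
    have "\<gamma> s - \<gamma> t = (s - t) *\<^sub>R (y - x)"
      by (simp add: \<gamma>_def algebra_simps)
    then show ?thesis by (simp add: dist_norm norm_minus_commute)
  qed
  \<comment> \<open>Along the segment from \<open>x\<close> to \<open>y\<close> the pieces become
    finitely many closed subsets of the unit interval, where the bounds combine. The pieces
    themselves, such as the closure of an outer region, may fail to be convex.\<close>
  have "(C * dist x y)-lipschitz_on {0..1} (f \<circ> \<gamma>)"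
  proof (rule lipschitz_on_closed_Union[where I = \<C> and U = "\<lambda>S. \<gamma> -` S"])
    show "(C * dist x y)-lipschitz_on (\<gamma> -` S) (f \<circ> \<gamma>)" if "S \<in> \<C>" for S
    proof (rule lipschitz_onI)
      fix s t assume "s \<in> \<gamma> -` S" "t \<in> \<gamma> -` S"
      then have "dist (f (\<gamma> s)) (f (\<gamma> t)) \<le> C * dist (\<gamma> s) (\<gamma> t)"
        by (intro lipschitz_onD[OF lip[OF that]]) auto
      then show "dist ((f \<circ> \<gamma>) s) ((f \<circ> \<gamma>) t) \<le> C * dist x y * dist s t"
        by (simp add: d\<gamma> mult.assoc)
    qed (use C in auto)
    show "closed (\<gamma> -` S)" if "S \<in> \<C>" for S
      using cl[OF that] cont by (simp add: closed_vimage)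
    show "{0..1} \<subseteq> (\<Union>S\<in>\<C>. \<gamma> -` S)" using cov by auto
  qed (use fin C in auto)
  then have "dist ((f \<circ> \<gamma>) 0) ((f \<circ> \<gamma>) 1) \<le> C * dist x y * dist 0 (1::real)"
    by (rule lipschitz_onD) auto
  then show "dist (f x) (f y) \<le> C * dist x y"
    by (simp add: \<gamma>_def)
qed

lemma lborel_integral_translate:
  fixes f :: "'a::euclidean_space \<Rightarrow> 'b::{banach, second_countable_topology}"
  assumes "f \<in> borel_measurable borel"
  shows "(LINT x|lborel. f (x + c)) = (LINT x|lborel. f x)"
proof -
  have "(LINT x|lborel. f x) = (LINT x|distr lborel borel ((+) c). f x)"
    by (simp add: lborel_distr_plus)
  also have "\<dots> = (LINT x|lborel. f (c + x))"
    using assms by (intro integral_distr) auto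
  finally show ?thesis by (simp add: add.commute)
qed

lemma lborel_integrable_bounded_support:
  fixes f :: "'a::euclidean_space \<Rightarrow> 'b::{banach, second_countable_topology}"
  assumes "f \<in> borel_measurable borel" "\<And>x. norm (f x) \<le> B" "\<And>x. norm x > R \<Longrightarrow> f x = 0"
  shows "integrable lborel f"
proof (rule Bochner_Integration.integrable_bound)
  show "integrable lborel (\<lambda>x. indicator (cball 0 R) x *\<^sub>R B)"
    by (intro borel_integrable_compact) auto
  have "0 \<le> B" using assms(2)[of 0] norm_ge_zero order_trans by blast
  then show "AE x in lborel. norm (f x) \<le> norm (indicator (cball 0 R) x *\<^sub>R B)"
    using assms by (auto simp: indicator_def)
qed (use assms in simp)

lemma GDERIV_difference_quotient_LIMSEQ:
  assumes "GDERIV f x :> D"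
  shows "(\<lambda>n. (f (x + (1 / real (Suc n)) *\<^sub>R e) - f x) * real (Suc n)) \<longlonglongrightarrow> e \<bullet> D"
proof -
  have "((\<lambda>t. f (x + t *\<^sub>R e)) has_derivative (\<lambda>t. (t *\<^sub>R e) \<bullet> D)) (at 0)"
    by (rule has_derivative_compose[of "\<lambda>t. x + t *\<^sub>R e" "\<lambda>t. t *\<^sub>R e" 0 UNIV f "\<lambda>h. h \<bullet> D"])
       (use assms in \<open>auto simp: gderiv_def intro!: derivative_eq_intros\<close>)
  then have "((\<lambda>t. f (x + t *\<^sub>R e)) has_field_derivative (e \<bullet> D)) (at 0)"
    by (simp add: has_field_derivative_def mult_commute_abs)
  then have "((\<lambda>h. (f (x + (0 + h) *\<^sub>R e) - f (x + 0 *\<^sub>R e)) / h) \<longlongrightarrow> e \<bullet> D) (at 0)"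
    by (rule DERIV_D)
  moreover have "filterlim (\<lambda>n. 1 / real (Suc n)) (at 0) sequentially"
    using LIMSEQ_inverse_real_of_nat
    by (auto simp: filterlim_at inverse_eq_divide)
  ultimately have "(\<lambda>n. (f (x + (0 + 1 / real (Suc n)) *\<^sub>R e) - f (x + 0 *\<^sub>R e)) / (1 / real (Suc n)))
      \<longlonglongrightarrow> e \<bullet> D"
    by (rule filterlim_compose)
  then show ?thesis by simp
qed

text \<open>Translation invariance gives every difference quotient integral zero; the Lipschitz
  bound and the bounded support provide a dominating function, so the limit has integral zero too.
  Applied to a product with a test function this is integration by parts.\<close>

lemma lipschitz_compact_support_integral_gradient:
  fixes f :: "'a::euclidean_space \<Rightarrow> real"
  assumes lip: "C-lipschitz_on UNIV f" and supp: "\<And>x. norm x > R \<Longrightarrow> f x = 0"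
    and H: "H \<in> borel_measurable borel" and deriv: "AE x in lborel. GDERIV f x :> H x"
  shows "integrable lborel H" and "(LINT x|lborel. H x) = 0"
proof -
  have cont: "continuous_on UNIV f" by (rule lipschitz_on_continuous_on[OF lip])
  have fm[measurable]: "f \<in> borel_measurable borel"
    using cont by (rule borel_measurable_continuous_onI)
  have *: "integrable lborel (\<lambda>x. e \<bullet> H x) \<and> (LINT x|lborel. e \<bullet> H x) = 0" for e
  proof -
    define s where "s n x = (f (x + (1 / real (Suc n)) *\<^sub>R e) - f x) * real (Suc n)" for n x
    \<comment> \<open>The radius grows by \<open>norm e\<close> because the shifts are at most that
      long: outside this ball \<open>f\<close> vanishes at \<open>x\<close> and at its
      shift.\<close>
    define b where "b x = indicator (cball 0 (R + norm e)) x *\<^sub>R (C * norm e)" for x :: 'a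
    have C: "0 \<le> C" using lip by (rule lipschitz_on_nonneg)
    have bi: "integrable lborel b" unfolding b_def by (intro borel_integrable_compact) auto
    have lim: "AE x in lborel. (\<lambda>n. s n x) \<longlonglongrightarrow> e \<bullet> H x"
      using deriv by eventually_elim (simp only: s_def GDERIV_difference_quotient_LIMSEQ)
    have sb: "norm (s n x) \<le> b x" for n x
    proof (cases "norm x \<le> R + norm e")
      case True
      have "\<bar>f (x + (1 / real (Suc n)) *\<^sub>R e) - f x\<bar> \<le> C * (norm e / real (Suc n))"
        using lipschitz_onD[OF lip, of "x + (1 / real (Suc n)) *\<^sub>R e" x]
        by (simp add: dist_norm)
      then have "\<bar>f (x + (1 / real (Suc n)) *\<^sub>R e) - f x\<bar> * real (Suc n) \<le> C * (norm e / real (Suc n)) * real (Suc n)"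
        by (rule mult_right_mono) simp
      then show ?thesis using True by (simp add: s_def b_def abs_mult del: of_nat_Suc)
    next
      case False
      have "norm ((1 / real (Suc n)) *\<^sub>R e) \<le> norm e" by (simp add: divide_le_eq mult_le_cancel_left1)
      then have "norm (x + (1 / real (Suc n)) *\<^sub>R e) > R"
        using False norm_diff_ineq[of x "(1 / real (Suc n)) *\<^sub>R e"] by linarith
      moreover have "norm x > R" using False norm_ge_zero[of e] by linarith
      ultimately show ?thesis using False by (simp add: s_def b_def supp)
    qed
    have sm: "s n \<in> borel_measurable lborel" for n unfolding s_def by measurable
    have em: "(\<lambda>x. e \<bullet> H x) \<in> borel_measurable lborel" using H by measurable
    have conv: "(\<lambda>n. LINT x|lborel. s n x) \<longlonglongrightarrow> (LINT x|lborel. e \<bullet> H x)"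
      by (rule integral_dominated_convergence[OF em sm bi lim]) (use sb in auto)
    have int: "integrable lborel (\<lambda>x. e \<bullet> H x)"
      by (rule integrable_dominated_convergence[OF em sm bi lim]) (use sb in auto)
    have "compact (f ` cball 0 R)"
      by (intro compact_continuous_image continuous_on_subset[OF cont]) auto
    then obtain B where B: "\<And>x. x \<in> cball 0 R \<Longrightarrow> norm (f x) \<le> B"
      using compact_imp_bounded bounded_iff by (metis imageI)
    have "norm (f x) \<le> max B 0" for x
      using B[of x] supp[of x] by (cases "norm x > R") force+
    then have fi: "integrable lborel f"
      using fm supp by (intro lborel_integrable_bounded_support)
    have "(LINT x|lborel. s n x) = 0" for n
    proof -
      let ?c = "(1 / real (Suc n)) *\<^sub>R e"
      have "integrable lborel (\<lambda>x. f (?c + x))"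
      proof -
        have "integrable (distr lborel borel ((+) ?c)) f" using fi by (simp add: lborel_distr_plus)
        then show ?thesis by (subst (asm) integrable_distr_eq) auto
      qed
      then show ?thesis using fi
        by (simp add: s_def lborel_integral_translate[OF fm] add.commute)
    qed
    then show ?thesis using int conv by (simp add: LIMSEQ_const_iff)
  qed
  have rep: "H x = (\<Sum>b\<in>Basis. (H x \<bullet> b) *\<^sub>R b)" for x
    by (rule euclidean_representation[symmetric])
  have **: "integrable lborel (\<lambda>x. (H x \<bullet> b) *\<^sub>R b)" "(LINT x|lborel. (H x \<bullet> b) *\<^sub>R b) = 0" for b
  proof -
    have "integrable lborel (\<lambda>x. H x \<bullet> b)" "(LINT x|lborel. H x \<bullet> b) = 0"
      using *[of b] by (simp_all only: inner_commute[of b])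
    then show "integrable lborel (\<lambda>x. (H x \<bullet> b) *\<^sub>R b)" "(LINT x|lborel. (H x \<bullet> b) *\<^sub>R b) = 0"
      by simp_all
  qed
  have "integrable lborel (\<lambda>x. \<Sum>b\<in>Basis. (H x \<bullet> b) *\<^sub>R b)"
    by (intro Bochner_Integration.integrable_sum **)
  then show "integrable lborel H" by (simp only: rep[symmetric])
  have "(LINT x|lborel. (\<Sum>b\<in>Basis. (H x \<bullet> b) *\<^sub>R b)) = (\<Sum>b\<in>Basis. (LINT x|lborel. (H x \<bullet> b) *\<^sub>R b))"
    by (intro Bochner_Integration.integral_sum **)
  also have "\<dots> = 0" using ** by (intro sum.neutral ballI)
  finally show "(LINT x|lborel. H x) = 0" by (simp only: rep[symmetric])
qed

section \<open>Uniqueness of weak gradients\<close>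

text \<open>Squaring the positive part removes its kink and gives the C^1 regularity that test
  functions need.\<close>

lemma DERIV_max_0_squared: "((\<lambda>t::real. (max 0 t)\<^sup>2) has_field_derivative 2 * max 0 t) (at t)"
proof -
  consider "t < 0" | "t = 0" | "t > 0" by linarith
  then show ?thesis
  proof cases
    case 1
    have "((\<lambda>t::real. 0) has_field_derivative 0) (at t)" by simp
    then have "((\<lambda>t::real. (max 0 t)\<^sup>2) has_field_derivative 0) (at t)"
      by (rule has_field_derivative_transform_within_open[of _ _ _ "{..<0}"]) (use 1 in auto)
    then show ?thesis using 1 by simp
  next
    case 2
    have "((\<lambda>h::real. max 0 h) \<longlongrightarrow> max 0 0) (at 0)" by (intro tendsto_intros)
    then have "((\<lambda>h::real. ((max 0 (0 + h))\<^sup>2 - (max 0 0)\<^sup>2) / h) \<longlongrightarrow> 0) (at 0)"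
      by (rule Lim_transform_eventually[THEN tendsto_eq_rhs])
         (auto simp: eventually_at_filter max_def power2_eq_square)
    then show ?thesis using 2 unfolding DERIV_def by simp
  next
    case 3
    have "((\<lambda>t::real. t\<^sup>2) has_field_derivative 2 * t) (at t)"
      by (auto intro!: derivative_eq_intros)
    then have "((\<lambda>t::real. (max 0 t)\<^sup>2) has_field_derivative 2 * t) (at t)"
      by (rule has_field_derivative_transform_within_open[of _ _ _ "{0<..}"]) (use 3 in auto)
    then show ?thesis using 3 by simp
  qed
qed

text \<open>A product of squared positive parts of two parabolas, each positive exactly between the
  bounds of its coordinate.\<close>

lemma box_bump_function:
  fixes c d :: plane
  assumes cd: "c $ 1 < d $ 1" "c $ 2 < d $ 2"
  obtains \<psi> D where "\<And>x. GDERIV \<psi> x :> D x" "continuous_on UNIV D"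
    "\<And>x. 0 \<le> \<psi> x" "\<And>x. 0 < \<psi> x \<longleftrightarrow> x \<in> box c d"
proof -
  define q where "q i x = (x $ i - c $ i) * (d $ i - x $ i)" for i and x :: plane
  define D0 where "D0 i x = (2 * max 0 (q i x)) *\<^sub>R ((d $ i + c $ i - 2 * x $ i) *\<^sub>R (axis i 1 :: plane))" for i and x :: plane
  have q: "GDERIV (q i) x :> (d $ i + c $ i - 2 * x $ i) *\<^sub>R axis i 1" for i x
    unfolding gderiv_def q_def
    by (auto intro!: derivative_eq_intros bounded_linear.has_derivative[OF bounded_linear_vec_nth]
        simp: inner_axis algebra_simps fun_eq_iff)
  have p: "GDERIV (\<lambda>x. (max 0 (q i x))\<^sup>2) x :> D0 i x" for i x
    unfolding D0_def by (rule GDERIV_DERIV_compose[OF q DERIV_max_0_squared])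
  have cD: "continuous_on UNIV (D0 i)" for i
    unfolding D0_def q_def by (intro continuous_intros)
  have cq: "continuous_on UNIV (q i)" for i unfolding q_def by (intro continuous_intros)
  have qpos: "0 < q i x \<longleftrightarrow> c $ i < x $ i \<and> x $ i < d $ i" if "c $ i < d $ i" for i x
    using that unfolding q_def zero_less_mult_iff by auto
  show thesis
  proof (rule that)
    show "GDERIV (\<lambda>x. (max 0 (q 1 x))\<^sup>2 * (max 0 (q 2 x))\<^sup>2) x
      :> (max 0 (q 1 x))\<^sup>2 *\<^sub>R D0 2 x + (max 0 (q 2 x))\<^sup>2 *\<^sub>R D0 1 x" for x
      by (rule GDERIV_mult[OF p p])
    show "continuous_on UNIV (\<lambda>x. (max 0 (q 1 x))\<^sup>2 *\<^sub>R D0 2 x + (max 0 (q 2 x))\<^sup>2 *\<^sub>R D0 1 x)"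
      by (intro continuous_intros cD cq)
    show "0 < (max 0 (q 1 x))\<^sup>2 * (max 0 (q 2 x))\<^sup>2 \<longleftrightarrow> x \<in> box c d" for x
    proof -
      have "0 < (max 0 (q 1 x))\<^sup>2 * (max 0 (q 2 x))\<^sup>2 \<longleftrightarrow> 0 < q 1 x \<and> 0 < q 2 x"
        by (auto simp: zero_less_mult_iff max_def split: if_splits)
      then show ?thesis using qpos cd by (auto simp: mem_box_cart forall_2)
    qed
  qed auto
qed

text \<open>With \<psi> a bump on the box, the functions 1 - 1 / (1 + n \<psi>) tend to 1 where
  \<psi> is positive and stay 0 elsewhere. In the limit, the weak formula can thus be tested with
  the indicator of a box.\<close>

lemma box_indicator_approx:
  fixes c d :: plane
  assumes cd: "c $ 1 < d $ 1" "c $ 2 < d $ 2"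
  obtains \<phi> D where "\<And>n x. GDERIV (\<phi> n) x :> D n x" "\<And>n. continuous_on UNIV (D n)"
    "\<And>n x. 0 \<le> \<phi> n x" "\<And>n x. \<phi> n x \<le> 1" "\<And>n x. x \<notin> box c d \<Longrightarrow> \<phi> n x = 0"
    "\<And>x. (\<lambda>n::nat. \<phi> n x) \<longlonglongrightarrow> indicator (box c d) x"
proof -
  obtain \<psi> D where \<psi>: "\<And>x. GDERIV \<psi> x :> D x" "continuous_on UNIV D"
    "\<And>x. 0 \<le> \<psi> x" "\<And>x. 0 < \<psi> x \<longleftrightarrow> x \<in> box c d"
    using box_bump_function[OF cd] by metis
  have pos: "0 < 1 + real n * \<psi> x" for n x using \<psi>(3)[of x] by (intro add_pos_nonneg) auto
  have c\<psi>: "continuous_on UNIV \<psi>"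
    using \<psi>(1) unfolding gderiv_def by (meson continuous_at_imp_continuous_on has_derivative_continuous)
  show thesis
  proof (rule that)
    fix n x
    have "((\<lambda>y. 1 - 1 / (1 + real n * y)) has_field_derivative real n / (1 + real n * \<psi> x)\<^sup>2) (at (\<psi> x))"
      using pos[of n x] by (auto intro!: derivative_eq_intros simp: power2_eq_square)
    from GDERIV_DERIV_compose[OF \<psi>(1) this]
    show "GDERIV (\<lambda>x. 1 - 1 / (1 + real n * \<psi> x)) x :> (real n / (1 + real n * \<psi> x)\<^sup>2) *\<^sub>R D x" .
    show "continuous_on UNIV (\<lambda>x. (real n / (1 + real n * \<psi> x)\<^sup>2) *\<^sub>R D x)"
      by (intro continuous_intros \<psi>(2) c\<psi>) (use pos in \<open>auto simp: less_imp_neq[symmetric]\<close>)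
    show "0 \<le> 1 - 1 / (1 + real n * \<psi> x)" "1 - 1 / (1 + real n * \<psi> x) \<le> 1"
      using pos[of n x] \<psi>(3)[of x] by (auto simp: divide_le_eq)
    show "1 - 1 / (1 + real n * \<psi> x) = 0" if "x \<notin> box c d"
      using \<psi>(3,4)[of x] that by auto
  next
    fix x
    show "(\<lambda>n. 1 - 1 / (1 + real n * \<psi> x)) \<longlonglongrightarrow> indicator (box c d) x"
    proof (cases "x \<in> box c d")
      case True
      then have p: "\<psi> x > 0" using \<psi>(4) by blast
      have "filterlim (\<lambda>n. 1 + real n * \<psi> x) at_top sequentially"
        by (intro filterlim_tendsto_add_at_top[OF tendsto_const]
            filterlim_at_top_mult_tendsto_pos[OF tendsto_const p] filterlim_real_sequentially)
      then have "(\<lambda>n. inverse (1 + real n * \<psi> x)) \<longlonglongrightarrow> 0"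
        by (rule tendsto_inverse_0_at_top)
      then have "(\<lambda>n. 1 - inverse (1 + real n * \<psi> x)) \<longlonglongrightarrow> 1 - 0"
        by (intro tendsto_intros)
      then show ?thesis using True by (simp add: inverse_eq_divide)
    next
      case False
      then have "\<psi> x = 0" using \<psi>(3,4)[of x] by auto
      then show ?thesis using False by simp
    qed
  qed
qed

lemma test_function_times_integrable:
  fixes g :: "plane \<Rightarrow> plane"
  assumes g: "g absolutely_integrable_on S" and \<phi>: "continuous_on UNIV \<phi>"
    and b: "\<And>x. \<bar>\<phi> x\<bar> \<le> B" and z: "\<And>x. x \<notin> S \<Longrightarrow> \<phi> x = 0" and SM: "S \<subseteq> M"
  shows "integrable lebesgue (\<lambda>x. indicator M x *\<^sub>R \<phi> x *\<^sub>R g x)"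
proof -
  have eq: "indicator M x *\<^sub>R \<phi> x *\<^sub>R g x = \<phi> x *\<^sub>R (indicator S x *\<^sub>R g x)" for x
    using z[of x] SM by (auto simp: indicator_def)
  have gS: "integrable lebesgue (\<lambda>x. indicator S x *\<^sub>R g x)"
    using g unfolding set_integrable_def .
  have "\<phi> \<in> borel_measurable lebesgue"
    by (rule measurable_completion) (use borel_measurable_continuous_onI[OF \<phi>] in simp)
  then have m: "(\<lambda>x. \<phi> x *\<^sub>R (indicator S x *\<^sub>R g x)) \<in> borel_measurable lebesgue"
    by (rule borel_measurable_scaleR) (rule borel_measurable_integrable[OF gS])
  show ?thesis unfolding eq
  proof (rule Bochner_Integration.integrable_bound[OF integrable_scaleR_right[OF gS, of B] m], rule AE_I2)
    fix x
    have "\<bar>\<phi> x\<bar> * norm (indicator S x *\<^sub>R g x) \<le> \<bar>B\<bar> * norm (indicator S x *\<^sub>R g x)"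
      by (intro mult_right_mono order_trans[OF b abs_ge_self] norm_ge_zero)
    then show "norm (\<phi> x *\<^sub>R (indicator S x *\<^sub>R g x)) \<le> norm (B *\<^sub>R (indicator S x *\<^sub>R g x))"
      by (simp only: norm_scaleR)
  qed
qed

text \<open>The left side of the weak formula does not see the gradient, so both gradients have
  equal integrals against every test function. Dominated convergence carries this over to the
  indicator of the box.\<close>

lemma weak_gradients_same_integral:
  fixes c d :: plane
  assumes G: "has_weak_gradient w G M" and G': "has_weak_gradient w G' M" and sub: "cbox c d \<subseteq> M"
  shows "integral (cbox c d) (\<lambda>x. G x - G' x) = 0"
proof (cases "box c d = {}")
  case True
  then have "negligible (cbox c d)" by (simp add: negligible_interval)
  then show ?thesis by (rule integral_negligible)
next
  case False
  then have cd: "c $ 1 < d $ 1" "c $ 2 < d $ 2"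
    by (auto simp: interval_ne_empty_cart forall_2)
  obtain \<phi> D where \<phi>: "\<And>n x. GDERIV (\<phi> n) x :> D n x" "\<And>n. continuous_on UNIV (D n)"
    "\<And>n x. 0 \<le> \<phi> n x" "\<And>n x. \<phi> n x \<le> 1" "\<And>n x. x \<notin> box c d \<Longrightarrow> \<phi> n x = 0"
    "\<And>x. (\<lambda>n::nat. \<phi> n x) \<longlonglongrightarrow> indicator (box c d) x"
    using box_indicator_approx[OF cd] by metis
  have gi: "G absolutely_integrable_on cbox c d" "G' absolutely_integrable_on cbox c d"
    using G G' sub unfolding has_weak_gradient_def by (meson compact_cbox)+
  have c\<phi>: "continuous_on UNIV (\<phi> n)" for n
    using \<phi>(1) unfolding gderiv_def by (meson continuous_at_imp_continuous_on has_derivative_continuous)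
  have \<phi>c: "\<phi> n x = 0" if "x \<notin> cbox c d" for n x
    using that \<phi>(5) box_subset_cbox by blast
  have \<phi>b: "\<bar>\<phi> n x\<bar> \<le> 1" for n x
    using \<phi>(3,4)[of n x] by simp
  have int: "integrable lebesgue (\<lambda>x. indicator M x *\<^sub>R \<phi> n x *\<^sub>R g x)"
    if "g absolutely_integrable_on cbox c d" for g :: "plane \<Rightarrow> plane" and n
    by (rule test_function_times_integrable[OF _ c\<phi> \<phi>b _ sub]) (use that \<phi>c in auto)
  let ?F = "\<lambda>n x. indicator M x *\<^sub>R \<phi> n x *\<^sub>R (G x - G' x)"
  have z: "(LINT x|lebesgue. ?F n x) = 0" for n
  proof -
    have test: "(\<forall>x. GDERIV (\<phi> n) x :> D n x) \<and> continuous_on UNIV (D n) \<and>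
            (\<exists>K. compact K \<and> K \<subseteq> M \<and> (\<forall>x. x \<notin> K \<longrightarrow> \<phi> n x = 0))"
      using \<phi>(1,2) \<phi>c sub by (intro conjI allI exI[of _ "cbox c d"]) auto
    have "(LINT x:M|lebesgue. w x *\<^sub>R D n x) = - (LINT x:M|lebesgue. \<phi> n x *\<^sub>R G x)"
      "(LINT x:M|lebesgue. w x *\<^sub>R D n x) = - (LINT x:M|lebesgue. \<phi> n x *\<^sub>R G' x)"
      using G[unfolded has_weak_gradient_def, THEN conjunct2, rule_format, OF test]
        G'[unfolded has_weak_gradient_def, THEN conjunct2, rule_format, OF test] by simp_all
    then have eq: "(LINT x|lebesgue. indicator M x *\<^sub>R \<phi> n x *\<^sub>R G x)
        = (LINT x|lebesgue. indicator M x *\<^sub>R \<phi> n x *\<^sub>R G' x)"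
      unfolding set_lebesgue_integral_def by (simp only: neg_equal_iff_equal)
    have "?F n x = indicator M x *\<^sub>R \<phi> n x *\<^sub>R G x - indicator M x *\<^sub>R \<phi> n x *\<^sub>R G' x" for x
      by (simp only: scaleR_diff_right)
    then have "(LINT x|lebesgue. ?F n x) = (LINT x|lebesgue. indicator M x *\<^sub>R \<phi> n x *\<^sub>R G x)
        - (LINT x|lebesgue. indicator M x *\<^sub>R \<phi> n x *\<^sub>R G' x)"
      using Bochner_Integration.integral_diff[OF int[OF gi(1)] int[OF gi(2)], of n n] by (simp only:)
    then show ?thesis by (simp only: eq diff_self)
  qed
  have gd: "(\<lambda>x. G x - G' x) absolutely_integrable_on cbox c d"
    using gi by (rule set_integral_diff)
  then have dom: "integrable lebesgue (\<lambda>x. norm (indicator (cbox c d) x *\<^sub>R (G x - G' x)))"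
    unfolding set_integrable_def by (rule integrable_norm)
  have gb: "(\<lambda>x. G x - G' x) absolutely_integrable_on box c d"
    by (rule set_integrable_subset[OF gd _ box_subset_cbox]) simp
  have "(\<lambda>n. LINT x|lebesgue. ?F n x) \<longlonglongrightarrow> (LINT x|lebesgue. indicator (box c d) x *\<^sub>R (G x - G' x))"
  proof (rule integral_dominated_convergence[OF _ _ dom])
    show "(\<lambda>x. indicator (box c d) x *\<^sub>R (G x - G' x)) \<in> borel_measurable lebesgue"
      using gb by (simp add: set_integrable_def borel_measurable_integrable)
    show "?F n \<in> borel_measurable lebesgue" for n
      by (rule borel_measurable_integrable[OF int[OF gd]])
    show "AE x in lebesgue. (\<lambda>n. ?F n x) \<longlonglongrightarrow> indicator (box c d) x *\<^sub>R (G x - G' x)"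
    proof (rule AE_I2)
      fix x
      have "(\<lambda>n. \<phi> n x *\<^sub>R (indicator M x *\<^sub>R (G x - G' x))) \<longlonglongrightarrow>
          indicator (box c d) x *\<^sub>R (indicator M x *\<^sub>R (G x - G' x))"
        by (intro tendsto_intros \<phi>)
      moreover have "indicator (box c d) x *\<^sub>R (indicator M x *\<^sub>R (G x - G' x)) =
          indicator (box c d) x *\<^sub>R (G x - G' x)"
        using sub subsetD[OF box_subset_cbox, of x c d] by (cases "x \<in> box c d") auto
      ultimately show "(\<lambda>n. ?F n x) \<longlonglongrightarrow> indicator (box c d) x *\<^sub>R (G x - G' x)"
        by (simp only: scaleR_left_commute[of "indicator M x"])
    qed
    show "AE x in lebesgue. norm (?F n x) \<le> norm (indicator (cbox c d) x *\<^sub>R (G x - G' x))" for n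
    proof (rule AE_I2)
      fix x
      show "norm (?F n x) \<le> norm (indicator (cbox c d) x *\<^sub>R (G x - G' x))"
      proof (cases "x \<in> cbox c d")
        case True
        then have "x \<in> M" using sub by blast
        then have "norm (?F n x) = \<bar>\<phi> n x\<bar> * norm (G x - G' x)" by simp
        also have "\<dots> \<le> 1 * norm (G x - G' x)" by (intro mult_right_mono \<phi>b norm_ge_zero)
        finally show ?thesis using True by simp
      next
        case False
        then show ?thesis using \<phi>c by simp
      qed
    qed
  qed
  then have "(LINT x|lebesgue. indicator (box c d) x *\<^sub>R (G x - G' x)) = 0"
    unfolding z by (rule LIMSEQ_unique) (rule tendsto_const)
  then have "integral (box c d) (\<lambda>x. G x - G' x) = 0"
    unfolding set_lebesgue_integral_eq_integral(2)[OF gb, symmetric] set_lebesgue_integral_def .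
  then show ?thesis by (simp only: integral_open_interval)
qed

text \<open>By Lebesgue differentiation, an integrable function whose integrals over all small cubes
  vanish is zero almost everywhere; countably many boxes cover \<open>M\<close>.\<close>

lemma weak_gradient_unique:
  assumes G: "has_weak_gradient w G M" and G': "has_weak_gradient w G' M" and M: "open M"
  shows "negligible {x \<in> M. G x \<noteq> G' x}"
proof -
  have local: "negligible {x \<in> cbox a b. G x \<noteq> G' x}" if ab: "cbox a b \<subseteq> M" for a b
  proof -
    define f where "f x = (if x \<in> cbox a b then G x - G' x else 0)" for x
    have gi: "G absolutely_integrable_on cbox a b" "G' absolutely_integrable_on cbox a b"
      using G G' ab unfolding has_weak_gradient_def by (meson compact_cbox)+
    then have "(\<lambda>x. G x - G' x) integrable_on cbox a b"
      by (intro integrable_diff set_lebesgue_integral_eq_integral(1))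
    then have "f integrable_on UNIV" unfolding f_def by (simp add: integrable_restrict_UNIV)
    then have "f integrable_on cbox c d" for c d
      using integrable_on_subcbox by blast
    then obtain N where N: "negligible N"
      "\<And>x e. \<lbrakk>x \<notin> N; 0 < e\<rbrakk> \<Longrightarrow> \<exists>r>0. \<forall>h. 0 < h \<and> h < r \<longrightarrow>
         norm (integral (cbox x (x + h *\<^sub>R One)) f /\<^sub>R h ^ DIM(plane) - f x) < e"
      using integrable_ccontinuous_explicit[of f] by metis
    have "f x = 0" if x: "x \<in> box a b" "x \<notin> N" for x
    proof (rule ccontr)
      assume "f x \<noteq> 0"
      then obtain r where r: "r > 0" "\<And>h. 0 < h \<Longrightarrow> h < r \<Longrightarrow>
          norm (integral (cbox x (x + h *\<^sub>R One)) f /\<^sub>R h ^ DIM(plane) - f x) < norm (f x)"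
        using N(2)[OF x(2), of "norm (f x)"] by auto
      obtain s where s: "s > 0" "ball x s \<subseteq> box a b"
        using x(1) open_box open_contains_ball by blast
      \<comment> \<open>Points of a cube of side \<open>h\<close> have l1 distance at most
        \<open>2 * h\<close> from its corner, so \<open>s / 4\<close> keeps the cube inside the
        ball; \<open>r / 2\<close> gives the strict bound \<open>h < r\<close>.\<close>
      define h where "h = min (r / 2) (s / 4)"
      have h: "0 < h" "h < r" "h \<le> s / 4" using r s by (auto simp: h_def)
      have "cbox x (x + h *\<^sub>R One) \<subseteq> ball x s"
      proof
        fix y assume y: "y \<in> cbox x (x + h *\<^sub>R One)"
        have "axis i 1 \<in> (Basis :: plane set)" for i by (simp add: axis_in_Basis_iff)
        then have One: "(\<Sum>b\<in>Basis. (b :: plane) $ i) = 1" for i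
          by (simp add: cart_eq_inner_axis inner_Basis)
        have yx: "\<bar>(y - x) $ i\<bar> \<le> h" for i
        proof -
          have "x $ i \<le> y $ i \<and> y $ i \<le> x $ i + h"
            using y by (simp add: mem_box_cart One)
          then show ?thesis by simp
        qed
        have "(\<Sum>i\<in>UNIV. \<bar>(y - x) $ i\<bar>) \<le> 2 * h"
          unfolding sum_2 using yx[of 1] yx[of 2] by linarith
        then have "norm (y - x) \<le> 2 * h" using norm_le_l1_cart[of "y - x"] by linarith
        then show "y \<in> ball x s" using h s by (simp add: dist_norm norm_minus_commute)
      qed
      then have sub: "cbox x (x + h *\<^sub>R One) \<subseteq> cbox a b" using s box_subset_cbox by blast
      have "integral (cbox x (x + h *\<^sub>R One)) f = integral (cbox x (x + h *\<^sub>R One)) (\<lambda>x. G x - G' x)"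
        using sub by (intro integral_cong) (auto simp: f_def)
      also have "\<dots> = 0" using weak_gradients_same_integral[OF G G'] sub ab by blast
      finally show False using r(2)[OF h(1,2)] by simp
    qed
    then have "{x \<in> cbox a b. G x \<noteq> G' x} \<subseteq> N \<union> (cbox a b - box a b)"
      by (auto simp: f_def) (metis eq_iff_diff_eq_0)
    moreover have "negligible (cbox a b - box a b)"
      using negligible_convex_frontier[of "cbox a b"] by (simp add: frontier_cbox)
    ultimately show ?thesis using N(1) by (meson negligible_Un negligible_subset)
  qed
  obtain \<D> where D: "countable \<D>" "\<D> \<subseteq> Pow M" "\<And>X. X \<in> \<D> \<Longrightarrow> \<exists>a b. X = cbox a b" "\<Union>\<D> = M"
    using open_countable_Union_open_cbox[OF M] by metis
  have "negligible (\<Union>X\<in>\<D>. {x \<in> X. G x \<noteq> G' x})"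
  proof (rule negligible_countable_Union)
    show "countable ((\<lambda>X. {x \<in> X. G x \<noteq> G' x}) ` \<D>)" using D(1) by simp
    show "negligible Y" if Y: "Y \<in> (\<lambda>X. {x \<in> X. G x \<noteq> G' x}) ` \<D>" for Y
    proof -
      obtain X where X: "X \<in> \<D>" "Y = {x \<in> X. G x \<noteq> G' x}" using Y by (rule imageE)
      obtain a b where "X = cbox a b" using D(3)[OF X(1)] by blast
      then show ?thesis using local[of a b] X D(2) by blast
    qed
  qed
  moreover have "{x \<in> M. G x \<noteq> G' x} = (\<Union>X\<in>\<D>. {x \<in> X. G x \<noteq> G' x})" using D(4) by auto
  ultimately show ?thesis by simp
qed

section \<open>Weak gradients of piecewise smooth functions\<close>

text \<open>The gradient chosen by \<open>SOME\<close> in \<open>h1_seminorm\<close> is unknown, but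
  almost everywhere uniqueness lets an explicit one replace it under the integral.\<close>

lemma h1_seminorm_eqI:
  assumes G: "has_weak_gradient w G M" and M: "open M"
    and int: "(\<lambda>x. (norm (G x))\<^sup>2) absolutely_integrable_on M"
  shows "h1_seminorm M w = sqrt (LINT x:M|lebesgue. (norm (G x))\<^sup>2)"
proof -
  define G' where "G' = (SOME G. has_weak_gradient w G M)"
  have "has_weak_gradient w G' M" unfolding G'_def using G by (rule someI[of "\<lambda>G. has_weak_gradient w G M"])
  from weak_gradient_unique[OF this G M]
  have neg: "negligible {x \<in> M. G' x \<noteq> G x}" .
  have int': "(\<lambda>x. (norm (G' x))\<^sup>2) absolutely_integrable_on M"
    by (rule absolutely_integrable_spike[OF int neg]) auto
  have "integral M (\<lambda>x. (norm (G x))\<^sup>2) = integral M (\<lambda>x. (norm (G' x))\<^sup>2)"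
    by (rule integral_spike[OF neg]) auto
  then show ?thesis
    unfolding h1_seminorm_def G'_def[symmetric]
    by (simp only: set_lebesgue_integral_eq_integral(2)[OF int] set_lebesgue_integral_eq_integral(2)[OF int'])
qed

lemma continuous_GDERIV_imp_lipschitz_on:
  fixes f :: "'a::euclidean_space \<Rightarrow> real"
  assumes f: "\<And>x. GDERIV f x :> D x" and D: "continuous_on UNIV D"
    and K: "compact K" "convex K"
  obtains C where "C-lipschitz_on K f"
proof -
  have "compact (D ` K)"
    by (intro compact_continuous_image continuous_on_subset[OF D] K) auto
  then obtain B where B: "\<And>x. x \<in> K \<Longrightarrow> norm (D x) \<le> B" "0 < B"
    by (metis compact_imp_bounded bounded_pos imageI)
  have "B-lipschitz_on K f"
  proof (rule bounded_derivative_imp_lipschitz[OF _ K(2)])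
    show "(f has_derivative (\<lambda>h. h \<bullet> D x)) (at x within K)" for x
      using f[of x] unfolding gderiv_def by (rule has_derivative_at_withinI)
    show "onorm (\<lambda>h. h \<bullet> D x) \<le> B" if "x \<in> K" for x
    proof (rule onorm_le)
      fix h
      have "norm (h \<bullet> D x) \<le> norm h * norm (D x)" by (simp add: Cauchy_Schwarz_ineq2)
      also have "\<dots> \<le> B * norm h" using mult_right_mono[OF B(1)[OF that] norm_ge_zero[of h]]
        by (simp add: mult.commute)
      finally show "norm (h \<bullet> D x) \<le> B * norm h" .
    qed
  qed (use B in auto)
  then show thesis by (rule that)
qed

lemma lborel_integrable_imp_lebesgue:
  fixes f :: "'a::euclidean_space \<Rightarrow> 'b::{banach, second_countable_topology}"
  assumes "integrable lborel f"
  shows "integrable lebesgue f" "(LINT x|lebesgue. f x) = (LINT x|lborel. f x)"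
  using assms by (simp_all add: integrable_completion integral_completion borel_measurable_integrable)

text \<open>Each branch \<open>F K\<close> is of class C^1 on the whole plane, so no one-sided
  derivatives arise at edges. Continuity across edges is encoded by the single function
  \<open>w\<close>, which agrees with every branch on its closed piece.\<close>

locale piecewise_C1 =
  fixes \<T> :: "plane set set" and F :: "plane set \<Rightarrow> plane \<Rightarrow> real"
    and D :: "plane set \<Rightarrow> plane \<Rightarrow> plane" and w :: "plane \<Rightarrow> real"
  assumes finite_pieces: "finite \<T>"
    and compact_piece: "K \<in> \<T> \<Longrightarrow> compact K"
    and convex_piece: "K \<in> \<T> \<Longrightarrow> convex K"
    and disjoint_interiors: "K \<in> \<T> \<Longrightarrow> K' \<in> \<T> \<Longrightarrow> K \<noteq> K' \<Longrightarrow> interior K \<inter> interior K' = {}"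
    and GDERIV_piece: "GDERIV (F K) x :> D K x"
    and continuous_gradient: "continuous_on UNIV (D K)"
    and on_piece: "K \<in> \<T> \<Longrightarrow> x \<in> K \<Longrightarrow> w x = F K x"
begin

text \<open>Zero on the edges, which form a null set. The finite sum of indicators makes Borel
  measurability immediate.\<close>

definition pgrad :: "plane \<Rightarrow> plane" where
  "pgrad x = (\<Sum>K\<in>\<T>. indicator (interior K) x *\<^sub>R D K x)"

lemma continuous_piece: "continuous_on S (F K)"
  using GDERIV_piece unfolding gderiv_def
  by (meson continuous_at_imp_continuous_on has_derivative_continuous)

lemma compact_union: "compact (\<Union>\<T>)"
  using finite_pieces compact_piece by (rule compact_Union)

lemma pgrad_interior:
  assumes "K \<in> \<T>" "x \<in> interior K"
  shows "pgrad x = D K x"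
proof -
  have "x \<notin> interior K'" if "K' \<in> \<T> - {K}" for K'
    using disjoint_interiors[OF assms(1), of K'] that assms(2) by blast
  then have "(\<Sum>K'\<in>\<T> - {K}. indicator (interior K') x *\<^sub>R D K' x) = 0"
    by (intro sum.neutral) auto
  then show ?thesis
    using assms sum.remove[OF finite_pieces assms(1), of "\<lambda>K. indicator (interior K) x *\<^sub>R D K x"]
    by (simp only: pgrad_def) simp
qed

lemma GDERIV_interior:
  assumes "K \<in> \<T>" "x \<in> interior K"
  shows "GDERIV w x :> pgrad x"
proof -
  have "(F K has_derivative (\<lambda>h. h \<bullet> D K x)) (at x)"
    using GDERIV_piece[of K x] unfolding gderiv_def .
  then have "(w has_derivative (\<lambda>h. h \<bullet> D K x)) (at x)"
    by (rule has_derivative_transform_within_open[OF _ open_interior assms(2)])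
       (use assms interior_subset on_piece in force)
  then show ?thesis unfolding gderiv_def pgrad_interior[OF assms] .
qed

lemma AE_interior: "AE x in lborel. x \<in> \<Union>\<T> \<longrightarrow> (\<exists>K\<in>\<T>. x \<in> interior K)"
proof -
  have "negligible (\<Union>K\<in>\<T>. frontier K)"
    using finite_pieces convex_piece by (intro negligible_Union) (auto intro: negligible_convex_frontier)
  then have "AE x in lebesgue. x \<notin> (\<Union>K\<in>\<T>. frontier K)"
    by (intro AE_not_in) (simp add: negligible_iff_null_sets)
  then have "AE x in lborel. x \<notin> (\<Union>K\<in>\<T>. frontier K)"
    by (simp only: AE_completion_iff)
  then show ?thesis
  proof eventually_elim
    case (elim x)
    then show ?case using closure_subset by (force simp: frontier_def)
  qed
qed

lemma pgrad_outside: "x \<notin> \<Union>\<T> \<Longrightarrow> pgrad x = 0"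
  unfolding pgrad_def using interior_subset by (intro sum.neutral) (auto simp: indicator_def)

lemma pgrad_measurable: "pgrad \<in> borel_measurable borel"
proof -
  have "D K \<in> borel_measurable borel" for K
    by (rule borel_measurable_continuous_onI[OF continuous_gradient])
  moreover have "interior K \<in> sets borel" for K :: "plane set" by simp
  ultimately show ?thesis unfolding pgrad_def
    by (intro borel_measurable_sum borel_measurable_scaleR borel_measurable_indicator)
qed

lemma pgrad_bounded: obtains B where "\<And>x. norm (pgrad x) \<le> B"
proof -
  have "\<exists>B. \<forall>x\<in>K. norm (D K x) \<le> B" if "K \<in> \<T>" for K
    using compact_imp_bounded[OF compact_continuous_image[OF continuous_on_subset[OF continuous_gradient[of K]] compact_piece[OF that]]]
    by (auto simp: bounded_iff)
  then obtain b where b: "\<And>K x. K \<in> \<T> \<Longrightarrow> x \<in> K \<Longrightarrow> norm (D K x) \<le> b K" by metis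
  have "norm (pgrad x) \<le> (\<Sum>K\<in>\<T>. \<bar>b K\<bar>)" for x
    unfolding pgrad_def
  proof (rule sum_norm_le)
    fix K assume K: "K \<in> \<T>"
    show "norm (indicator (interior K) x *\<^sub>R D K x) \<le> \<bar>b K\<bar>"
      using b[OF K, of x] interior_subset[of K] by (auto simp: indicator_def)
  qed
  then show thesis by (rule that)
qed

lemma integrable_pgrad_power: "integrable lborel (\<lambda>x. (norm (pgrad x))\<^sup>2)"
proof -
  obtain B where B: "\<And>x. norm (pgrad x) \<le> B" using pgrad_bounded by blast
  obtain R where R: "\<And>x. x \<in> \<Union>\<T> \<Longrightarrow> norm x \<le> R"
    using compact_imp_bounded[OF compact_union] by (auto simp: bounded_iff)
  note pgrad_measurable[measurable]
  show ?thesis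
  proof (rule lborel_integrable_bounded_support)
    show "norm ((norm (pgrad x))\<^sup>2) \<le> B\<^sup>2" for x using power_mono[OF B[of x]] by simp
    show "(norm (pgrad x))\<^sup>2 = 0" if "norm x > R" for x
      using R[of x] that pgrad_outside[of x] by force
  qed measurable
qed

lemma continuous_union: "continuous_on (\<Union>\<T>) w"
proof -
  have "continuous_on (\<Union>K\<in>\<T>. K) w"
  proof (rule continuous_on_closed_Union[OF finite_pieces])
    show "closed K" if "K \<in> \<T>" for K using compact_piece[OF that] by (rule compact_imp_closed)
    show "continuous_on K w" if "K \<in> \<T>" for K
      using continuous_piece[of K K] on_piece[OF that] by (simp cong: continuous_on_cong)
  qed
  then show ?thesis by simp
qed

lemma lipschitz_on_pieces:
  assumes \<phi>: "\<And>x. GDERIV \<phi> x :> E x" "continuous_on UNIV E"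
  obtains C where "0 \<le> C" "\<And>K. K \<in> \<T> \<Longrightarrow> C-lipschitz_on K (\<lambda>x. w x * \<phi> x)"
proof -
  have c\<phi>: "continuous_on UNIV \<phi>"
    using \<phi>(1) unfolding gderiv_def by (meson continuous_at_imp_continuous_on has_derivative_continuous)
  have "\<exists>C. C-lipschitz_on K (\<lambda>x. w x * \<phi> x)" if K: "K \<in> \<T>" for K
  proof -
    have "continuous_on UNIV (\<lambda>x. F K x *\<^sub>R E x + \<phi> x *\<^sub>R D K x)"
      by (intro continuous_intros continuous_piece \<phi>(2) c\<phi> continuous_gradient)
    then obtain C where "C-lipschitz_on K (\<lambda>x. F K x * \<phi> x)"
      using continuous_GDERIV_imp_lipschitz_on[OF GDERIV_mult[OF GDERIV_piece \<phi>(1)] _ compact_piece[OF K] convex_piece[OF K]]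
      by blast
    then have "C-lipschitz_on K (\<lambda>x. w x * \<phi> x)"
      by (rule lipschitz_on_transform) (simp add: on_piece[OF K])
    then show ?thesis ..
  qed
  then obtain c where c: "\<And>K. K \<in> \<T> \<Longrightarrow> (c K)-lipschitz_on K (\<lambda>x. w x * \<phi> x)" by metis
  show thesis
  proof (rule that)
    show "0 \<le> (\<Sum>K\<in>\<T>. \<bar>c K\<bar>)" by (simp add: sum_nonneg)
    show "(\<Sum>K\<in>\<T>. \<bar>c K\<bar>)-lipschitz_on K (\<lambda>x. w x * \<phi> x)" if "K \<in> \<T>" for K
    proof (rule lipschitz_on_mono[OF c[OF that] subset_refl])
      have "\<bar>c K\<bar> \<le> (\<Sum>K\<in>\<T>. \<bar>c K\<bar>)"
        using finite_pieces that by (intro member_le_sum) auto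
      then show "c K \<le> (\<Sum>K\<in>\<T>. \<bar>c K\<bar>)" by linarith
    qed
  qed
qed

text \<open>The product of \<open>w\<close> with a test function, extended by zero, is Lipschitz on
  the plane because \<open>w\<close> is continuous across edges. Almost everywhere its gradient is
  given by the product rule with \<open>pgrad\<close>, and the integral of that gradient vanishes:
  this is the weak formula.\<close>

lemma has_weak_gradient_pgrad:
  assumes M: "open M" "M \<subseteq> \<Union>\<T>"
  shows "has_weak_gradient w pgrad M"
  unfolding has_weak_gradient_def
proof (intro conjI allI impI)
  note pgrad_measurable[measurable]
  obtain B where B: "\<And>x. norm (pgrad x) \<le> B" using pgrad_bounded by blast
  have wS: "continuous_on S w" if "S \<subseteq> M" for S
    using continuous_on_subset[OF continuous_union] that M by blast
  fix S assume "compact S \<and> S \<subseteq> M"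
  then have S: "compact S" "S \<subseteq> M" by auto
  show "w absolutely_integrable_on S"
    unfolding set_integrable_def
    by (intro lborel_integrable_imp_lebesgue borel_integrable_compact S wS)
  obtain R where R: "\<And>x. x \<in> S \<Longrightarrow> norm x \<le> R"
    using compact_imp_bounded[OF S(1)] by (auto simp: bounded_iff)
  have "0 \<le> B" using B[of 0] norm_ge_zero order_trans by blast
  have S_sets: "S \<in> sets borel" using S(1) by (simp add: borel_compact)
  show "pgrad absolutely_integrable_on S"
    unfolding set_integrable_def
  proof (intro lborel_integrable_imp_lebesgue lborel_integrable_bounded_support)
    show "norm (indicator S x *\<^sub>R pgrad x) \<le> B" for x
      using B[of x] \<open>0 \<le> B\<close> by (simp add: indicator_def)
    show "indicator S x *\<^sub>R pgrad x = 0" if "norm x > R" for x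
      using R[of x] that by (force simp: indicator_def)
    show "(\<lambda>x. indicator S x *\<^sub>R pgrad x) \<in> borel_measurable borel"
      using S_sets by measurable
  qed
next
  note pgrad_measurable[measurable]
  obtain B where B: "\<And>x. norm (pgrad x) \<le> B" using pgrad_bounded by blast
  fix \<phi> E
  assume "(\<forall>x. GDERIV \<phi> x :> E x) \<and> continuous_on UNIV E \<and>
    (\<exists>S. compact S \<and> S \<subseteq> M \<and> (\<forall>x. x \<notin> S \<longrightarrow> \<phi> x = 0))"
  then obtain S where \<phi>: "\<And>x. GDERIV \<phi> x :> E x" "continuous_on UNIV E"
    and S: "compact S" "S \<subseteq> M" "\<And>x. x \<notin> S \<Longrightarrow> \<phi> x = 0" by blast
  have c\<phi>: "continuous_on UNIV \<phi>"
    using \<phi>(1) unfolding gderiv_def by (meson continuous_at_imp_continuous_on has_derivative_continuous)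
  have S_sets[measurable]: "S \<in> sets borel" using S(1) by (simp add: borel_compact)
  have zero: "GDERIV f x :> 0" if "\<And>y. y \<notin> S \<Longrightarrow> f y = 0" "x \<notin> S" for f :: "plane \<Rightarrow> real" and x
  proof -
    have "((\<lambda>y. 0::real) has_derivative (\<lambda>h. h \<bullet> 0)) (at x)" by simp
    then show ?thesis unfolding gderiv_def
      by (rule has_derivative_transform_within_open[of _ _ _ _ "- S"])
         (use that compact_imp_closed[OF S(1)] in auto)
  qed
  have E0: "E x = 0" if "x \<notin> S" for x
  proof -
    have "(\<lambda>h. h \<bullet> E x) = (\<lambda>h. h \<bullet> 0)"
      using \<phi>(1)[of x] zero[OF S(3) that] unfolding gderiv_def by (rule has_derivative_unique)
    then have "E x \<bullet> E x = E x \<bullet> 0" by metis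
    then show ?thesis by simp
  qed
  define f where "f x = w x * \<phi> x" for x
  have f0: "f x = 0" if "x \<notin> S" for x using S(3)[OF that] by (simp add: f_def)
  obtain C where C: "0 \<le> C" "\<And>K. K \<in> \<T> \<Longrightarrow> C-lipschitz_on K f"
    using lipschitz_on_pieces[OF \<phi>] unfolding f_def by metis
  \<comment> \<open>The complement enters with its closure so that the cover is closed. There
    \<open>f\<close> vanishes, since the support \<open>S\<close> lies in the open set
    \<open>M\<close> and hence in the interior of the union.\<close>
  have "C-lipschitz_on UNIV f"
  proof (rule lipschitz_on_finite_closed_cover[of "insert (closure (- \<Union>\<T>)) \<T>"])
    have "f x = 0" if "x \<in> closure (- \<Union>\<T>)" for x
    proof -
      have "x \<notin> interior (\<Union>\<T>)" using that by (simp add: closure_interior)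
      then show ?thesis using M S(2) interior_maximal f0 by blast
    qed
    then have "C-lipschitz_on (closure (- \<Union>\<T>)) f"
      using C(1) by (auto simp: lipschitz_on_def)
    then show "C-lipschitz_on X f" if "X \<in> insert (closure (- \<Union>\<T>)) \<T>" for X
      using that C by auto
    show "closed X" if "X \<in> insert (closure (- \<Union>\<T>)) \<T>" for X
      using that compact_piece compact_imp_closed by auto
    show "\<Union> (insert (closure (- \<Union>\<T>)) \<T>) = UNIV"
      using closure_subset[of "- \<Union>\<T>"] by auto
  qed (use finite_pieces C in auto)
  moreover obtain R where R: "\<And>x. x \<in> S \<Longrightarrow> norm x \<le> R"
    using compact_imp_bounded[OF S(1)] by (auto simp: bounded_iff)
  then have "f x = 0" if "norm x > R" for x using f0 that by force
  moreover
  define H1 where "H1 x = indicator S x *\<^sub>R (w x *\<^sub>R E x)" for x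
  define H2 where "H2 x = indicator S x *\<^sub>R (\<phi> x *\<^sub>R pgrad x)" for x
  have iH1: "integrable lborel H1"
    unfolding H1_def using M S(2)
    by (intro borel_integrable_compact S(1) continuous_on_scaleR
        continuous_on_subset[OF continuous_union] continuous_on_subset[OF \<phi>(2)]) auto
  have iH2: "integrable lborel H2"
  proof -
    have "compact (\<phi> ` S)" by (intro compact_continuous_image continuous_on_subset[OF c\<phi>] S) auto
    then obtain b where b: "\<And>x. x \<in> S \<Longrightarrow> \<bar>\<phi> x\<bar> \<le> b"
      using compact_imp_bounded[of "\<phi> ` S"] by (auto simp: bounded_iff)
    have "norm (H2 x) \<le> \<bar>b\<bar> * \<bar>B\<bar>" for x
    proof (cases "x \<in> S")
      case True
      have "\<bar>\<phi> x\<bar> * norm (pgrad x) \<le> \<bar>b\<bar> * \<bar>B\<bar>"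
        using b[OF True] B[of x] by (intro mult_mono) auto
      then show ?thesis using True by (simp add: H2_def)
    qed (simp add: H2_def)
    moreover have "H2 \<in> borel_measurable borel"
      unfolding H2_def using borel_measurable_continuous_onI[OF c\<phi>] by measurable
    moreover have "H2 x = 0" if "norm x > R" for x
      using R[of x] that by (force simp: H2_def)
    ultimately show ?thesis by (intro lborel_integrable_bounded_support)
  qed
  have "AE x in lborel. GDERIV f x :> H1 x + H2 x"
    using AE_interior
  proof eventually_elim
    case (elim x)
    show ?case
    proof (cases "x \<in> S")
      case True
      then obtain K where K: "K \<in> \<T>" "x \<in> interior K" using elim M S(2) by blast
      show ?thesis unfolding f_def
        using GDERIV_mult[OF GDERIV_interior[OF K] \<phi>(1)] True by (simp add: H1_def H2_def)
    next
      case False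
      then show ?thesis using zero[OF f0] by (simp add: H1_def H2_def)
    qed
  qed
  moreover have "(\<lambda>x. H1 x + H2 x) \<in> borel_measurable borel"
    using borel_measurable_integrable[OF iH1] borel_measurable_integrable[OF iH2] by simp
  ultimately have "(LINT x|lborel. H1 x + H2 x) = 0"
    by (intro lipschitz_compact_support_integral_gradient(2))
  then have sum0: "(LINT x|lborel. H1 x) + (LINT x|lborel. H2 x) = 0"
    by (simp only: Bochner_Integration.integral_add[OF iH1 iH2])
  have "indicator M x *\<^sub>R (w x *\<^sub>R E x) = H1 x" for x
    using E0[of x] S(2) by (auto simp: H1_def indicator_def)
  then have "(LINT x:M|lebesgue. w x *\<^sub>R E x) = (LINT x|lborel. H1 x)"
    unfolding set_lebesgue_integral_def using lborel_integrable_imp_lebesgue(2)[OF iH1] by (simp only:)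
  moreover have "indicator M x *\<^sub>R (\<phi> x *\<^sub>R pgrad x) = H2 x" for x
    using S(2) S(3)[of x] by (auto simp: H2_def indicator_def)
  then have "(LINT x:M|lebesgue. \<phi> x *\<^sub>R pgrad x) = (LINT x|lborel. H2 x)"
    unfolding set_lebesgue_integral_def using lborel_integrable_imp_lebesgue(2)[OF iH2] by (simp only:)
  ultimately show "(LINT x:M|lebesgue. w x *\<^sub>R E x) = - (LINT x:M|lebesgue. \<phi> x *\<^sub>R pgrad x)"
    using sum0 by (simp only: add_eq_0_iff2)
qed

lemma h1_seminorm_pgrad:
  assumes M: "open M" "M \<subseteq> \<Union>\<T>"
  shows "h1_seminorm M w = sqrt (LINT x|lborel. indicator M x * (norm (pgrad x))\<^sup>2)"
    and "integrable lborel (\<lambda>x. indicator M x * (norm (pgrad x))\<^sup>2)"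
proof -
  have M_sets: "M \<in> sets borel" using M(1) by simp
  show int: "integrable lborel (\<lambda>x. indicator M x * (norm (pgrad x))\<^sup>2)"
    using integrable_mult_indicator[of M lborel "\<lambda>x. (norm (pgrad x))\<^sup>2"] integrable_pgrad_power M_sets by simp
  then have "(\<lambda>x. (norm (pgrad x))\<^sup>2) absolutely_integrable_on M"
    unfolding set_integrable_def using lborel_integrable_imp_lebesgue(1) by simp
  from h1_seminorm_eqI[OF has_weak_gradient_pgrad[OF M] M(1) this]
  show "h1_seminorm M w = sqrt (LINT x|lborel. indicator M x * (norm (pgrad x))\<^sup>2)"
    using lborel_integrable_imp_lebesgue(2)[OF int] by (simp add: set_lebesgue_integral_def)
qed

end

section \<open>Angles and kinks at a vertex\<close>

lemma inner_div_norms_bounds: "- 1 \<le> (x \<bullet> y) / (norm x * norm y)" "(x \<bullet> y) / (norm x * norm y) \<le> 1"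
  for x y :: "'a::real_inner"
proof -
  have "\<bar>(x \<bullet> y) / (norm x * norm y)\<bar> \<le> 1"
    using Cauchy_Schwarz_ineq2[of x y] by (auto simp: divide_le_eq abs_mult)
  then show "- 1 \<le> (x \<bullet> y) / (norm x * norm y)" "(x \<bullet> y) / (norm x * norm y) \<le> 1" by linarith+
qed

lemma cos_vertex_angle: "cos (vertex_angle a b c) = ((a - b) \<bullet> (c - b)) / (norm (a - b) * norm (c - b))"
  unfolding vertex_angle_def using inner_div_norms_bounds[of "a - b" "c - b"] by (intro cos_arccos) auto

lemma sin_vertex_angle: "sin (pi - vertex_angle a b c) = sqrt (1 - (cos (vertex_angle a b c))\<^sup>2)"
  unfolding cos_vertex_angle unfolding vertex_angle_def sin_pi_minus
  using inner_div_norms_bounds[of "a - b" "c - b"] by (intro sin_arccos) auto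

text \<open>By the law of cosines, with side lengths a, b, c, the comparison of the cosines becomes
  (a - b) (c^2 - (a + b)^2) \<le> 0. The strict triangle inequality \<open>nb\<close> makes the
  second factor negative, so a < b is impossible.\<close>

lemma vertex_angle_le_imp_dist_le:
  assumes "vertex_angle P A B \<le> vertex_angle A P B"
    and "A \<noteq> P" "B \<noteq> P" "A \<noteq> B" and nb: "dist P A < dist P B + dist A B"
  shows "dist P B \<le> dist A B"
proof (rule ccontr)
  define a b c where "a = dist A B" and "b = dist P B" and "c = dist P A"
  have pos: "0 < a" "0 < b" "0 < c" using assms by (auto simp: a_def b_def c_def)
  assume "\<not> dist P B \<le> dist A B"
  then have ab: "a < b" by (simp add: a_def b_def)
  have "cos (vertex_angle A P B) \<le> cos (vertex_angle P A B)"
    using assms(1) unfolding vertex_angle_def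
    by (intro cos_monotone_0_pi_le arccos_lbound arccos_ubound inner_div_norms_bounds)
  moreover have "(A - P) \<bullet> (B - P) = (c\<^sup>2 + b\<^sup>2 - a\<^sup>2) / 2" "(P - A) \<bullet> (B - A) = (c\<^sup>2 + a\<^sup>2 - b\<^sup>2) / 2"
    by (simp_all add: a_def b_def c_def dist_norm power2_norm_eq_inner algebra_simps inner_commute)
  moreover have "norm (A - P) = c" "norm (B - P) = b" "norm (P - A) = c" "norm (B - A) = a"
    by (simp_all add: a_def b_def c_def dist_norm norm_minus_commute)
  ultimately have "(c\<^sup>2 + b\<^sup>2 - a\<^sup>2) / 2 / (c * b) \<le> (c\<^sup>2 + a\<^sup>2 - b\<^sup>2) / 2 / (c * a)"
    by (simp only: cos_vertex_angle)
  then have "a * (c\<^sup>2 + b\<^sup>2 - a\<^sup>2) \<le> b * (c\<^sup>2 + a\<^sup>2 - b\<^sup>2)"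
    using pos by (simp add: divide_simps) (simp add: algebra_simps)
  then have "(a - b) * (c\<^sup>2 - (a + b)\<^sup>2) \<le> 0"
    by (simp add: algebra_simps power2_eq_square)
  moreover have "c\<^sup>2 < (a + b)\<^sup>2"
    using nb pos by (intro power_strict_mono) (auto simp: a_def b_def c_def)
  ultimately show False using ab by (simp add: mult_le_0_iff)
qed

text \<open>The largest angle of a triangle is at least \<pi> / 3, so its cosine is at most 1/2. In
  lengths: the opposite side a is the longest, so c^2 + b^2 - a^2 is at most the smaller of b^2 and
  c^2, which is at most b c.\<close>

lemma largest_angle_inner_le:
  assumes "vertex_angle P A B \<le> vertex_angle A P B" "vertex_angle P B A \<le> vertex_angle A P B"
    and "A \<noteq> P" "B \<noteq> P" "A \<noteq> B"
    and nb: "dist P A < dist P B + dist A B" "dist P B < dist P A + dist A B"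
  shows "2 * ((A - P) \<bullet> (B - P)) \<le> norm (A - P) * norm (B - P)"
proof -
  define a b c where "a = dist A B" and "b = dist P B" and "c = dist P A"
  have pos: "0 < a" "0 < b" "0 < c" using assms by (auto simp: a_def b_def c_def)
  have "b \<le> a" using vertex_angle_le_imp_dist_le[OF assms(1)] assms by (simp add: a_def b_def)
  have "vertex_angle A P B = vertex_angle B P A"
    by (simp add: vertex_angle_def inner_commute mult.commute)
  then have "c \<le> a" using vertex_angle_le_imp_dist_le[of P B A] assms
    by (simp add: a_def c_def dist_commute)
  have "2 * ((A - P) \<bullet> (B - P)) = c\<^sup>2 + b\<^sup>2 - a\<^sup>2"
    by (simp add: a_def b_def c_def dist_norm power2_norm_eq_inner algebra_simps inner_commute)
  also have "\<dots> \<le> c * b"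
  proof (cases "b \<le> c")
    case True
    have "c\<^sup>2 \<le> a\<^sup>2" using \<open>c \<le> a\<close> pos by (intro power_mono) auto
    moreover have "b * b \<le> c * b" using True pos by (intro mult_right_mono) auto
    ultimately show ?thesis by (simp add: power2_eq_square)
  next
    case False
    have "b\<^sup>2 \<le> a\<^sup>2" using \<open>b \<le> a\<close> pos by (intro power_mono) auto
    moreover have "c * c \<le> c * b" using False pos by (intro mult_left_mono) auto
    ultimately show ?thesis by (simp add: power2_eq_square)
  qed
  finally show ?thesis by (simp add: b_def c_def dist_norm norm_minus_commute)
qed

text \<open>By Lagrange's identity the determinant of \<open>d\<close> and \<nu> has square 1, so
  the remainder, orthogonal to both, is zero.\<close>

lemma plane_frame:
  fixes d \<nu> z :: plane
  assumes "norm d = 1" "norm \<nu> = 1" "d \<bullet> \<nu> = 0"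
  shows "z = (z \<bullet> d) *\<^sub>R d + (z \<bullet> \<nu>) *\<^sub>R \<nu>"
proof -
  have dd: "d \<bullet> d = 1" "\<nu> \<bullet> \<nu> = 1" "\<nu> \<bullet> d = 0" using assms by (simp_all add: norm_eq_1 inner_commute)
  define y where "y = z - (z \<bullet> d) *\<^sub>R d - (z \<bullet> \<nu>) *\<^sub>R \<nu>"
  have y: "y \<bullet> d = 0" "y \<bullet> \<nu> = 0"
    using dd assms by (simp_all add: y_def algebra_simps)
  have "(d $ 1 * \<nu> $ 2 - d $ 2 * \<nu> $ 1)\<^sup>2 + (d \<bullet> \<nu>)\<^sup>2 = (d \<bullet> d) * (\<nu> \<bullet> \<nu>)"
    by (simp add: inner_vec_def sum_2) algebra
  then have "d $ 1 * \<nu> $ 2 - d $ 2 * \<nu> $ 1 \<noteq> 0" using dd assms by auto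
  moreover have "y $ 1 * (d $ 1 * \<nu> $ 2 - d $ 2 * \<nu> $ 1) = (y \<bullet> d) * \<nu> $ 2 - (y \<bullet> \<nu>) * d $ 2"
    "y $ 2 * (d $ 1 * \<nu> $ 2 - d $ 2 * \<nu> $ 1) = (y \<bullet> \<nu>) * d $ 1 - (y \<bullet> d) * \<nu> $ 1"
    by (simp_all add: inner_vec_def sum_2 algebra_simps)
  ultimately have "y = 0" using y by (simp add: vec_eq_iff forall_2)
  then show ?thesis by (simp add: y_def algebra_simps)
qed

text \<open>For nonzero \<open>e\<close>, the vector \<open>z\<close> is a multiple of
  \<open>e\<close> turned by a right angle, so its component along \<open>d\<close> has the size of
  \<open>norm z\<close> times the sine of the angle between \<open>e\<close> and the line of
  direction \<open>d\<close>. This is how only a sine of a gradient jump reaches the slope along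
  \<Gamma>.\<close>

lemma tangential_component_le:
  fixes d \<nu> z e :: plane
  assumes fr: "norm d = 1" "norm \<nu> = 1" "d \<bullet> \<nu> = 0" and ze: "z \<bullet> e = 0"
  shows "\<bar>z \<bullet> d\<bar> * norm e \<le> norm z * \<bar>e \<bullet> \<nu>\<bar>"
proof -
  have dd: "d \<bullet> d = 1" "\<nu> \<bullet> \<nu> = 1" "\<nu> \<bullet> d = 0" using fr by (simp_all add: norm_eq_1 inner_commute)
  have n2: "(norm x)\<^sup>2 = (x \<bullet> d)\<^sup>2 + (x \<bullet> \<nu>)\<^sup>2" for x
    unfolding power2_norm_eq_inner
    by (subst (1 2) plane_frame[OF fr, of x])
       (simp add: inner_add_left inner_add_right dd fr power2_eq_square)
  have "z \<bullet> e = (z \<bullet> d) * (e \<bullet> d) + (z \<bullet> \<nu>) * (e \<bullet> \<nu>)"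
    by (subst plane_frame[OF fr, of z]) (simp add: inner_add_left inner_add_right inner_commute)
  then have "(z \<bullet> d) * (e \<bullet> d) = - ((z \<bullet> \<nu>) * (e \<bullet> \<nu>))" using ze by simp
  then have "((z \<bullet> d) * (e \<bullet> d))\<^sup>2 = ((z \<bullet> \<nu>) * (e \<bullet> \<nu>))\<^sup>2" by simp
  then have "(\<bar>z \<bullet> d\<bar> * norm e)\<^sup>2 = (norm z * \<bar>e \<bullet> \<nu>\<bar>)\<^sup>2"
    by (simp add: power_mult_distrib n2 algebra_simps)
  then have "\<bar>z \<bullet> d\<bar> * norm e = norm z * \<bar>e \<bullet> \<nu>\<bar>"
    by (rule power2_eq_imp_eq) simp_all
  then show ?thesis by simp
qed

text \<open>Since the base of each \<open>K\<^sub>i\<close> is its longest edge, both edges at \<open>P\<close> make acute angles with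
  the base line. These two angles and the angle of the triangle between them at \<open>P\<close> add up to \<open>\<pi>\<close>, and the latter is at
  least \<open>\<pi> / 3\<close>, so the sines of the first two are at most twice its sine.\<close>

lemma kink_bound:
  fixes d \<nu> P Q0 Q1 g0 gt g1 :: plane
  assumes fr: "norm d = 1" "norm \<nu> = 1" "d \<bullet> \<nu> = 0"
    and y: "0 < (Q0 - P) \<bullet> \<nu>" "0 < (Q1 - P) \<bullet> \<nu>"
    and l: "0 < l0" "0 < l1"
    and longest: "dist (P - l0 *\<^sub>R d) Q0 \<le> l0" "dist (P + l1 *\<^sub>R d) Q1 \<le> l1"
    and angle: "vertex_angle P Q0 Q1 \<le> vertex_angle Q0 P Q1" "vertex_angle P Q1 Q0 \<le> vertex_angle Q0 P Q1"
    and common: "(g1 - gt) \<bullet> (Q1 - P) = 0" "(gt - g0) \<bullet> (Q0 - P) = 0"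
  shows "0 < sin (pi - vertex_angle Q0 P Q1)"
    and "\<bar>(g1 - g0) \<bullet> d\<bar> \<le> 2 * sin (pi - vertex_angle Q0 P Q1) * (norm (g1 - gt) + norm (gt - g0))"
proof -
  have dd: "d \<bullet> d = 1" "\<nu> \<bullet> \<nu> = 1" "\<nu> \<bullet> d = 0" using fr by (simp_all add: norm_eq_1 inner_commute)
  define e f where "e = Q1 - P" and "f = Q0 - P"
  \<comment> \<open>In the frame around \<open>P\<close>, \<open>Q1\<close> sits at (q, y1) and
    \<open>Q0\<close> at (-n, y0). Positivity of \<open>q\<close> and \<open>n\<close>, shown below,
    is the acuteness of the two angles with the base line.\<close>
  define q n y0 y1 where "q = e \<bullet> d" and "n = - (f \<bullet> d)" and "y0 = f \<bullet> \<nu>" and "y1 = e \<bullet> \<nu>"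
  have y01: "0 < y0" "0 < y1" using y by (auto simp: y0_def y1_def e_def f_def)
  have n2: "x \<bullet> z = (x \<bullet> d) * (z \<bullet> d) + (x \<bullet> \<nu>) * (z \<bullet> \<nu>)" for x z
    by (subst plane_frame[OF fr, of x]) (simp add: inner_add_left inner_add_right inner_commute)
  have r1: "(norm e)\<^sup>2 = q\<^sup>2 + y1\<^sup>2" and r0: "(norm f)\<^sup>2 = n\<^sup>2 + y0\<^sup>2"
    unfolding power2_norm_eq_inner n2[of e e] n2[of f f]
    by (simp_all add: q_def n_def y0_def y1_def power2_eq_square)
  have dot: "f \<bullet> e = y0 * y1 - n * q"
    unfolding n2[of f e] by (simp add: q_def n_def y0_def y1_def)
  \<comment> \<open>\<open>Q1\<close> lies in the disc of radius \<open>l1\<close> around the far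
    end of its base edge. This disc meets the normal to the base line at \<open>P\<close> only in
    \<open>P\<close> and otherwise lies beyond it, so \<open>q\<close> is positive.\<close>
  have "(l1 - q)\<^sup>2 + y1\<^sup>2 \<le> l1\<^sup>2"
  proof -
    have "(dist (P + l1 *\<^sub>R d) Q1)\<^sup>2 \<le> l1\<^sup>2" using longest l by (intro power_mono) auto
    moreover have "(dist (P + l1 *\<^sub>R d) Q1)\<^sup>2 = (norm (l1 *\<^sub>R d - e))\<^sup>2"
      by (simp add: dist_norm e_def algebra_simps)
    moreover have "\<dots> = (l1 - q)\<^sup>2 + y1\<^sup>2"
      unfolding power2_norm_eq_inner n2[of "l1 *\<^sub>R d - e" "l1 *\<^sub>R d - e"] using dd fr
      by (simp add: q_def y1_def power2_eq_square inner_diff_left)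
    ultimately show ?thesis by simp
  qed
  then have "q\<^sup>2 + y1\<^sup>2 \<le> 2 * l1 * q" by (simp add: power2_eq_square algebra_simps)
  moreover have "0 < q\<^sup>2 + y1\<^sup>2" using y01 by (simp add: add_nonneg_pos)
  ultimately have "0 < 2 * l1 * q" by linarith
  then have q: "0 < q" using l by (simp add: zero_less_mult_iff)
  have "(l0 - n)\<^sup>2 + y0\<^sup>2 \<le> l0\<^sup>2"
  proof -
    have "(dist (P - l0 *\<^sub>R d) Q0)\<^sup>2 \<le> l0\<^sup>2" using longest l by (intro power_mono) auto
    moreover have "(dist (P - l0 *\<^sub>R d) Q0)\<^sup>2 = (norm (- (l0 *\<^sub>R d) - f))\<^sup>2"
      by (simp add: dist_norm f_def algebra_simps)
    moreover have "\<dots> = (l0 - n)\<^sup>2 + y0\<^sup>2"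
      unfolding power2_norm_eq_inner n2[of "- (l0 *\<^sub>R d) - f" "- (l0 *\<^sub>R d) - f"] using dd fr
      by (simp add: n_def y0_def power2_eq_square inner_diff_left algebra_simps)
    ultimately show ?thesis by simp
  qed
  then have "n\<^sup>2 + y0\<^sup>2 \<le> 2 * l0 * n" by (simp add: power2_eq_square algebra_simps)
  moreover have "0 < n\<^sup>2 + y0\<^sup>2" using y01 by (simp add: add_nonneg_pos)
  ultimately have "0 < 2 * l0 * n" by linarith
  then have n: "0 < n" using l by (simp add: zero_less_mult_iff)
  have ne: "Q0 \<noteq> P" "Q1 \<noteq> P" using y by auto
  have fe: "e - f = Q1 - Q0" by (simp add: e_def f_def)
  have "Q0 \<noteq> Q1" using n q fe by (auto simp: n_def q_def)
  \<comment> \<open>Equality would put \<open>Q1\<close> on the segment from \<open>P\<close> to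
    \<open>Q0\<close>, making \<open>e\<close> a nonnegative multiple of \<open>f\<close>; but the
    two have components of opposite sign along \<open>d\<close>.\<close>
  have nb1: "dist P Q0 < dist P Q1 + dist Q0 Q1"
  proof (rule ccontr)
    assume "\<not> ?thesis"
    then have "dist P Q0 = dist P Q1 + dist Q1 Q0" using dist_triangle[of P Q0 Q1] by (simp add: dist_commute)
    then have "between (P, Q0) Q1" by (simp add: between)
    then obtain u where u: "0 \<le> u" "Q1 = (1 - u) *\<^sub>R P + u *\<^sub>R Q0"
      by (auto simp: between_mem_segment in_segment)
    then have "e = u *\<^sub>R f" by (simp add: e_def f_def algebra_simps)
    then have "q = - (u * n)" by (simp add: q_def n_def)
    then show False using q mult_nonneg_nonneg[OF u(1) less_imp_le[OF n]] by linarith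
  qed
  have nb2: "dist P Q1 < dist P Q0 + dist Q0 Q1"
  proof (rule ccontr)
    assume "\<not> ?thesis"
    then have "dist P Q1 = dist P Q0 + dist Q0 Q1" using dist_triangle[of P Q1 Q0] by simp
    then have "between (P, Q1) Q0" by (simp add: between)
    then obtain u where u: "0 \<le> u" "Q0 = (1 - u) *\<^sub>R P + u *\<^sub>R Q1"
      by (auto simp: between_mem_segment in_segment)
    then have "f = u *\<^sub>R e" by (simp add: e_def f_def algebra_simps)
    then have "n = - (u * q)" by (simp add: q_def n_def)
    then show False using n mult_nonneg_nonneg[OF u(1) less_imp_le[OF q]] by linarith
  qed
  have half: "2 * (f \<bullet> e) \<le> norm f * norm e"
    using largest_angle_inner_le[OF angle ne \<open>Q0 \<noteq> Q1\<close> nb1 nb2] by (simp add: e_def f_def)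
  \<comment> \<open>The cross product of \<open>e\<close> and \<open>f\<close>, twice the area of
    the triangle between them; \<open>lagrange\<close> links it to the sine at
    \<open>P\<close>.\<close>
  define cr where "cr = n * y1 + q * y0"
  have cr: "0 < cr" using n q y01 by (simp add: cr_def add_pos_pos)
  have lagrange: "(f \<bullet> e)\<^sup>2 + cr\<^sup>2 = (norm f * norm e)\<^sup>2"
    unfolding dot cr_def power_mult_distrib r0 r1 by algebra
  have np: "0 < norm f" "0 < norm e" using ne by (auto simp: e_def f_def)
  have sin_eq: "sin (pi - vertex_angle Q0 P Q1) = cr / (norm f * norm e)"
  proof -
    have "1 - ((f \<bullet> e) / (norm f * norm e))\<^sup>2 = (cr / (norm f * norm e))\<^sup>2"
      using lagrange np by (simp add: power_divide field_simps)
    then show ?thesis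
      unfolding sin_vertex_angle cos_vertex_angle e_def[symmetric] f_def[symmetric]
      using cr np by simp
  qed
  then show "0 < sin (pi - vertex_angle Q0 P Q1)" using cr np by simp
  \<comment> \<open>Divided by both norms: the sines of the base angles are at most twice the sine
    at \<open>P\<close>. If the angle at \<open>P\<close> is right or obtuse, comparing squares even
    gives this without the factor 2; otherwise it lies between \<pi> / 3 and \<pi> / 2, where its
    sine exceeds 1/2.\<close>
  have le2: "y1 * norm f \<le> 2 * cr \<and> y0 * norm e \<le> 2 * cr"
  proof (cases "f \<bullet> e \<le> 0")
    case True
    then have yy: "y0 * y1 \<le> n * q" by (simp add: dot)
    have "(y1 * norm f)\<^sup>2 = (n * y1)\<^sup>2 + (y0 * y1) * (y0 * y1)"
      unfolding power_mult_distrib r0 by algebra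
    also have "\<dots> \<le> (n * y1)\<^sup>2 + (n * q) * (y0 * y1)"
      using yy y01 by (intro add_left_mono mult_right_mono) auto
    also have "\<dots> \<le> (n * y1)\<^sup>2 + (n * q) * (y0 * y1) + ((q * y0)\<^sup>2 + (n * q) * (y0 * y1))"
      using n q y01 by simp
    also have "\<dots> = cr\<^sup>2" unfolding cr_def by algebra
    finally have 1: "y1 * norm f \<le> cr" by (rule power2_le_imp_le) (use cr in simp)
    have "(y0 * norm e)\<^sup>2 = (q * y0)\<^sup>2 + (y0 * y1) * (y0 * y1)"
      unfolding power_mult_distrib r1 by algebra
    also have "\<dots> \<le> (q * y0)\<^sup>2 + (n * q) * (y0 * y1)"
      using yy y01 by (intro add_left_mono mult_right_mono) auto
    also have "\<dots> \<le> (q * y0)\<^sup>2 + (n * q) * (y0 * y1) + ((n * y1)\<^sup>2 + (n * q) * (y0 * y1))"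
      using n q y01 by simp
    also have "\<dots> = cr\<^sup>2" unfolding cr_def by algebra
    finally have 2: "y0 * norm e \<le> cr" by (rule power2_le_imp_le) (use cr in simp)
    show ?thesis using 1 2 cr by simp
  next
    case False
    have "(2 * (f \<bullet> e))\<^sup>2 \<le> (norm f * norm e)\<^sup>2" using half False by (intro power_mono) auto
    then have "4 * (f \<bullet> e)\<^sup>2 \<le> (norm f * norm e)\<^sup>2" by (simp only: power_mult_distrib) simp
    then have "(norm f * norm e)\<^sup>2 \<le> 4 * cr\<^sup>2"
      using lagrange zero_le_power2[of "norm f * norm e"] by linarith
    then have "(norm f * norm e)\<^sup>2 \<le> (2 * cr)\<^sup>2" unfolding power_mult_distrib[of 2 cr] by simp
    then have *: "norm f * norm e \<le> 2 * cr" by (rule power2_le_imp_le) (use cr in simp)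
    have "y1\<^sup>2 \<le> (norm e)\<^sup>2" "y0\<^sup>2 \<le> (norm f)\<^sup>2" using r0 r1 by simp_all
    then have ye: "y1 \<le> norm e" and yf: "y0 \<le> norm f" by (meson norm_ge_zero power2_le_imp_le)+
    have "y1 * norm f \<le> norm f * norm e" "y0 * norm e \<le> norm f * norm e"
      using mult_right_mono[OF ye norm_ge_zero[of f]] mult_right_mono[OF yf norm_ge_zero[of e]]
      by (simp_all only: mult.commute[of "norm e"])
    then show ?thesis using * by linarith
  qed
  define \<sigma> where "\<sigma> = sin (pi - vertex_angle Q0 P Q1)"
  have \<sigma>: "\<sigma> * (norm f * norm e) = cr" using np unfolding \<sigma>_def sin_eq by simp
  have scale: "\<bar>z \<bullet> d\<bar> \<le> 2 * \<sigma> * norm z"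
    if "\<bar>z \<bullet> d\<bar> * r \<le> norm z * y" "y * s \<le> 2 * cr" "\<sigma> * (r * s) = cr" "0 < r" "0 < s" for z :: plane and r s y
  proof -
    have "\<bar>z \<bullet> d\<bar> * (r * s) = (\<bar>z \<bullet> d\<bar> * r) * s" by (simp only: mult.assoc)
    also have "\<dots> \<le> (norm z * y) * s" using that by (intro mult_right_mono) auto
    also have "\<dots> = norm z * (y * s)" by (simp only: mult.assoc)
    also have "\<dots> \<le> norm z * (2 * cr)" using that by (intro mult_left_mono) auto
    also have "\<dots> = (2 * \<sigma> * norm z) * (r * s)" by (simp add: that(3)[symmetric])
    finally show ?thesis using mult_pos_pos[OF that(4,5)] by (rule mult_right_le_imp_le)
  qed
  have b1: "\<bar>(g1 - gt) \<bullet> d\<bar> \<le> 2 * \<sigma> * norm (g1 - gt)"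
  proof (rule scale[of _ "norm e" y1 "norm f"])
    show "\<bar>(g1 - gt) \<bullet> d\<bar> * norm e \<le> norm (g1 - gt) * y1"
      using tangential_component_le[OF fr, of "g1 - gt" e] common y01 by (simp add: e_def y1_def)
    show "\<sigma> * (norm e * norm f) = cr" using \<sigma> by (simp only: mult.commute[of "norm e"])
  qed (use le2 np in auto)
  have b2: "\<bar>(gt - g0) \<bullet> d\<bar> \<le> 2 * \<sigma> * norm (gt - g0)"
  proof (rule scale[of _ "norm f" y0 "norm e"])
    show "\<bar>(gt - g0) \<bullet> d\<bar> * norm f \<le> norm (gt - g0) * y0"
      using tangential_component_le[OF fr, of "gt - g0" f] common y01 by (simp add: f_def y0_def)
  qed (use le2 np \<sigma> in auto)
  have "(g1 - g0) \<bullet> d = (g1 - gt) \<bullet> d + (gt - g0) \<bullet> d" by (simp add: inner_diff_left)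
  then have "\<bar>(g1 - g0) \<bullet> d\<bar> \<le> 2 * \<sigma> * norm (g1 - gt) + 2 * \<sigma> * norm (gt - g0)"
    using b1 b2 by linarith
  then show "\<bar>(g1 - g0) \<bullet> d\<bar> \<le> 2 * sin (pi - vertex_angle Q0 P Q1) * (norm (g1 - gt) + norm (gt - g0))"
    by (simp add: \<sigma>_def distrib_left)
qed

section \<open>A trace inequality on a segment\<close>

text \<open>The rectangle is a translate of the image of an axis-parallel box under the orthogonal
  map that sends the unit vectors to \<open>d\<close> and \<nu>.\<close>

lemma measure_rectangle:
  fixes d \<nu> p :: plane
  assumes on: "norm d = 1" "norm \<nu> = 1" "d \<bullet> \<nu> = 0" and le: "a \<le> b" "c \<le> e"
  shows "{x. a \<le> (x - p) \<bullet> d \<and> (x - p) \<bullet> d \<le> b \<and> c \<le> (x - p) \<bullet> \<nu> \<and> (x - p) \<bullet> \<nu> \<le> e} \<in> lmeasurable"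
      (is "?R \<in> _")
    and "measure lebesgue {x. a \<le> (x - p) \<bullet> d \<and> (x - p) \<bullet> d \<le> b \<and> c \<le> (x - p) \<bullet> \<nu> \<and> (x - p) \<bullet> \<nu> \<le> e}
      = (b - a) * (e - c)"
proof -
  define f where "f x = x $ 1 *\<^sub>R d + x $ 2 *\<^sub>R \<nu>" for x :: plane
  have dd: "d \<bullet> d = 1" "\<nu> \<bullet> \<nu> = 1" "\<nu> \<bullet> d = 0" using on by (simp_all add: norm_eq_1 inner_commute)
  have lin: "linear f"
    by (rule linearI) (simp_all add: f_def algebra_simps scaleR_add_left)
  have nf: "norm (f x) = norm x" for x
  proof -
    have "f x \<bullet> f x = x $ 1 * x $ 1 + x $ 2 * x $ 2"
      by (simp add: f_def inner_add_left inner_add_right dd on(3))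
    also have "\<dots> = x \<bullet> x" by (simp add: inner_vec_def sum_2)
    finally show ?thesis by (simp add: norm_eq_sqrt_inner)
  qed
  have orth: "orthogonal_transformation f"
    using lin nf by (simp add: orthogonal_transformation)
  then have "surj f" by (rule orthogonal_transformation_surj)
  let ?B = "cbox (vector [a, c]) (vector [b, e]) :: plane set"
  have fd: "f x \<bullet> d = x $ 1" "f x \<bullet> \<nu> = x $ 2" for x
    using dd on by (simp_all add: f_def inner_add_left)
  have eq: "?R = (+) p ` (f ` ?B)"
  proof safe
    fix x assume x: "a \<le> (x - p) \<bullet> d" "(x - p) \<bullet> d \<le> b" "c \<le> (x - p) \<bullet> \<nu>" "(x - p) \<bullet> \<nu> \<le> e"
    obtain y where y: "x - p = f y" using \<open>surj f\<close> by (meson surjE)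
    have "y \<in> ?B" using x unfolding y fd by (simp add: mem_box_cart forall_2)
    then show "x \<in> (+) p ` (f ` ?B)" using y by (metis add.commute diff_add_cancel imageI)
  qed (auto simp: fd mem_box_cart forall_2)
  have fB: "f ` ?B \<in> lmeasurable" "measure lebesgue (f ` ?B) = measure lebesgue ?B"
    using measure_orthogonal_image[OF orth, of ?B] measurable_orthogonal_image[OF orth, of ?B] by auto
  have "?B \<noteq> {}" using le by (simp add: interval_ne_empty_cart forall_2)
  then have "measure lebesgue ?B = (b - a) * (e - c)"
    by (simp add: content_cbox_cart prod_2 UNIV_2)
  then show "?R \<in> lmeasurable" "measure lebesgue ?R = (b - a) * (e - c)"
    unfolding eq using fB by (simp_all add: measurable_translation measure_translation)
qed

lemma integrable_indicator_mult_bounded: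
  fixes f :: "'a::euclidean_space \<Rightarrow> real"
  assumes "S \<in> sets borel" "S \<subseteq> S'" "S' \<in> lmeasurable" "S' \<in> sets borel" "f \<in> borel_measurable borel" "\<And>x. \<bar>f x\<bar> \<le> B"
  shows "integrable lborel (\<lambda>x. indicator S x * f x)"
proof (rule Bochner_Integration.integrable_bound)
  have "emeasure lborel S' < \<infinity>"
    using assms(3,4) by (simp add: fmeasurable_def)
  then show "integrable lborel (\<lambda>x. indicator S' x * \<bar>B\<bar>)"
    using assms(4) by (intro integrable_mult_left) (simp add: integrable_indicator_iff)
  show "(\<lambda>x. indicator S x * f x) \<in> borel_measurable lborel"
    using assms(1,5) by measurable
  show "AE x in lborel. norm (indicator S x * f x) \<le> norm (indicator S' x * \<bar>B\<bar>)"
    using assms(2) order_trans[OF assms(6) abs_ge_self] by (intro AE_I2) (auto simp: indicator_def)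
qed

text \<open>The function \<open>w\<close> stands for a nonnegative error that vanishes from height
  \<open>D1\<close> on above the base, and \<open>g\<close> bounds its growth in direction \<nu>.
  The assumption \<open>slope\<close> speaks of difference quotients with slack \<eta> instead of a
  derivative, because the function inserted later is a truncated absolute value, which may fail to
  be differentiable inside an element.\<close>

context
  fixes d \<nu> p :: plane and w g :: "plane \<Rightarrow> real" and L D1 \<Lambda> B :: real
  assumes on: "norm d = 1" "norm \<nu> = 1" "d \<bullet> \<nu> = 0"
    and pos: "0 < L" "0 < D1"
    and lip: "\<Lambda>-lipschitz_on UNIV w" and w0: "\<And>x. 0 \<le> w x"
    and wint: "integrable lborel w"
    and top: "\<And>x. 0 \<le> (x - p) \<bullet> d \<Longrightarrow> (x - p) \<bullet> d \<le> L \<Longrightarrow> D1 \<le> (x - p) \<bullet> \<nu> \<Longrightarrow> w x = 0"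
    and g: "g \<in> borel_measurable borel" "\<And>x. 0 \<le> g x" "\<And>x. g x \<le> B"
    and slope: "AE x in lborel. \<forall>\<eta>>0. \<forall>\<^sub>F n in sequentially.
        \<bar>w (x + (1 / real (Suc n)) *\<^sub>R \<nu>) - w x\<bar> * real (Suc n) \<le> g x + \<eta>"
begin

definition strip :: "plane set" where
  "strip = {x. 0 \<le> (x - p) \<bullet> d \<and> (x - p) \<bullet> d \<le> L \<and> 0 \<le> (x - p) \<bullet> \<nu> \<and> (x - p) \<bullet> \<nu> \<le> D1}"

text \<open>Open at the top, so that for 0 < \<epsilon> \<le> D1 the layer over the whole base is
  exactly what the strip loses when it is raised by \<epsilon>.\<close>

definition layer :: "real \<Rightarrow> real \<Rightarrow> real \<Rightarrow> plane set" where
  "layer a b \<epsilon> = {x. a \<le> (x - p) \<bullet> d \<and> (x - p) \<bullet> d \<le> b \<and> 0 \<le> (x - p) \<bullet> \<nu> \<and> (x - p) \<bullet> \<nu> < \<epsilon>}"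

lemma strip_sets: "strip \<in> sets borel" "strip \<in> lmeasurable" "measure lebesgue strip = L * D1"
  using measure_rectangle[OF on, of 0 L 0 D1 p] pos unfolding strip_def by auto

lemma layer_sets: "layer a b \<epsilon> \<in> sets borel"
  unfolding layer_def by measurable

lemma w_measurable: "w \<in> borel_measurable borel"
  using lipschitz_on_continuous_on[OF lip] by (rule borel_measurable_continuous_onI)

lemma inner_frame: "d \<bullet> d = 1" "\<nu> \<bullet> \<nu> = 1" "\<nu> \<bullet> d = 0" "d \<bullet> \<nu> = 0"
  using on by (simp_all add: norm_eq_1 inner_commute)

lemma integrable_shift: "integrable lborel (\<lambda>x. w (x + c))"
proof -
  have "integrable (distr lborel borel ((+) c)) w" using wint by (simp add: lborel_distr_plus)
  then show ?thesis by (subst (asm) integrable_distr_eq) (use w_measurable in \<open>auto simp: add.commute\<close>)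
qed

lemma integrable_ind:
  assumes "S \<in> sets borel"
  shows "integrable lborel (\<lambda>x. indicator S (x + c) * w (x + c))" "integrable lborel (\<lambda>x. indicator S x * w (x + c))"
proof -
  have "(\<lambda>x. x + c) -` S \<in> sets borel"
    using assms by (intro measurable_sets_borel[of "\<lambda>x. x + c" borel]) auto
  then have "integrable lborel (\<lambda>x. indicator ((\<lambda>x. x + c) -` S) x *\<^sub>R w (x + c))"
    by (intro integrable_mult_indicator integrable_shift) simp
  moreover have "indicator ((\<lambda>x. x + c) -` S) x *\<^sub>R w (x + c) = indicator S (x + c) * w (x + c)" for x
    by (simp add: indicator_def)
  ultimately show "integrable lborel (\<lambda>x. indicator S (x + c) * w (x + c))" by (simp only:)
  show "integrable lborel (\<lambda>x. indicator S x * w (x + c))"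
    using integrable_mult_indicator[OF _ integrable_shift, of S c] assms by simp
qed

text \<open>Only the bottom layer survives when \<open>w\<close> is compared with its translate over the strip,
  because \<open>w\<close> vanishes above the strip. This replaces integration along the lines
  parallel to \<open>\<nu>\<close> and avoids Fubini in rotated coordinates.\<close>

lemma layer_integral_le:
  assumes \<epsilon>: "0 < \<epsilon>" "\<epsilon> \<le> D1"
  shows "(LINT x|lborel. indicator (layer 0 L \<epsilon>) x * w x)
      \<le> (LINT x|lborel. indicator strip x * \<bar>w (x + \<epsilon> *\<^sub>R \<nu>) - w x\<bar>)"
proof -
  \<comment> \<open>Over the base, by height: below \<epsilon> only the first indicator on the right
    is 1, from \<epsilon> to \<open>D1\<close> the two terms cancel, and above \<open>D1\<close> the
    function \<open>w\<close> is 0.\<close>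
  have pw: "indicator (layer 0 L \<epsilon>) x * w x \<le> indicator strip x * w x - indicator strip (x + - (\<epsilon> *\<^sub>R \<nu>)) * w x" for x
  proof -
    have 1: "(x + - (\<epsilon> *\<^sub>R \<nu>) - p) \<bullet> d = (x - p) \<bullet> d" "(x + - (\<epsilon> *\<^sub>R \<nu>) - p) \<bullet> \<nu> = (x - p) \<bullet> \<nu> - \<epsilon>"
      using inner_frame by (simp_all add: algebra_simps)
    show ?thesis
      using w0[of x] top[of x] \<epsilon> unfolding indicator_def strip_def layer_def mem_Collect_eq 1
      by auto
  qed
  have int1: "integrable lborel (\<lambda>x. indicator strip x * w x)"
    using integrable_ind(2)[OF strip_sets(1), of 0] by simp
  have int0: "integrable lborel (\<lambda>x. indicator (layer 0 L \<epsilon>) x * w x)"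
    using integrable_ind(2)[OF layer_sets, of _ _ _ 0] by simp
  have int2: "integrable lborel (\<lambda>x. indicator strip x * w (x + \<epsilon> *\<^sub>R \<nu>))"
    by (rule integrable_ind(2)[OF strip_sets(1)])
  have m: "(\<lambda>x. indicator strip (x + - (\<epsilon> *\<^sub>R \<nu>)) * w x) \<in> borel_measurable borel"
    using strip_sets(1) w_measurable by measurable
  have int3: "integrable lborel (\<lambda>x. indicator strip (x + - (\<epsilon> *\<^sub>R \<nu>)) * w x)"
  proof (rule Bochner_Integration.integrable_bound[OF wint])
    show "AE x in lborel. norm (indicator strip (x + - (\<epsilon> *\<^sub>R \<nu>)) * w x) \<le> norm (w x)"
      by (intro AE_I2) (auto simp: indicator_def)
  qed (use m in simp)
  have tr: "(LINT x|lborel. indicator strip (x + - (\<epsilon> *\<^sub>R \<nu>)) * w x) = (LINT x|lborel. indicator strip x * w (x + \<epsilon> *\<^sub>R \<nu>))"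
    using lborel_integral_translate[OF m, of "\<epsilon> *\<^sub>R \<nu>"] by simp
  have "(LINT x|lborel. indicator (layer 0 L \<epsilon>) x * w x)
      \<le> (LINT x|lborel. indicator strip x * w x - indicator strip (x + - (\<epsilon> *\<^sub>R \<nu>)) * w x)"
    by (intro integral_mono int0 Bochner_Integration.integrable_diff int1 int3 pw)
  also have "\<dots> = (LINT x|lborel. indicator strip x * w x) - (LINT x|lborel. indicator strip x * w (x + \<epsilon> *\<^sub>R \<nu>))"
    by (simp only: Bochner_Integration.integral_diff[OF int1 int3] tr)
  also have "\<dots> = (LINT x|lborel. indicator strip x * w x - indicator strip x * w (x + \<epsilon> *\<^sub>R \<nu>))"
    by (simp only: Bochner_Integration.integral_diff[OF int1 int2])
  also have "\<dots> \<le> (LINT x|lborel. indicator strip x * \<bar>w (x + \<epsilon> *\<^sub>R \<nu>) - w x\<bar>)"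
  proof (rule integral_mono)
    show "integrable lborel (\<lambda>x. indicator strip x * w x - indicator strip x * w (x + \<epsilon> *\<^sub>R \<nu>))"
      by (intro Bochner_Integration.integrable_diff int1 int2)
    have "integrable lborel (\<lambda>x. \<bar>indicator strip x * w (x + \<epsilon> *\<^sub>R \<nu>) - indicator strip x * w x\<bar>)"
      by (intro integrable_abs Bochner_Integration.integrable_diff int1 int2)
    moreover have "\<bar>indicator strip x * w (x + \<epsilon> *\<^sub>R \<nu>) - indicator strip x * w x\<bar> = indicator strip x * \<bar>w (x + \<epsilon> *\<^sub>R \<nu>) - w x\<bar>" for x
      by (simp add: indicator_def)
    ultimately show "integrable lborel (\<lambda>x. indicator strip x * \<bar>w (x + \<epsilon> *\<^sub>R \<nu>) - w x\<bar>)" by simp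
  qed (auto simp: indicator_def)
  finally show ?thesis .
qed

lemma layer_integral_eventually_le:
  assumes \<eta>: "0 < \<eta>"
  shows "\<forall>\<^sub>F n in sequentially. (LINT x|lborel. indicator (layer 0 L (1 / real (Suc n))) x * w x) * real (Suc n)
      \<le> (LINT x|lborel. indicator strip x * g x) + \<eta>"
proof -
  define q where "q n x = \<bar>w (x + (1 / real (Suc n)) *\<^sub>R \<nu>) - w x\<bar> * real (Suc n)" for n x
  have qle: "q n x \<le> \<Lambda>" for n x
  proof -
    have "\<bar>w (x + (1 / real (Suc n)) *\<^sub>R \<nu>) - w x\<bar> \<le> \<Lambda> * (1 / real (Suc n))"
      using lipschitz_onD[OF lip, of "x + (1 / real (Suc n)) *\<^sub>R \<nu>" x] on by (simp add: dist_norm)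
    then have "q n x \<le> \<Lambda> * (1 / real (Suc n)) * real (Suc n)"
      unfolding q_def by (rule mult_right_mono) simp
    then show ?thesis by (simp del: of_nat_Suc)
  qed
  have q0: "0 \<le> q n x" for n x by (simp add: q_def)
  note w_measurable[measurable] g(1)[measurable] strip_sets(1)[measurable]
  have qm[measurable]: "q n \<in> borel_measurable borel" for n unfolding q_def by measurable
  \<comment> \<open>The quotients \<open>q n\<close> may fail to converge; they are only
    asymptotically at most \<open>g\<close>. Their maximum with \<open>g\<close> does converge, to
    \<open>g\<close>, and is bounded, so dominated convergence applies to it.\<close>
  let ?f = "\<lambda>n x. indicator strip x * max (q n x) (g x)"
  have int_b: "integrable lborel (\<lambda>x. indicator strip x * (\<bar>\<Lambda>\<bar> + \<bar>B\<bar>))"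
    by (rule integrable_indicator_mult_bounded[OF strip_sets(1) subset_refl strip_sets(2,1), of _ "\<bar>\<Lambda>\<bar> + \<bar>B\<bar>"]) auto
  have max_le: "\<bar>max (q n x) (g x)\<bar> \<le> \<bar>\<Lambda>\<bar> + \<bar>B\<bar>" for n x
    using qle[of n x] q0[of n x] g(2,3)[of x] by (auto simp: max_def)
  have conv: "(\<lambda>n. LINT x|lborel. ?f n x) \<longlonglongrightarrow> (LINT x|lborel. indicator strip x * g x)"
  proof (rule integral_dominated_convergence[OF _ _ int_b])
    show "AE x in lborel. (\<lambda>n. ?f n x) \<longlonglongrightarrow> indicator strip x * g x"
      using slope
    proof eventually_elim
      case (elim x)
      have "(\<lambda>n. max (q n x) (g x)) \<longlonglongrightarrow> g x"
      proof (rule LIMSEQ_I)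
        fix r :: real assume "0 < r"
        then have "\<forall>\<^sub>F n in sequentially. q n x \<le> g x + r / 2"
          using elim unfolding q_def by simp
        then obtain N where N: "\<And>n. n \<ge> N \<Longrightarrow> q n x \<le> g x + r / 2"
          by (auto simp: eventually_sequentially)
        have "norm (max (q n x) (g x) - g x) < r" if "n \<ge> N" for n
          using N[OF that] \<open>0 < r\<close> by (auto simp: max_def)
        then show "\<exists>no. \<forall>n\<ge>no. norm (max (q n x) (g x) - g x) < r" by blast
      qed
      then show ?case by (intro tendsto_intros)
    qed
    show "AE x in lborel. norm (?f n x) \<le> indicator strip x * (\<bar>\<Lambda>\<bar> + \<bar>B\<bar>)" for n
      using max_le by (intro AE_I2) (simp add: indicator_def)
  qed measurable
  then have ev: "\<forall>\<^sub>F n in sequentially. (LINT x|lborel. ?f n x) < (LINT x|lborel. indicator strip x * g x) + \<eta>"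
    using \<eta> by (intro order_tendstoD(2)) auto
  have "(\<lambda>n. 1 / real (Suc n)) \<longlonglongrightarrow> 0"
    using LIMSEQ_inverse_real_of_nat by (simp add: inverse_eq_divide)
  then have "\<forall>\<^sub>F n in sequentially. 1 / real (Suc n) < D1"
    using pos(2) by (rule order_tendstoD(2))
  with ev show ?thesis
  proof eventually_elim
    case (elim n)
    let ?N = "real (Suc n)" let ?\<epsilon> = "1 / ?N"
    have "(LINT x|lborel. indicator (layer 0 L ?\<epsilon>) x * w x) * ?N
        \<le> (LINT x|lborel. indicator strip x * \<bar>w (x + ?\<epsilon> *\<^sub>R \<nu>) - w x\<bar>) * ?N"
      using elim(2) by (intro mult_right_mono layer_integral_le) auto
    also have "\<dots> = (LINT x|lborel. indicator strip x * q n x)"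
      by (simp only: q_def integral_mult_left_zero[symmetric] mult.assoc)
    also have "\<dots> \<le> (LINT x|lborel. ?f n x)"
    proof (rule integral_mono)
      show "integrable lborel (\<lambda>x. indicator strip x * q n x)"
        using qle q0 by (intro integrable_indicator_mult_bounded[OF strip_sets(1) subset_refl strip_sets(2,1) qm, where B = \<Lambda>]) auto
      show "integrable lborel (?f n)"
        using max_le by (intro integrable_indicator_mult_bounded[OF strip_sets(1) subset_refl strip_sets(2,1), where B = "\<bar>\<Lambda>\<bar> + \<bar>B\<bar>"]) auto
    qed (auto simp: indicator_def)
    finally show ?case using elim(1) by linarith
  qed
qed

text \<open>The inequality \<open>sd\<close> is integrated over the part of a thin layer above the
  middle third of the base. Shifts by \<open>L / 3\<close> stay above the base, so the weights 1 + 2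
  + 1 cost four integrals over the full layer. The length L / 3 and half of the layer height then
  give 24 = 3 * 4 * 2.\<close>

lemma second_difference_le_strip_integral:
  assumes m: "0 < m" and
    sd: "\<And>t. L / 3 \<le> t \<Longrightarrow> t \<le> 2 * L / 3 \<Longrightarrow>
      m \<le> w (p + (t + L / 3) *\<^sub>R d) + 2 * w (p + t *\<^sub>R d) + w (p + (t - L / 3) *\<^sub>R d)"
  shows "m * L / 24 \<le> (LINT x|lborel. indicator strip x * g x)"
proof (rule field_le_epsilon)
  fix \<eta> :: real assume \<eta>: "0 < \<eta>"
  define a where "a = L / 3"
  have a: "0 < a" "L = 3 * a" using pos by (auto simp: a_def)
  let ?I = "LINT x|lborel. indicator strip x * g x"
  have "\<Lambda> \<ge> 0" using lip by (rule lipschitz_on_nonneg)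
  have step: "(m - 4 * \<Lambda> * (1 / real (Suc n))) * a / 8 \<le> (LINT x|lborel. indicator (layer 0 L (1 / real (Suc n))) x * w x) * real (Suc n)"
    if n: "4 * \<Lambda> * (1 / real (Suc n)) \<le> m" for n
  proof -
    define \<epsilon> where "\<epsilon> = 1 / real (Suc n)"
    have \<epsilon>: "0 < \<epsilon>" by (simp add: \<epsilon>_def)
    let ?R = "layer 0 L \<epsilon>" let ?R' = "layer a (2 * a) \<epsilon>"
    have pw: "indicator ?R' x * (m - 4 * \<Lambda> * \<epsilon>) \<le> indicator ?R (x + a *\<^sub>R d) * w (x + a *\<^sub>R d)
        + 2 * (indicator ?R x * w x) + indicator ?R (x + - (a *\<^sub>R d)) * w (x + - (a *\<^sub>R d))" for x
    proof (cases "x \<in> ?R'")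
      case False
      then show ?thesis using w0 by simp
    next
      case True
      define X where "X = (x - p) \<bullet> d"
      define Y where "Y = (x - p) \<bullet> \<nu>"
      have XY: "a \<le> X" "X \<le> 2 * a" "0 \<le> Y" "Y < \<epsilon>" using True by (auto simp: layer_def X_def Y_def)
      have shift: "(x + k *\<^sub>R d - p) \<bullet> d = X + k" "(x + k *\<^sub>R d - p) \<bullet> \<nu> = Y" for k
        using inner_frame by (simp_all add: X_def Y_def algebra_simps)
      have mem: "x + k *\<^sub>R d \<in> ?R" if "- a \<le> k" "k \<le> a" for k
        unfolding layer_def mem_Collect_eq shift using XY that a by auto
      have xeq: "x = p + X *\<^sub>R d + Y *\<^sub>R \<nu>"
        using plane_frame[OF on, of "x - p"] by (simp add: X_def Y_def algebra_simps)
      \<comment> \<open>Moving to the foot point on the base changes \<open>w\<close> by at most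
        \<Lambda> \<epsilon>. The weighted sum of the values loses
        \<open>4 * \<Lambda> * \<epsilon>\<close>, which disappears in the limit.\<close>
      have near: "w (p + (X + k) *\<^sub>R d) - \<Lambda> * \<epsilon> \<le> w (x + k *\<^sub>R d)" for k
      proof -
        have "x + k *\<^sub>R d - (p + (X + k) *\<^sub>R d) = Y *\<^sub>R \<nu>"
          by (subst xeq) (simp add: algebra_simps)
        then have "dist (x + k *\<^sub>R d) (p + (X + k) *\<^sub>R d) = Y"
          using on XY by (simp add: dist_norm)
        then have "\<bar>w (x + k *\<^sub>R d) - w (p + (X + k) *\<^sub>R d)\<bar> \<le> \<Lambda> * Y"
          using lipschitz_onD[OF lip, of "x + k *\<^sub>R d" "p + (X + k) *\<^sub>R d"] by (simp add: dist_norm)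
        moreover have "\<Lambda> * Y \<le> \<Lambda> * \<epsilon>" using XY \<open>\<Lambda> \<ge> 0\<close> by (intro mult_left_mono) auto
        ultimately show ?thesis by linarith
      qed
      have "m \<le> w (p + (X + a) *\<^sub>R d) + 2 * w (p + X *\<^sub>R d) + w (p + (X - a) *\<^sub>R d)"
        using sd[of X] XY a by simp
      then have "m - 4 * \<Lambda> * \<epsilon> \<le> w (x + a *\<^sub>R d) + 2 * w x + w (x - a *\<^sub>R d)"
        using near[of a] near[of 0] near[of "- a"] by simp
      then show ?thesis using True mem[of a] mem[of 0] mem[of "- a"] a by simp
    qed
    have i1: "integrable lborel (\<lambda>x. indicator ?R (x + c) * w (x + c))" for c
      by (rule integrable_ind(1)[OF layer_sets])
    have i2: "integrable lborel (\<lambda>x. indicator ?R x * w x)" using i1[of 0] by simp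
    have m2: "(\<lambda>x. indicator ?R x * w x) \<in> borel_measurable borel"
      using borel_measurable_integrable[OF i2] by simp
    have cl: "{x. a \<le> (x - p) \<bullet> d \<and> (x - p) \<bullet> d \<le> 2 * a \<and> 0 \<le> (x - p) \<bullet> \<nu> \<and> (x - p) \<bullet> \<nu> \<le> e} \<in> lmeasurable"
      "measure lebesgue {x. a \<le> (x - p) \<bullet> d \<and> (x - p) \<bullet> d \<le> 2 * a \<and> 0 \<le> (x - p) \<bullet> \<nu> \<and> (x - p) \<bullet> \<nu> \<le> e} = a * e"
      if "0 \<le> e" for e
      using measure_rectangle[OF on, of a "2 * a" 0 e p] a that by auto
    have R'm: "?R' \<in> lmeasurable"
      by (rule fmeasurableI2[OF cl(1)[of \<epsilon>]]) (use \<epsilon> layer_sets[of a "2 * a" \<epsilon>] in \<open>auto simp: layer_def\<close>)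
    \<comment> \<open>A closed rectangle of half the height fits into the half-open layer, at the
      price of a factor 2.\<close>
    have mR': "a * \<epsilon> / 2 \<le> measure lebesgue ?R'"
    proof -
      have "a * (\<epsilon> / 2) \<le> measure lebesgue ?R'"
        using \<epsilon> unfolding cl(2)[of "\<epsilon> / 2", OF less_imp_le[OF half_gt_zero[OF \<epsilon>]], symmetric]
        by (intro measure_mono_fmeasurable R'm) (use cl(1)[of "\<epsilon> / 2"] in \<open>auto simp: layer_def\<close>)
      then show ?thesis by simp
    qed
    have "(m - 4 * \<Lambda> * \<epsilon>) * (a * \<epsilon> / 2) \<le> (m - 4 * \<Lambda> * \<epsilon>) * measure lebesgue ?R'"
      using n by (intro mult_left_mono mR') (simp add: \<epsilon>_def)
    also have "\<dots> = (LINT x|lborel. indicator ?R' x * (m - 4 * \<Lambda> * \<epsilon>))"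
      using layer_sets[of a "2 * a" \<epsilon>] by (simp add: mult.commute)
    also have "\<dots> \<le> (LINT x|lborel. indicator ?R (x + a *\<^sub>R d) * w (x + a *\<^sub>R d)
        + 2 * (indicator ?R x * w x) + indicator ?R (x + - (a *\<^sub>R d)) * w (x + - (a *\<^sub>R d)))"
    proof (rule integral_mono[OF _ _ pw])
      show "integrable lborel (\<lambda>x. indicator ?R' x * (m - 4 * \<Lambda> * \<epsilon>))"
        using layer_sets[of a "2 * a" \<epsilon>] R'm
        by (intro integrable_mult_left) (simp add: integrable_indicator_iff fmeasurable_def)
    qed (intro Bochner_Integration.integrable_add integrable_mult_right i1 i2)
    also have "\<dots> = (LINT x|lborel. indicator ?R (x + a *\<^sub>R d) * w (x + a *\<^sub>R d))
        + 2 * (LINT x|lborel. indicator ?R x * w x)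
        + (LINT x|lborel. indicator ?R (x + - (a *\<^sub>R d)) * w (x + - (a *\<^sub>R d)))"
      by (simp only: Bochner_Integration.integral_add Bochner_Integration.integrable_add
          integrable_mult_right integral_mult_right_zero i1 i2)
    also have "\<dots> = 4 * (LINT x|lborel. indicator ?R x * w x)"
      by (simp only: lborel_integral_translate[OF m2])
    finally have fin: "(m - 4 * \<Lambda> * \<epsilon>) * (a * \<epsilon> / 2) \<le> 4 * (LINT x|lborel. indicator ?R x * w x)" .
    have "(m - 4 * \<Lambda> * \<epsilon>) * a / 8 = (m - 4 * \<Lambda> * \<epsilon>) * (a * \<epsilon> / 2) * real (Suc n) / 4"
      by (simp add: \<epsilon>_def del: of_nat_Suc)
    also have "\<dots> \<le> 4 * (LINT x|lborel. indicator ?R x * w x) * real (Suc n) / 4"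
      using fin by (intro divide_right_mono mult_right_mono) auto
    finally show ?thesis by (simp add: \<epsilon>_def)
  qed
  have lim0: "(\<lambda>n. 1 / real (Suc n)) \<longlonglongrightarrow> 0"
    using LIMSEQ_inverse_real_of_nat by (simp add: inverse_eq_divide)
  have lim: "(\<lambda>n. 4 * \<Lambda> * (1 / real (Suc n))) \<longlonglongrightarrow> 4 * \<Lambda> * 0"
    by (intro tendsto_intros lim0)
  then have "\<forall>\<^sub>F n in sequentially. 4 * \<Lambda> * (1 / real (Suc n)) < m"
    using m by (intro order_tendstoD(2)) auto
  with layer_integral_eventually_le[OF \<eta>]
  have ev: "\<forall>\<^sub>F n in sequentially. (m - 4 * \<Lambda> * (1 / real (Suc n))) * a / 8 \<le> ?I + \<eta>"
    by eventually_elim (use step in \<open>meson less_imp_le order_trans\<close>)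
  have lm: "(\<lambda>n. (m - 4 * \<Lambda> * (1 / real (Suc n))) * a / 8) \<longlonglongrightarrow> (m - 4 * \<Lambda> * 0) * a / 8"
    by (intro tendsto_intros lim0) simp
  have "(m - 4 * \<Lambda> * 0) * a / 8 \<le> ?I + \<eta>"
    by (rule tendsto_upperbound[OF lm ev sequentially_bot])
  then show "m * L / 24 \<le> ?I + \<eta>" using a by (simp add: algebra_simps)
qed

end

section \<open>Finite element functions\<close>

lemma partition_cover:
  fixes t :: "nat \<Rightarrow> real"
  assumes "t 0 \<le> x" "x \<le> t (Suc N)"
  shows "\<exists>i\<le>N. t i \<le> x \<and> x \<le> t (Suc i)"
  using assms(2)
proof (induction N)
  case 0
  then show ?case using assms(1) by auto
next
  case (Suc N)
  show ?case
  proof (cases "x \<le> t (Suc N)")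
    case True
    then obtain i where "i \<le> N" "t i \<le> x \<and> x \<le> t (Suc i)" using Suc.IH by blast
    then show ?thesis by (intro exI[of _ i]) auto
  next
    case False
    then show ?thesis using Suc.prems by (intro exI[of _ "Suc N"]) auto
  qed
qed

lemma abs_diff_first_le_variation:
  fixes s :: "nat \<Rightarrow> real"
  shows "\<bar>s i - s 0\<bar> \<le> (\<Sum>j=1..i. \<bar>s j - s (j - 1)\<bar>)"
proof (induction i)
  case (Suc i)
  then show ?case by simp
qed simp

text \<open>Second differences annihilate the linear function \<open>s 0 * x\<close>. What remains
  has slopes \<open>s i - s 0\<close>, all at most \<open>V\<close> in absolute value, and is
  \<open>V\<close>-Lipschitz across the breakpoints.\<close>

lemma piecewise_affine_second_difference_le:
  fixes f t s c :: "_ \<Rightarrow> real"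
  assumes f: "\<And>i x. i \<le> N \<Longrightarrow> t i \<le> x \<Longrightarrow> x \<le> t (Suc i) \<Longrightarrow> f x = s i * x + c i"
    and V: "(\<Sum>i=1..N. \<bar>s i - s (i - 1)\<bar>) \<le> V"
    and x: "t 0 \<le> x - a" "x + a \<le> t (Suc N)" "0 \<le> a"
  shows "\<bar>f (x + a) - 2 * f x + f (x - a)\<bar> \<le> 2 * a * V"
proof -
  have V0: "0 \<le> V" by (rule order_trans[OF _ V]) (simp add: sum_nonneg)
  have sV: "\<bar>s i - s 0\<bar> \<le> V" if "i \<le> N" for i
  proof -
    have "(\<Sum>j=1..i. \<bar>s j - s (j - 1)\<bar>) \<le> (\<Sum>j=1..N. \<bar>s j - s (j - 1)\<bar>)"
      using that by (intro sum_mono2) auto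
    then show ?thesis using abs_diff_first_le_variation[of s i] V by linarith
  qed
  define k where "k x = f x - s 0 * x" for x
  have lip: "V-lipschitz_on {t 0..t (Suc N)} k"
  proof (rule lipschitz_on_closed_Union[where I = "{..N}" and U = "\<lambda>i. {t i..t (Suc i)}"])
    fix i assume i: "i \<in> {..N}"
    show "V-lipschitz_on {t i..t (Suc i)} k"
    proof (rule lipschitz_onI[OF _ V0])
      fix y z assume "y \<in> {t i..t (Suc i)}" "z \<in> {t i..t (Suc i)}"
      then have "k y - k z = (s i - s 0) * (y - z)"
        using f[of i y] f[of i z] i by (simp add: k_def algebra_simps)
      then show "dist (k y) (k z) \<le> V * dist y z"
        using mult_right_mono[OF sV[of i] abs_ge_zero[of "y - z"]] i
        by (simp add: dist_real_def abs_mult)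
    qed
  next
    show "{t 0..t (Suc N)} \<subseteq> (\<Union>i\<in>{..N}. {t i..t (Suc i)})"
      using partition_cover[of t] by fastforce
  qed (use V0 in auto)
  have "dist (k (x + a)) (k x) \<le> V * dist (x + a) x"
    by (rule lipschitz_onD[OF lip]) (use x in auto)
  moreover have "dist (k x) (k (x - a)) \<le> V * dist x (x - a)"
    by (rule lipschitz_onD[OF lip]) (use x in auto)
  ultimately have "\<bar>k (x + a) - k x\<bar> \<le> V * a" "\<bar>k x - k (x - a)\<bar> \<le> V * a"
    using x by (simp_all add: dist_real_def)
  moreover have "f (x + a) - 2 * f x + f (x - a) = (k (x + a) - k x) - (k x - k (x - a))"
    by (simp add: k_def algebra_simps)
  ultimately show ?thesis by (simp add: mult.commute)
qed

lemma u_quad_inner: "u_quad x = x \<bullet> x"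
  by (simp add: u_quad_def inner_vec_def sum_2 power2_eq_square)

lemma GDERIV_u_quad_diff_affine: "GDERIV (\<lambda>x. u_quad x - (a \<bullet> x + b)) x :> 2 *\<^sub>R x - a"
  unfolding gderiv_def u_quad_inner
  by (auto intro!: derivative_eq_intros simp: inner_commute algebra_simps)

locale fe_setting =
  fixes \<Omega> :: "plane set" and \<T> :: "plane set set" and U :: "plane \<Rightarrow> real" and h :: real
  assumes domain: "polygonal_lipschitz_domain \<Omega>"
    and triangulated: "conforming_triangulation \<Omega> \<T>"
    and mesh: "mesh_size \<T> = h"
    and fe: "U \<in> fe_space \<T>"
    and boundary: "\<exists>v. lagrange_interpolant \<T> u_quad v \<and> (\<forall>x\<in>frontier \<Omega>. U x = v x)"
begin

lemma finite_elements: "finite \<T>"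
  using triangulated by (auto simp: conforming_triangulation_def triangulation_def)

lemma union_elements: "\<Union>\<T> = closure \<Omega>"
  using triangulated by (simp add: conforming_triangulation_def)

lemma open_domain: "open \<Omega>"
  using domain by (simp add: polygonal_lipschitz_domain_def)

lemma element_hull:
  assumes "K \<in> \<T>"
  shows "compact K" "convex K" "K = convex hull {p. p extreme_point_of K}"
proof -
  have "2 simplex K" using triangulated assms by (auto simp: conforming_triangulation_def)
  then obtain C where C: "\<not> affine_dependent C" "K = convex hull C" by (auto simp: simplex_def)
  then have "finite C" using aff_independent_finite by blast
  then show "compact K" "convex K"
    using C by (simp_all add: finite_imp_compact_convex_hull)
  have "{p. p extreme_point_of K} = C"
    unfolding C(2) extreme_point_of_convex_hull_affine_independent[OF C(1)] by simp
  then show "K = convex hull {p. p extreme_point_of K}" using C(2) by simp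
qed

text \<open>The intersection is a face of both elements and a proper face of at least one; a proper
  face misses the interior.\<close>

lemma element_interiors_disjoint:
  assumes "K \<in> \<T>" "K' \<in> \<T>" "K \<noteq> K'"
  shows "interior K \<inter> interior K' = {}"
proof -
  have face: "(K \<inter> K') face_of K" "(K' \<inter> K) face_of K'"
    using triangulated assms by (auto simp: conforming_triangulation_def triangulation_def)
  show ?thesis
  proof (cases "K \<inter> K' = K")
    case False
    then have "(K \<inter> K') \<inter> interior K = {}" by (rule face_of_disjoint_interior[OF face(1)])
    then show ?thesis using interior_subset by blast
  next
    case True
    then have "K' \<inter> K \<noteq> K'" using assms by blast
    then have "(K' \<inter> K) \<inter> interior K' = {}" by (rule face_of_disjoint_interior[OF face(2)])
    then show ?thesis using interior_subset by blast
  qed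
qed

lemma element_diameter:
  assumes "K \<in> \<T>" "x \<in> K" "y \<in> K"
  shows "dist x y \<le> h"
proof -
  have "dist x y \<le> diameter K"
    using assms element_hull(1) by (intro diameter_bounded_bound compact_imp_bounded) auto
  also have "\<dots> \<le> h"
    using finite_elements assms(1) unfolding mesh[symmetric] mesh_size_def by (intro Max_ge) auto
  finally show ?thesis .
qed

definition slope :: "plane set \<Rightarrow> plane" where
  "slope K = (SOME a. \<exists>b. \<forall>x\<in>K. U x = a \<bullet> x + b)"

definition offset :: "plane set \<Rightarrow> real" where
  "offset K = (SOME b. \<forall>x\<in>K. U x = slope K \<bullet> x + b)"

lemma U_on_element:
  assumes "K \<in> \<T>" "x \<in> K"
  shows "U x = slope K \<bullet> x + offset K"
proof -
  have "\<exists>a b. \<forall>x\<in>K. U x = a \<bullet> x + b" using fe assms(1) by (auto simp: fe_space_def)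
  then have "\<exists>b. \<forall>x\<in>K. U x = slope K \<bullet> x + b" unfolding slope_def by (rule someI_ex)
  then have "\<forall>x\<in>K. U x = slope K \<bullet> x + offset K" unfolding offset_def by (rule someI_ex)
  then show ?thesis using assms(2) by blast
qed

sublocale piecewise_C1 \<T> "\<lambda>K x. u_quad x - (slope K \<bullet> x + offset K)" "\<lambda>K x. 2 *\<^sub>R x - slope K"
  "\<lambda>x. u_quad x - U x"
proof
  show "finite \<T>" by (rule finite_elements)
  show "compact K" "convex K" if "K \<in> \<T>" for K using element_hull[OF that] by auto
  show "interior K \<inter> interior K' = {}" if "K \<in> \<T>" "K' \<in> \<T>" "K \<noteq> K'" for K K'
    using that by (rule element_interiors_disjoint)
  show "continuous_on UNIV (\<lambda>x. 2 *\<^sub>R x - slope K)" for K by (intro continuous_intros)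
qed (simp_all only: GDERIV_u_quad_diff_affine U_on_element)

text \<open>Subtracting from the interpolant the tangent plane of u at \<open>x\<close> leaves an
  affine function whose value at a vertex \<open>p\<close> is the squared distance from
  \<open>p\<close> to \<open>x\<close>. It is between 0 and h^2 at the vertices, hence on the whole
  triangle, and at \<open>x\<close> it equals \<open>U x - u_quad x\<close>.\<close>

lemma boundary_error:
  assumes "x \<in> frontier \<Omega>"
  shows "\<bar>u_quad x - U x\<bar> \<le> h\<^sup>2"
proof -
  obtain v where v: "lagrange_interpolant \<T> u_quad v" "U x = v x" using boundary assms by blast
  obtain K where K: "K \<in> \<T>" "x \<in> K"
    using assms union_elements by (auto simp: frontier_def)
  have "\<exists>a b. \<forall>y\<in>K. v y = a \<bullet> y + b"
    using v(1) K(1) by (auto simp: lagrange_interpolant_def fe_space_def)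
  then obtain a b where ab: "\<And>y. y \<in> K \<Longrightarrow> v y = a \<bullet> y + b" by blast
  define c e where "c = a - 2 *\<^sub>R x" and "e = b + x \<bullet> x"
  have "{p. p extreme_point_of K} \<subseteq> {y. c \<bullet> y \<ge> - e} \<inter> {y. c \<bullet> y \<le> h\<^sup>2 - e}"
  proof
    fix p assume "p \<in> {p. p extreme_point_of K}"
    then have p: "p extreme_point_of K" "p \<in> K" by (auto simp: extreme_point_of_def)
    have "a \<bullet> p + b = p \<bullet> p"
      using v(1) K(1) p ab[of p] by (simp add: lagrange_interpolant_def u_quad_inner)
    then have "c \<bullet> p + e = (norm (p - x))\<^sup>2"
      by (simp add: c_def e_def power2_norm_eq_inner algebra_simps inner_commute)
    moreover have "(norm (p - x))\<^sup>2 \<le> h\<^sup>2"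
      using element_diameter[OF K(1) p(2) K(2)] by (intro power_mono) (auto simp: dist_norm)
    ultimately have "0 \<le> c \<bullet> p + e" "c \<bullet> p + e \<le> h\<^sup>2" by simp_all
    then show "p \<in> {y. c \<bullet> y \<ge> - e} \<inter> {y. c \<bullet> y \<le> h\<^sup>2 - e}"
      unfolding Int_iff mem_Collect_eq by linarith
  qed
  then have "convex hull {p. p extreme_point_of K} \<subseteq> {y. c \<bullet> y \<ge> - e} \<inter> {y. c \<bullet> y \<le> h\<^sup>2 - e}"
    by (intro hull_minimal convex_Int convex_halfspace_ge convex_halfspace_le)
  then have "x \<in> {y. c \<bullet> y \<ge> - e} \<inter> {y. c \<bullet> y \<le> h\<^sup>2 - e}"
    unfolding element_hull(3)[OF K(1), symmetric] using K(2) by (rule subsetD)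
  then have "0 \<le> c \<bullet> x + e" "c \<bullet> x + e \<le> h\<^sup>2" by auto
  moreover have "U x - u_quad x = c \<bullet> x + e"
    using v(2) ab[OF K(2)] by (simp add: c_def e_def u_quad_inner algebra_simps)
  ultimately show ?thesis by linarith
qed

lemma frontier_negligible: "negligible (frontier \<Omega>)"
proof -
  obtain S :: "(plane \<times> plane) set" where S: "finite S" "frontier \<Omega> = (\<Union>(a, b)\<in>S. closed_segment a b)"
    using domain by (auto simp: polygonal_lipschitz_domain_def)
  have "negligible (closed_segment a b)" for a b :: plane
  proof -
    have "interior (closed_segment a b) = {}" by (simp add: interior_closed_segment_ge2)
    then have "closed_segment a b = frontier (closed_segment a b)" by (simp add: frontier_def)
    then show ?thesis using negligible_convex_frontier[of "closed_segment a b"] by simp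
  qed
  then show ?thesis unfolding S(2) using S(1) by (intro negligible_Union) auto
qed

text \<open>The boundary is a null set and \<open>pgrad\<close> vanishes outside the closed domain.
  With the energy written over the plane, the strip of the trace estimate may leave the domain
  freely.\<close>

lemma h1_seminorm_domain:
  "(h1_seminorm \<Omega> (\<lambda>x. u_quad x - U x))\<^sup>2 = (LINT x|lborel. (norm (pgrad x))\<^sup>2)"
proof -
  have sub: "\<Omega> \<subseteq> \<Union>\<T>" using union_elements closure_subset by simp
  have "AE x in lebesgue. x \<notin> frontier \<Omega>"
    using frontier_negligible by (intro AE_not_in) (simp add: negligible_iff_null_sets)
  then have ae: "AE x in lborel. x \<notin> frontier \<Omega>" by (simp only: AE_completion_iff)
  have eq: "(LINT x|lborel. indicator \<Omega> x * (norm (pgrad x))\<^sup>2) = (LINT x|lborel. (norm (pgrad x))\<^sup>2)"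
  proof (rule integral_cong_AE)
    show "AE x in lborel. indicator \<Omega> x * (norm (pgrad x))\<^sup>2 = (norm (pgrad x))\<^sup>2"
      using ae
    proof eventually_elim
      case (elim x)
      show ?case
      proof (cases "x \<in> \<Omega>")
        case False
        then have "x \<notin> \<Union>\<T>" using elim union_elements interior_open[OF open_domain] by (auto simp: frontier_def)
        then show ?thesis using pgrad_outside[of x] by simp
      qed simp
    qed
  qed (use h1_seminorm_pgrad(2)[OF open_domain sub] integrable_pgrad_power in \<open>auto intro: borel_measurable_integrable\<close>)
  have "0 \<le> (LINT x|lborel. (norm (pgrad x))\<^sup>2)" by simp
  then show ?thesis unfolding h1_seminorm_pgrad(1)[OF open_domain sub] eq by simp
qed

lemma sum_element_integrals_le:
  fixes f :: "plane \<Rightarrow> real"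
  assumes B: "\<B> \<subseteq> \<T>" and M: "M \<in> sets borel" "\<And>K. K \<in> \<B> \<Longrightarrow> interior K \<subseteq> M"
    and f: "integrable lborel f" "\<And>x. 0 \<le> f x"
  shows "(\<Sum>K\<in>\<B>. LINT x|lborel. indicator (interior K) x * f x) \<le> (LINT x|lborel. indicator M x * f x)"
proof -
  have int: "integrable lborel (\<lambda>x. indicator S x * f x)" if "S \<in> sets borel" for S
    using integrable_mult_indicator[of S lborel f] that f(1) by simp
  have intK: "integrable lborel (\<lambda>x. indicator (interior K) x * f x)" for K by (rule int) simp
  have fin: "finite \<B>" using B finite_elements finite_subset by blast
  have le: "(\<Sum>K\<in>\<B>. indicator (interior K) x * f x) \<le> indicator M x * f x" for x
  proof (cases "\<exists>K\<in>\<B>. x \<in> interior K")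
    case True
    then obtain K where K: "K \<in> \<B>" "x \<in> interior K" by blast
    have "x \<notin> interior K'" if "K' \<in> \<B> - {K}" for K'
      using element_interiors_disjoint[of K K'] K that B by blast
    then have "(\<Sum>K'\<in>\<B> - {K}. indicator (interior K') x * f x) = 0" by (intro sum.neutral) auto
    then have "(\<Sum>K\<in>\<B>. indicator (interior K) x * f x) = indicator (interior K) x * f x"
      using sum.remove[OF fin K(1), of "\<lambda>K. indicator (interior K) x * f x"] by linarith
    then show ?thesis using K M(2)[OF K(1)] by auto
  next
    case False
    then have "(\<Sum>K\<in>\<B>. indicator (interior K) x * f x) = 0" by (intro sum.neutral) auto
    then show ?thesis using f(2)[of x] by simp
  qed
  have "(\<Sum>K\<in>\<B>. LINT x|lborel. indicator (interior K) x * f x) = (LINT x|lborel. (\<Sum>K\<in>\<B>. indicator (interior K) x * f x))"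
    by (rule Bochner_Integration.integral_sum[symmetric]) (rule intK)
  also have "\<dots> \<le> (LINT x|lborel. indicator M x * f x)"
    by (intro integral_mono le int M(1) Bochner_Integration.integrable_sum intK)
  finally show ?thesis .
qed

lemma measure_element: "K \<in> \<T> \<Longrightarrow> (LINT x|lborel. indicator (interior K) x) = measure lebesgue K"
proof -
  assume K: "K \<in> \<T>"
  have "measure lebesgue (interior K) = measure lebesgue K"
    using element_hull[OF K] by (intro measure_interior compact_imp_bounded negligible_convex_frontier)
  then show "(LINT x|lborel. indicator (interior K) x) = measure lebesgue K" by simp
qed

lemma sum_element_areas_le:
  assumes "\<B> \<subseteq> \<T>"
  shows "(\<Sum>K\<in>\<B>. measure lebesgue K) \<le> measure lebesgue (closure \<Omega>)"
proof -
  have c: "compact (closure \<Omega>)" using compact_union union_elements by simp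
  then have cs: "closure \<Omega> \<in> sets borel" by (simp add: borel_compact)
  have ic: "integrable lborel (indicator (closure \<Omega>) :: plane \<Rightarrow> real)"
    using borel_integrable_compact[OF c, of "\<lambda>x. 1 :: real"] by simp
  have "(\<Sum>K\<in>\<B>. measure lebesgue K)
      = (\<Sum>K\<in>\<B>. LINT x|lborel. indicator (interior K) x * (indicator (closure \<Omega>) x :: real))"
  proof (rule sum.cong[OF refl])
    fix K assume "K \<in> \<B>"
    then have K: "K \<in> \<T>" using assms by blast
    then have "interior K \<subseteq> closure \<Omega>" using interior_subset union_elements by blast
    then have "indicator (interior K) x * (indicator (closure \<Omega>) x :: real) = indicator (interior K) x" for x
      by (auto simp: indicator_def)
    then show "measure lebesgue K = (LINT x|lborel. indicator (interior K) x * (indicator (closure \<Omega>) x :: real))"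
      by (simp only: measure_element[OF K])
  qed
  also have "\<dots> \<le> (LINT x|lborel. indicator (closure \<Omega>) x * (indicator (closure \<Omega>) x :: real))"
    using assms union_elements interior_subset
    by (intro sum_element_integrals_le cs ic) (auto, blast)
  also have "\<dots> = measure lebesgue (closure \<Omega>)"
    using cs by (simp add: indicator_inter_arith[symmetric])
  finally show ?thesis .
qed

text \<open>The vector \<open>2 *\<^sub>R p\<close> is the gradient of u at \<open>p\<close>, and it
  varies by at most \<open>2 * h\<close> on the element. The constants 2 and 8 come from (a + b)^2
  \<le> 2 a^2 + 2 b^2 with b = 2 h, integrated over \<open>K\<close>.\<close>

lemma element_estimate:
  assumes K: "K \<in> \<T>" and p: "p \<in> K"
  shows "measure lebesgue K * (norm (slope K - 2 *\<^sub>R p))\<^sup>2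
    \<le> 2 * (LINT x|lborel. indicator (interior K) x * (norm (pgrad x))\<^sup>2) + 8 * h\<^sup>2 * measure lebesgue K"
proof -
  let ?\<delta> = "norm (slope K - 2 *\<^sub>R p)"
  have pw: "indicator (interior K) x * ?\<delta>\<^sup>2
      \<le> 2 * (indicator (interior K) x * (norm (pgrad x))\<^sup>2) + 8 * h\<^sup>2 * indicator (interior K) x" for x
  proof (cases "x \<in> interior K")
    case True
    then have x: "x \<in> K" using interior_subset by blast
    have "slope K - 2 *\<^sub>R p = (slope K - 2 *\<^sub>R x) + 2 *\<^sub>R (x - p)" by (simp add: algebra_simps)
    then have "?\<delta> \<le> norm (slope K - 2 *\<^sub>R x) + norm (2 *\<^sub>R (x - p))" by (metis norm_triangle_ineq)
    also have "\<dots> \<le> norm (pgrad x) + 2 * h"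
      using element_diameter[OF K x p] pgrad_interior[OF K True] by (simp add: dist_norm norm_minus_commute)
    finally have "?\<delta>\<^sup>2 \<le> (norm (pgrad x) + 2 * h)\<^sup>2" by (intro power_mono) auto
    also have "\<dots> \<le> 2 * (norm (pgrad x))\<^sup>2 + 8 * h\<^sup>2"
      using zero_le_power2[of "norm (pgrad x) - 2 * h"] by (simp add: power2_eq_square algebra_simps)
    finally show ?thesis using True by simp
  qed simp
  have i1: "integrable lborel (\<lambda>x. indicator (interior K) x * (norm (pgrad x))\<^sup>2)"
    using integrable_mult_indicator[of "interior K" lborel "\<lambda>x. (norm (pgrad x))\<^sup>2"] integrable_pgrad_power by simp
  have i2: "integrable lborel (indicator (interior K) :: plane \<Rightarrow> real)"
    using integrable_mult_indicator[of "interior K" lborel "indicator K :: plane \<Rightarrow> real"]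
      borel_integrable_compact[OF element_hull(1)[OF K], of "\<lambda>x. 1 :: real"] interior_subset[of K]
    by (simp add: indicator_inter_arith[symmetric] Int_absorb2)
  have "measure lebesgue K * ?\<delta>\<^sup>2 = (LINT x|lborel. indicator (interior K) x * ?\<delta>\<^sup>2)"
    by (simp only: integral_mult_left_zero measure_element[OF K])
  also have "\<dots> \<le> (LINT x|lborel. 2 * (indicator (interior K) x * (norm (pgrad x))\<^sup>2) + 8 * h\<^sup>2 * indicator (interior K) x)"
    by (intro integral_mono pw integrable_mult_left Bochner_Integration.integrable_add integrable_mult_right i1 i2)
  also have "\<dots> = 2 * (LINT x|lborel. indicator (interior K) x * (norm (pgrad x))\<^sup>2) + 8 * h\<^sup>2 * measure lebesgue K"
    by (simp only: Bochner_Integration.integral_add integrable_mult_right i1 i2 integral_mult_right_zero measure_element[OF K])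
  finally show ?thesis .
qed

end

section \<open>From the energy on the domain to the error on a segment\<close>

context fe_setting
begin

text \<open>Whatever the shape of the domain, the strip of height \<open>D1\<close> over the segment
  ends outside it, since \<open>D1\<close> exceeds all distances in its closure. Cauchy-Schwarz on
  this strip of area L D1 gives the factor \<open>sqrt (L * D1)\<close>, and 432 = 18 * 24.\<close>

lemma trace_bound:
  fixes d \<nu> p :: plane
  assumes on: "norm d = 1" "norm \<nu> = 1" "d \<bullet> \<nu> = 0" and L: "0 < L" and D1: "0 < D1"
    and line: "\<And>t. 0 \<le> t \<Longrightarrow> t \<le> L \<Longrightarrow> p + t *\<^sub>R d \<in> \<Union>\<T>"
    and diam: "\<And>x y. x \<in> \<Union>\<T> \<Longrightarrow> y \<in> \<Union>\<T> \<Longrightarrow> dist x y < D1"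
    and sd: "\<And>t. L / 3 \<le> t \<Longrightarrow> t \<le> 2 * L / 3 \<Longrightarrow>
      L\<^sup>2 / 9 \<le> \<bar>u_quad (p + (t + L / 3) *\<^sub>R d) - U (p + (t + L / 3) *\<^sub>R d)\<bar>
        + 2 * \<bar>u_quad (p + t *\<^sub>R d) - U (p + t *\<^sub>R d)\<bar>
        + \<bar>u_quad (p + (t - L / 3) *\<^sub>R d) - U (p + (t - L / 3) *\<^sub>R d)\<bar>"
    and hL: "72 * h\<^sup>2 \<le> L\<^sup>2"
    and c: "0 < c" "h1_seminorm \<Omega> (\<lambda>x. u_quad x - U x) \<le> c"
  shows "L ^ 3 \<le> 432 * (c * sqrt (L * D1))"
proof -
  define v where "v x = u_quad x - U x" for x
  \<comment> \<open>The interpolation error on the boundary is at most \<open>h\<^sup>2\<close>, so this truncation extends by zero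
    to a Lipschitz function on the plane.\<close>
  define w where "w x = (if x \<in> \<Union>\<T> then max 0 (\<bar>v x\<bar> - h\<^sup>2) else 0)" for x
  obtain R where R: "\<And>x. x \<in> \<Union>\<T> \<Longrightarrow> norm x \<le> R"
    using compact_imp_bounded[OF compact_union] by (auto simp: bounded_iff)
  obtain B where B: "\<And>x. norm (pgrad x) \<le> B" using pgrad_bounded by blast
  have w_nonneg: "0 \<le> w x" for x by (simp add: w_def)
  have w_diff: "\<bar>w x - w y\<bar> \<le> \<bar>v x - v y\<bar>" if "x \<in> \<Union>\<T>" "y \<in> \<Union>\<T>" for x y
    using that by (simp add: w_def)
  obtain \<Lambda> where \<Lambda>: "0 \<le> \<Lambda>" "\<And>K. K \<in> \<T> \<Longrightarrow> \<Lambda>-lipschitz_on K v"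
    using lipschitz_on_pieces[of "\<lambda>_. 1" "\<lambda>_. 0"] GDERIV_const[of 1] by (auto simp: v_def)
  have w_outer: "w x = 0" if "x \<in> closure (- \<Union>\<T>)" for x
  proof (cases "x \<in> \<Union>\<T>")
    case True
    have "x \<notin> interior (\<Union>\<T>)" using that by (simp add: closure_interior)
    moreover have "\<Omega> \<subseteq> interior (\<Union>\<T>)"
      unfolding union_elements by (intro interior_maximal closure_subset open_domain)
    ultimately have "x \<in> frontier \<Omega>"
      using True unfolding union_elements frontier_def interior_open[OF open_domain] by blast
    then have "\<bar>v x\<bar> \<le> h\<^sup>2" unfolding v_def by (rule boundary_error)
    then show ?thesis by (simp add: w_def)
  qed (simp add: w_def)
  have lip: "\<Lambda>-lipschitz_on UNIV w"
  proof (rule lipschitz_on_finite_closed_cover[of "insert (closure (- \<Union>\<T>)) \<T>"])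
    have "\<Lambda>-lipschitz_on (closure (- \<Union>\<T>)) w"
      using \<Lambda>(1) w_outer by (auto simp: lipschitz_on_def)
    moreover have "\<Lambda>-lipschitz_on K w" if K: "K \<in> \<T>" for K
    proof (rule lipschitz_onI[OF _ \<Lambda>(1)])
      fix x y assume xy: "x \<in> K" "y \<in> K"
      then have "\<bar>w x - w y\<bar> \<le> \<bar>v x - v y\<bar>" using K by (intro w_diff) auto
      also have "\<dots> \<le> \<Lambda> * dist x y" using lipschitz_onD[OF \<Lambda>(2)[OF K] xy] by (simp add: dist_real_def)
      finally show "dist (w x) (w y) \<le> \<Lambda> * dist x y" by (simp add: dist_real_def)
    qed
    ultimately show "\<Lambda>-lipschitz_on X w" if "X \<in> insert (closure (- \<Union>\<T>)) \<T>" for X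
      using that by auto
    show "closed X" if "X \<in> insert (closure (- \<Union>\<T>)) \<T>" for X
      using that element_hull(1) compact_imp_closed by auto
    show "\<Union> (insert (closure (- \<Union>\<T>)) \<T>) = UNIV"
      using closure_subset[of "- \<Union>\<T>"] by auto
  qed (use finite_elements \<Lambda> in auto)
  have cont: "continuous_on UNIV w" by (rule lipschitz_on_continuous_on[OF lip])
  have wint: "integrable lborel w"
  proof -
    have "integrable lborel (\<lambda>x. indicator (\<Union>\<T>) x *\<^sub>R w x)"
      by (rule borel_integrable_compact[OF compact_union continuous_on_subset[OF cont subset_UNIV]])
    moreover have "indicator (\<Union>\<T>) x *\<^sub>R w x = w x" for x by (simp add: w_def indicator_def)
    ultimately show ?thesis by (simp only:)
  qed
  have top: "w x = 0" if x: "0 \<le> (x - p) \<bullet> d" "(x - p) \<bullet> d \<le> L" "D1 \<le> (x - p) \<bullet> \<nu>" for x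
  proof -
    have "x - (p + ((x - p) \<bullet> d) *\<^sub>R d) = ((x - p) \<bullet> \<nu>) *\<^sub>R \<nu>"
      using plane_frame[OF on, of "x - p"] by (simp add: algebra_simps)
    then have "dist x (p + ((x - p) \<bullet> d) *\<^sub>R d) = (x - p) \<bullet> \<nu>"
      using x(3) D1 on by (simp add: dist_norm)
    then have "x \<notin> \<Union>\<T>" using diam[OF _ line[OF x(1,2)], of x] x(3) by auto
    then show ?thesis by (simp add: w_def)
  qed
  have seq0: "(\<lambda>n. x + (1 / real (Suc n)) *\<^sub>R \<nu>) \<longlonglongrightarrow> x" for x
  proof -
    have "(\<lambda>n. 1 / real (Suc n)) \<longlonglongrightarrow> 0"
      using LIMSEQ_inverse_real_of_nat by (simp add: inverse_eq_divide)
    then have "(\<lambda>n. x + (1 / real (Suc n)) *\<^sub>R \<nu>) \<longlonglongrightarrow> x + 0 *\<^sub>R \<nu>" by (intro tendsto_intros)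
    then show ?thesis by simp
  qed
  \<comment> \<open>Absolute value and truncation do not increase differences, so the quotients of
    \<open>w\<close> are bounded by those of \<open>v\<close>, which converge to the derivative of
    \<open>v\<close> in direction \<nu>. Outside the closed domain \<open>w\<close> vanishes
    locally.\<close>
  have slope: "AE x in lborel. \<forall>\<eta>>0. \<forall>\<^sub>F n in sequentially.
      \<bar>w (x + (1 / real (Suc n)) *\<^sub>R \<nu>) - w x\<bar> * real (Suc n) \<le> norm (pgrad x) + \<eta>"
    using AE_interior
  proof eventually_elim
    case (elim x)
    show ?case
    proof (intro allI impI)
      fix \<eta> :: real assume \<eta>: "0 < \<eta>"
      show "\<forall>\<^sub>F n in sequentially. \<bar>w (x + (1 / real (Suc n)) *\<^sub>R \<nu>) - w x\<bar> * real (Suc n) \<le> norm (pgrad x) + \<eta>"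
      proof (cases "x \<in> \<Union>\<T>")
        case True
        then obtain K where K: "K \<in> \<T>" "x \<in> interior K" using elim by blast
        have "(\<lambda>n. (v (x + (1 / real (Suc n)) *\<^sub>R \<nu>) - v x) * real (Suc n)) \<longlonglongrightarrow> \<nu> \<bullet> pgrad x"
          using GDERIV_difference_quotient_LIMSEQ[OF GDERIV_interior[OF K]] unfolding v_def .
        then have "(\<lambda>n. \<bar>(v (x + (1 / real (Suc n)) *\<^sub>R \<nu>) - v x) * real (Suc n)\<bar>) \<longlonglongrightarrow> \<bar>\<nu> \<bullet> pgrad x\<bar>"
          by (rule tendsto_rabs)
        moreover have "\<bar>\<nu> \<bullet> pgrad x\<bar> < norm (pgrad x) + \<eta>"
          using Cauchy_Schwarz_ineq2[of \<nu> "pgrad x"] on \<eta> by simp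
        ultimately have "\<forall>\<^sub>F n in sequentially. \<bar>(v (x + (1 / real (Suc n)) *\<^sub>R \<nu>) - v x) * real (Suc n)\<bar> < norm (pgrad x) + \<eta>"
          by (rule order_tendstoD(2))
        moreover have "\<forall>\<^sub>F n in sequentially. x + (1 / real (Suc n)) *\<^sub>R \<nu> \<in> interior K"
          by (rule topological_tendstoD[OF seq0 open_interior K(2)])
        ultimately show ?thesis
        proof eventually_elim
          case (elim n)
          then have "x + (1 / real (Suc n)) *\<^sub>R \<nu> \<in> \<Union>\<T>" using K(1) interior_subset by blast
          from mult_right_mono[OF w_diff[OF this True] of_nat_0_le_iff[of "Suc n"]]
          show ?case using elim(1) by (simp only: abs_mult abs_of_nat)
        qed
      next
        case False
        have "open (- \<Union>\<T>)" using compact_imp_closed[OF compact_union] by (simp add: open_Compl)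
        then have "\<forall>\<^sub>F n in sequentially. x + (1 / real (Suc n)) *\<^sub>R \<nu> \<in> - \<Union>\<T>"
          using False by (intro topological_tendstoD[OF seq0]) auto
        then show ?thesis
        proof eventually_elim
          case (elim n)
          then have "w (x + (1 / real (Suc n)) *\<^sub>R \<nu>) = 0" "w x = 0" using False by (simp_all add: w_def)
          then show ?case using \<eta> by simp
        qed
      qed
    qed
  qed
  have gm: "(\<lambda>x. norm (pgrad x)) \<in> borel_measurable borel" using pgrad_measurable by measurable
  \<comment> \<open>Truncation costs h^2 for each of the weights 1 + 2 + 1. By \<open>hL\<close>
    this is at most half of L^2 / 9, leaving L^2 / 18.\<close>
  define m where "m = L\<^sup>2 / 9 - 4 * h\<^sup>2"
  have m: "0 < m" "L\<^sup>2 / 18 \<le> m"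
    using hL zero_less_power[OF L, of 2] unfolding m_def by linarith+
  have sdw: "m \<le> w (p + (t + L / 3) *\<^sub>R d) + 2 * w (p + t *\<^sub>R d) + w (p + (t - L / 3) *\<^sub>R d)"
    if t: "L / 3 \<le> t" "t \<le> 2 * L / 3" for t
  proof -
    have wv: "\<bar>v (p + s *\<^sub>R d)\<bar> - h\<^sup>2 \<le> w (p + s *\<^sub>R d)" if "0 \<le> s" "s \<le> L" for s
      using line[OF that] by (simp add: w_def)
    have "\<bar>v (p + (t + L / 3) *\<^sub>R d)\<bar> - h\<^sup>2 \<le> w (p + (t + L / 3) *\<^sub>R d)"
      "\<bar>v (p + t *\<^sub>R d)\<bar> - h\<^sup>2 \<le> w (p + t *\<^sub>R d)"
      "\<bar>v (p + (t - L / 3) *\<^sub>R d)\<bar> - h\<^sup>2 \<le> w (p + (t - L / 3) *\<^sub>R d)"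
      using t L by (intro wv; linarith)+
    moreover have "l - 4 * k \<le> x + 2 * y + z"
      if "a - k \<le> x" "b - k \<le> y" "c - k \<le> z" "l \<le> a + 2 * b + c" for a b c k l x y z :: real
      using that by linarith
    ultimately show ?thesis using sd[OF t] unfolding v_def m_def by blast
  qed
  let ?S = "strip d \<nu> p L D1"
  have main: "m * L / 24 \<le> (LINT x|lborel. indicator ?S x * norm (pgrad x))"
    by (rule second_difference_le_strip_integral[OF on L D1 lip w_nonneg wint top gm norm_ge_zero B slope m(1) sdw])
  define A where "A = L * D1"
  have A: "0 < A" using L D1 by (simp add: A_def)
  have S: "?S \<in> sets borel" "?S \<in> lmeasurable" "measure lebesgue ?S = A"
    using strip_sets[OF on L D1 lip w_nonneg wint top gm norm_ge_zero B slope] by (auto simp: A_def)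
  \<comment> \<open>the weight that makes the arithmetic-geometric mean inequality give Cauchy-Schwarz\<close>
  define \<kappa> where "\<kappa> = c / sqrt A"
  have \<kappa>: "0 < \<kappa>" using c A by (simp add: \<kappa>_def)
  have iS: "integrable lborel (indicator ?S :: plane \<Rightarrow> real)"
    using S(1,2) by (simp add: integrable_indicator_iff fmeasurable_def)
  have pw: "indicator ?S x * norm (pgrad x) \<le> \<kappa> / 2 * indicator ?S x + 1 / (2 * \<kappa>) * (norm (pgrad x))\<^sup>2" for x
  proof (cases "x \<in> ?S")
    case True
    have "0 \<le> (\<kappa> - norm (pgrad x))\<^sup>2 / (2 * \<kappa>)" using \<kappa> by simp
    also have "\<dots> = \<kappa> / 2 + 1 / (2 * \<kappa>) * (norm (pgrad x))\<^sup>2 - norm (pgrad x)"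
      using \<kappa> by (simp add: field_simps power2_eq_square)
    finally show ?thesis using True by simp
  qed (use \<kappa> in simp)
  have "(LINT x|lborel. indicator ?S x * norm (pgrad x))
      \<le> (LINT x|lborel. \<kappa> / 2 * indicator ?S x + 1 / (2 * \<kappa>) * (norm (pgrad x))\<^sup>2)"
  proof (rule integral_mono[OF _ _ pw])
    show "integrable lborel (\<lambda>x. indicator ?S x * norm (pgrad x))"
      using B by (intro integrable_indicator_mult_bounded[OF S(1) subset_refl S(2,1) gm, where B = B]) simp
  qed (intro Bochner_Integration.integrable_add integrable_mult_right iS integrable_pgrad_power)
  also have "\<dots> = \<kappa> / 2 * A + 1 / (2 * \<kappa>) * (LINT x|lborel. (norm (pgrad x))\<^sup>2)"
  proof -
    have "(LINT x|lborel. indicator ?S x) = A" using S by simp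
    then show ?thesis
      by (simp only: Bochner_Integration.integral_add integrable_mult_right iS integrable_pgrad_power integral_mult_right_zero)
  qed
  also have "\<dots> \<le> \<kappa> / 2 * A + 1 / (2 * \<kappa>) * c\<^sup>2"
  proof -
    have "0 \<le> h1_seminorm \<Omega> (\<lambda>x. u_quad x - U x)"
      unfolding h1_seminorm_pgrad(1)[OF open_domain closure_subset[of \<Omega>, folded union_elements]] by simp
    then have "(LINT x|lborel. (norm (pgrad x))\<^sup>2) \<le> c\<^sup>2"
      unfolding h1_seminorm_domain[symmetric] using c by (intro power_mono) auto
    then show ?thesis using \<kappa> by (intro add_left_mono mult_left_mono) auto
  qed
  also have "\<dots> = c * sqrt A"
  proof -
    have "\<kappa> * sqrt A = c" "sqrt A * sqrt A = A" using A by (simp_all add: \<kappa>_def)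
    then have "\<kappa> * A = c * sqrt A" by (metis mult.assoc)
    then have "\<kappa> / 2 * A = c * sqrt A / 2" by simp
    moreover have "1 / (2 * \<kappa>) * c\<^sup>2 = c * sqrt A / 2"
      using c A by (simp add: \<kappa>_def power2_eq_square)
    ultimately show ?thesis by simp
  qed
  finally have "m * L / 24 \<le> c * sqrt A" using main by linarith
  moreover have "L\<^sup>2 / 18 * L \<le> m * L" using m(2) L by (intro mult_right_mono) auto
  ultimately have "L\<^sup>2 * L \<le> 432 * (c * sqrt A)" by linarith
  then show ?thesis by (simp add: A_def power3_eq_cube power2_eq_square)
qed

end

section \<open>The band\<close>

text \<open>Absorbs surplus powers of \<open>h\<close> into a constant depending on
  \<open>h0\<close> only; used with the exponents 1 - 2 \<alpha> / 5 and 1 - \<alpha>.\<close>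

lemma powr_le_max_one:
  fixes h h0 \<beta> :: real
  assumes "0 < h" "h < h0" "0 \<le> \<beta>" "\<beta> \<le> 1"
  shows "h powr \<beta> \<le> max 1 h0"
proof (cases "h \<le> 1")
  case True
  then have "h powr \<beta> \<le> 1 powr \<beta>" using assms by (intro powr_mono2) auto
  then show ?thesis by simp
next
  case False
  then have "h powr \<beta> \<le> h powr 1" using assms by (intro powr_mono) auto
  then show ?thesis using assms by simp
qed

locale fe_band = fe_setting +
  fixes N :: nat and P Q :: "nat \<Rightarrow> plane" and d \<nu> :: plane and t :: "nat \<Rightarrow> real"
  assumes band: "is_band \<T> N P Q"
    and frame: "norm d = 1" "norm \<nu> = 1" "d \<bullet> \<nu> = 0"
    and t_mono: "strict_mono_on {..Suc N} t"
    and P_eq: "\<And>i. i \<le> Suc N \<Longrightarrow> P i = P 0 + t i *\<^sub>R d"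
    and Q_side: "\<And>i. i \<le> N \<Longrightarrow> 0 < (Q i - P 0) \<bullet> \<nu>"
begin

lemma t_0: "t 0 = 0"
proof -
  have "t 0 *\<^sub>R d = 0" using P_eq[of 0] by simp
  then show ?thesis using frame by auto
qed

lemma t_less: "i \<le> N \<Longrightarrow> t i < t (Suc i)"
  using t_mono by (auto simp: strict_mono_on_def)

lemma P_step: "i \<le> N \<Longrightarrow> P (Suc i) = P i + (t (Suc i) - t i) *\<^sub>R d"
  using P_eq[of i] P_eq[of "Suc i"] by (simp add: algebra_simps)

lemma dist_P_step: "i \<le> N \<Longrightarrow> dist (P i) (P (Suc i)) = t (Suc i) - t i"
  using P_step[of i] t_less[of i] frame by (simp add: dist_norm)

lemma band_length_eq: "band_length N P = t (Suc N)"
proof -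
  have "(\<Sum>i\<le>N. dist (P i) (P (Suc i))) = (\<Sum>i<Suc N. t (Suc i) - t i)"
    by (rule sum.cong) (auto simp: dist_P_step)
  then show ?thesis unfolding band_length_def sum_lessThan_telescope using t_0 by simp
qed

lemma band_length_pos: "0 < band_length N P"
  using strict_mono_onD[OF t_mono, of 0 "Suc N"] t_0 unfolding band_length_eq by simp

definition element_slope :: "nat \<Rightarrow> real" where
  "element_slope i = slope (tri_K P Q i) \<bullet> d"

definition variation :: real where
  "variation = (\<Sum>i=1..N. \<bar>element_slope i - element_slope (i - 1)\<bar>)"

lemma elements: "i \<le> N \<Longrightarrow> tri_K P Q i \<in> \<T>" "i \<in> {1..N} \<Longrightarrow> tri_Kt P Q i \<in> \<T>"
  using band by (auto simp: is_band_def)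

lemma vertices_K: "P i \<in> tri_K P Q i" "P (Suc i) \<in> tri_K P Q i" "Q i \<in> tri_K P Q i"
  unfolding tri_K_def by (simp_all add: hull_inc)

lemma vertices_Kt: "Q (i - 1) \<in> tri_Kt P Q i" "Q i \<in> tri_Kt P Q i" "P i \<in> tri_Kt P Q i"
  unfolding tri_Kt_def by (simp_all add: hull_inc)

lemma base_line:
  assumes "i \<le> N" "t i \<le> x" "x \<le> t (Suc i)"
  shows "P 0 + x *\<^sub>R d \<in> tri_K P Q i"
proof -
  define k where "k = (x - t i) / (t (Suc i) - t i)"
  have pos: "0 < t (Suc i) - t i" using t_less[OF assms(1)] by simp
  have k: "0 \<le> k" "k \<le> 1" "k * (t (Suc i) - t i) = x - t i"
    using pos assms by (simp_all add: k_def)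
  have "P 0 + x *\<^sub>R d = P i + (x - t i) *\<^sub>R d"
    using P_eq[of i] assms(1) by (simp add: algebra_simps)
  also have "\<dots> = P i + k *\<^sub>R ((t (Suc i) - t i) *\<^sub>R d)" by (simp add: k(3))
  also have "\<dots> = (1 - k) *\<^sub>R P i + k *\<^sub>R P (Suc i)"
    by (simp add: P_step[OF assms(1)] algebra_simps)
  also have "\<dots> \<in> tri_K P Q i"
    using k vertices_K[of i] element_hull(2)[OF elements(1)[OF assms(1)]]
    by (intro convexD) auto
  finally show ?thesis .
qed

text \<open>The 6 comes from the step a = L / 3: if the variation is below L / 6 = a / 2, second
  differences of \<open>U\<close> are at most a^2, half of the 2 a^2 of u, so those of the error are
  at least a^2 = L^2 / 9.\<close>

lemma variation_ge:
  assumes D1: "0 < D1" "\<And>x y. x \<in> \<Union>\<T> \<Longrightarrow> y \<in> \<Union>\<T> \<Longrightarrow> dist x y < D1"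
    and hL: "72 * h\<^sup>2 \<le> (band_length N P)\<^sup>2"
    and c: "0 < c" "h1_seminorm \<Omega> (\<lambda>x. u_quad x - U x) \<le> c"
    and large: "432 * (c * sqrt (band_length N P * D1)) < band_length N P ^ 3"
  shows "band_length N P / 6 \<le> variation"
proof (rule ccontr)
  assume small: "\<not> band_length N P / 6 \<le> variation"
  define L where "L = band_length N P"
  have L: "0 < L" "L = t (Suc N)" using band_length_pos band_length_eq by (auto simp: L_def)
  have line: "P 0 + x *\<^sub>R d \<in> \<Union>\<T>" if x: "0 \<le> x" "x \<le> L" for x
  proof -
    obtain i where i: "i \<le> N" "t i \<le> x" "x \<le> t (Suc i)"
      using partition_cover[of t x N] x t_0 L by auto
    show ?thesis using base_line[OF i] elements(1)[OF i(1)] by blast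
  qed
  have U_line: "U (P 0 + x *\<^sub>R d) = element_slope i * x + (slope (tri_K P Q i) \<bullet> P 0 + offset (tri_K P Q i))"
    if i: "i \<le> N" "t i \<le> x" "x \<le> t (Suc i)" for i x
    using U_on_element[OF elements(1)[OF i(1)] base_line[OF i]]
    by (simp add: element_slope_def algebra_simps)
  have "L ^ 3 \<le> 432 * (c * sqrt (L * D1))"
  proof (rule trace_bound[OF frame L(1) D1(1) line D1(2) _ hL[folded L_def] c])
    fix x assume x: "L / 3 \<le> x" "x \<le> 2 * L / 3"
    define a where "a = L / 3"
    have a: "0 < a" using L by (simp add: a_def)
    let ?u = "\<lambda>x. u_quad (P 0 + x *\<^sub>R d)" and ?U = "\<lambda>x. U (P 0 + x *\<^sub>R d)"
    have "\<bar>?U (x + a) - 2 * ?U x + ?U (x - a)\<bar> \<le> 2 * a * variation"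
      by (rule piecewise_affine_second_difference_le[where N = N and t = t, OF U_line])
         (use x L t_0 in \<open>auto simp: variation_def a_def\<close>)
    also have "\<dots> \<le> 2 * a * (a / 2)"
      using small a by (intro mult_left_mono) (auto simp: a_def L_def)
    finally have "\<bar>?U (x + a) - 2 * ?U x + ?U (x - a)\<bar> \<le> a\<^sup>2" by (simp add: power2_eq_square)
    moreover have "?u (x + a) - 2 * ?u x + ?u (x - a) = 2 * a\<^sup>2"
    proof -
      have dd: "d \<bullet> d = 1" using frame by (simp add: norm_eq_1)
      have u_line: "?u s = P 0 \<bullet> P 0 + 2 * s * (P 0 \<bullet> d) + s * s" for s
        by (simp add: u_quad_inner inner_add_left inner_add_right inner_commute[of d "P 0"] dd distrib_left)
      show ?thesis unfolding u_line by (simp add: power2_eq_square algebra_simps)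
    qed
    moreover have "q \<le> \<bar>x1 - y1\<bar> + 2 * \<bar>x2 - y2\<bar> + \<bar>x3 - y3\<bar>"
      if "\<bar>y1 - 2 * y2 + y3\<bar> \<le> q" "x1 - 2 * x2 + x3 = 2 * q" for q x1 x2 x3 y1 y2 y3 :: real
    proof -
      have "q \<le> (x1 - y1) + 2 * - (x2 - y2) + (x3 - y3)"
        using abs_le_D1[OF that(1)] that(2) by simp
      also have "\<dots> \<le> \<bar>x1 - y1\<bar> + 2 * \<bar>x2 - y2\<bar> + \<bar>x3 - y3\<bar>"
        by (intro add_mono mult_left_mono abs_ge_self abs_ge_minus_self) simp
      finally show ?thesis .
    qed
    ultimately have "a\<^sup>2 \<le> \<bar>?u (x + a) - ?U (x + a)\<bar> + 2 * \<bar>?u x - ?U x\<bar> + \<bar>?u (x - a) - ?U (x - a)\<bar>"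
      by blast
    then show "L\<^sup>2 / 9 \<le> \<bar>?u (x + L / 3) - ?U (x + L / 3)\<bar> + 2 * \<bar>?u x - ?U x\<bar> + \<bar>?u (x - L / 3) - ?U (x - L / 3)\<bar>"
      unfolding a_def by (simp add: power_divide)
  qed
  then show False using large by (simp add: L_def)
qed

text \<open>Inserting the common vector \<open>2 *\<^sub>R P i\<close>, the gradient of u at the
  vertex, splits the jumps of \<open>kink_bound\<close> into separate errors of the three triangles,
  each controlled by the energy on its own triangle.\<close>

lemma kink_square_le:
  assumes i: "i \<in> {1..N}"
  shows "0 < sin (pi - ang_Kt P Q i)"
    and "(element_slope i - element_slope (i - 1))\<^sup>2 \<le> 24 * (sin (pi - ang_Kt P Q i))\<^sup>2 *
      ((norm (slope (tri_K P Q i) - 2 *\<^sub>R P i))\<^sup>2 + (norm (slope (tri_Kt P Q i) - 2 *\<^sub>R P i))\<^sup>2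
        + (norm (slope (tri_K P Q (i - 1)) - 2 *\<^sub>R P i))\<^sup>2)"
proof -
  define j where "j = i - 1"
  have ij: "i = Suc j" "i \<le> N" "j \<le> N" using i by (auto simp: j_def)
  have Pi_\<nu>: "(P i - P 0) \<bullet> \<nu> = 0" using P_eq[of i] ij frame by simp
  have Kj: "P i \<in> tri_K P Q j" using vertices_K(2)[of j] ij by simp
  have Ktj: "Q j \<in> tri_Kt P Q i" using vertices_Kt(1)[of i] ij by simp
  let ?g1 = "slope (tri_K P Q i)" and ?gt = "slope (tri_Kt P Q i)" and ?g0 = "slope (tri_K P Q j)"
  have side: "0 < (Q j - P i) \<bullet> \<nu>" "0 < (Q i - P i) \<bullet> \<nu>"
    using Q_side[of j] Q_side[of i] ij Pi_\<nu> by (simp_all add: inner_diff_left)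
  have len: "0 < t i - t j" "0 < t (Suc i) - t i" using t_less[of j] t_less[of i] ij by simp_all
  have "P i - (t i - t j) *\<^sub>R d = P j" using P_step[of j] ij by simp
  moreover have "dist (P j) (Q j) \<le> dist (P j) (P (Suc j))" using band ij by (auto simp: is_band_def)
  ultimately have dist0: "dist (P i - (t i - t j) *\<^sub>R d) (Q j) \<le> t i - t j" using dist_P_step[of j] ij by simp
  have "P i + (t (Suc i) - t i) *\<^sub>R d = P (Suc i)" using P_step[of i] ij by simp
  moreover have "dist (P (Suc i)) (Q i) \<le> dist (P i) (P (Suc i))" using band ij by (auto simp: is_band_def)
  ultimately have dist1: "dist (P i + (t (Suc i) - t i) *\<^sub>R d) (Q i) \<le> t (Suc i) - t i" using dist_P_step[of i] ij by simp
  have "vertex_angle (P i) (Q (i - 1)) (Q i) \<le> ang_Kt P Q i \<and> vertex_angle (P i) (Q i) (Q (i - 1)) \<le> ang_Kt P Q i"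
    using band i unfolding is_band_def by blast
  then have angles: "vertex_angle (P i) (Q j) (Q i) \<le> vertex_angle (Q j) (P i) (Q i)"
    "vertex_angle (P i) (Q i) (Q j) \<le> vertex_angle (Q j) (P i) (Q i)"
    by (simp_all add: ang_Kt_def j_def)
  have Ki: "tri_K P Q i \<in> \<T>" "tri_Kt P Q i \<in> \<T>" "tri_K P Q j \<in> \<T>"
    using elements(1)[OF ij(2)] elements(2)[OF i] elements(1)[OF ij(3)] by auto
  \<comment> \<open>Both affine functions take the values of \<open>U\<close> at the two ends of the
    common edge, so the difference of their gradients is orthogonal to it.\<close>
  have edge1: "(?g1 - ?gt) \<bullet> (Q i - P i) = 0"
    using U_on_element[OF Ki(1) vertices_K(1)] U_on_element[OF Ki(1) vertices_K(3)]
      U_on_element[OF Ki(2) vertices_Kt(2)] U_on_element[OF Ki(2) vertices_Kt(3)]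
    by (simp add: inner_diff_left inner_diff_right)
  have edge0: "(?gt - ?g0) \<bullet> (Q j - P i) = 0"
    using U_on_element[OF Ki(3) Kj] U_on_element[OF Ki(3) vertices_K(3)]
      U_on_element[OF Ki(2) Ktj] U_on_element[OF Ki(2) vertices_Kt(3)]
    by (simp add: inner_diff_left inner_diff_right)
  from kink_bound[OF frame side len dist0 dist1 angles edge1 edge0]
  have \<sigma>: "0 < sin (pi - ang_Kt P Q i)" and
    kink: "\<bar>element_slope i - element_slope j\<bar> \<le> 2 * sin (pi - ang_Kt P Q i) * (norm (?g1 - ?gt) + norm (?gt - ?g0))"
    by (simp_all only: ang_Kt_def j_def[symmetric] element_slope_def inner_diff_left)
  then show "0 < sin (pi - ang_Kt P Q i)" by simp
  define x y z where "x = norm (?g1 - 2 *\<^sub>R P i)" and "y = norm (?gt - 2 *\<^sub>R P i)" and "z = norm (?g0 - 2 *\<^sub>R P i)"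
  have "norm (?g1 - ?gt) \<le> x + y" "norm (?gt - ?g0) \<le> y + z"
    using norm_triangle_ineq4[of "?g1 - 2 *\<^sub>R P i" "?gt - 2 *\<^sub>R P i"]
      norm_triangle_ineq4[of "?gt - 2 *\<^sub>R P i" "?g0 - 2 *\<^sub>R P i"] by (simp_all add: x_def y_def z_def)
  then have "\<bar>element_slope i - element_slope j\<bar> \<le> 2 * sin (pi - ang_Kt P Q i) * (x + 2 * y + z)"
    using \<sigma> by (intro order_trans[OF kink] mult_left_mono) auto
  then have "\<bar>element_slope i - element_slope j\<bar>\<^sup>2 \<le> (2 * sin (pi - ang_Kt P Q i) * (x + 2 * y + z))\<^sup>2"
    by (rule power_mono) simp
  also have "\<dots> = 4 * (sin (pi - ang_Kt P Q i))\<^sup>2 * (x + 2 * y + z)\<^sup>2" by (simp add: power_mult_distrib)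
  \<comment> \<open>The middle triangle takes part in both jumps, hence its weight 2. Cauchy-Schwarz
    gives 6 = 1 + 4 + 1, and 4 * 6 = 24.\<close>
  also have "\<dots> \<le> 4 * (sin (pi - ang_Kt P Q i))\<^sup>2 * (6 * (x\<^sup>2 + y\<^sup>2 + z\<^sup>2))"
  proof (intro mult_left_mono)
    have "6 * (x\<^sup>2 + y\<^sup>2 + z\<^sup>2) - (x + 2 * y + z)\<^sup>2 = (y - 2 * x)\<^sup>2 + (y - 2 * z)\<^sup>2 + (x - z)\<^sup>2" by algebra
    then show "(x + 2 * y + z)\<^sup>2 \<le> 6 * (x\<^sup>2 + y\<^sup>2 + z\<^sup>2)"
      using zero_le_power2[of "y - 2 * x"] zero_le_power2[of "y - 2 * z"] zero_le_power2[of "x - z"] by linarith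
  qed simp
  also have "\<dots> = 24 * (sin (pi - ang_Kt P Q i))\<^sup>2 * (x\<^sup>2 + y\<^sup>2 + z\<^sup>2)" by simp
  finally show "(element_slope i - element_slope (i - 1))\<^sup>2 \<le> 24 * (sin (pi - ang_Kt P Q i))\<^sup>2 *
      ((norm (?g1 - 2 *\<^sub>R P i))\<^sup>2 + (norm (?gt - 2 *\<^sub>R P i))\<^sup>2
        + (norm (slope (tri_K P Q (i - 1)) - 2 *\<^sub>R P i))\<^sup>2)"
    by (simp add: x_def y_def z_def j_def)
qed

definition band_elements :: "plane set set" where
  "band_elements = tri_K P Q ` {..N} \<union> tri_Kt P Q ` {1..N}"

lemma band_elements_subset: "band_elements \<subseteq> \<T>"
  using elements by (auto simp: band_elements_def)

text \<open>A triangle \<open>tri_K\<close> occurs at most for the two ends of its base, a triangle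
  \<open>tri_Kt\<close> only once. Distinctness of the elements turns sums over indices into sums
  over elements.\<close>

lemma sum_neighbours_le:
  fixes f :: "plane set \<Rightarrow> real"
  assumes f: "\<And>K. 0 \<le> f K"
  shows "(\<Sum>i=1..N. f (tri_K P Q i) + f (tri_Kt P Q i) + f (tri_K P Q (i - 1))) \<le> 2 * (\<Sum>K\<in>band_elements. f K)"
proof -
  have inj: "inj_on (tri_K P Q) {..N}" "inj_on (tri_Kt P Q) {1..N}" "tri_K P Q ` {..N} \<inter> tri_Kt P Q ` {1..N} = {}"
    using band by (auto simp: is_band_def)
  have "(\<Sum>K\<in>band_elements. f K) = (\<Sum>K\<in>tri_K P Q ` {..N}. f K) + (\<Sum>K\<in>tri_Kt P Q ` {1..N}. f K)"
    unfolding band_elements_def using inj(3) by (intro sum.union_disjoint) auto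
  also have "\<dots> = (\<Sum>i\<le>N. f (tri_K P Q i)) + (\<Sum>i=1..N. f (tri_Kt P Q i))"
    using inj(1,2) by (simp add: sum.reindex)
  finally have eq: "(\<Sum>K\<in>band_elements. f K) = (\<Sum>i\<le>N. f (tri_K P Q i)) + (\<Sum>i=1..N. f (tri_Kt P Q i))" .
  have "(\<Sum>i=1..N. f (tri_K P Q i)) \<le> (\<Sum>i\<le>N. f (tri_K P Q i))"
    using f by (intro sum_mono2) auto
  moreover have "(\<Sum>i=1..N. f (tri_K P Q (i - 1))) \<le> (\<Sum>i\<le>N. f (tri_K P Q i))"
  proof -
    have "(\<Sum>i=1..N. f (tri_K P Q (i - 1))) = (\<Sum>i<N. f (tri_K P Q i))"
      by (rule sum.reindex_bij_witness[of _ Suc "\<lambda>i. i - 1"]) auto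
    also have "\<dots> \<le> (\<Sum>i\<le>N. f (tri_K P Q i))" using f by (intro sum_mono2) auto
    finally show ?thesis .
  qed
  moreover have "0 \<le> (\<Sum>i=1..N. f (tri_Kt P Q i))" using f by (simp add: sum_nonneg)
  moreover have "a + c + b \<le> 2 * (s + c)" if "a \<le> s" "b \<le> s" "0 \<le> c" for a b c s :: real
    using that by simp
  ultimately show ?thesis unfolding eq sum.distrib by blast
qed

text \<open>Here \<mu> and \<open>r\<close> are to become the two minima of the theorem: \<mu>
  cancels the sine in the kinks, and r^2, being below every area up to \<open>CK\<close>, turns
  gradient errors into energies. Cauchy-Schwarz over the N kinks yields sqrt N. The constant is 3456
  = 36 * 24 * 2 * 2, from (L / 6)^2, \<open>kink_square_le\<close>, the double counting and
  \<open>element_estimate\<close>.\<close>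

lemma band_estimate:
  assumes CK: "1 \<le> CK"
    and areas: "\<And>i. i \<in> {1..N} \<Longrightarrow> measure lebesgue (tri_Kt P Q i) \<le> CK * measure lebesgue (tri_K P Q i)"
      "\<And>i. i \<in> {1..N} \<Longrightarrow> measure lebesgue (tri_Kt P Q i) \<le> CK * measure lebesgue (tri_K P Q (i - 1))"
    and \<mu>: "0 \<le> \<mu>" "\<And>i. i \<in> {1..N} \<Longrightarrow> \<mu> \<le> 1 / sin (pi - ang_Kt P Q i)"
    and r: "0 \<le> r" "\<And>i. i \<in> {1..N} \<Longrightarrow> r \<le> sqrt (measure lebesgue (tri_Kt P Q i))"
    and var: "band_length N P / 6 \<le> variation"
  shows "\<mu> * r * band_length N P / sqrt (real N) \<le> sqrt (3456 * CK) *
    (h1_seminorm (interior (band_union N P Q)) (\<lambda>x. u_quad x - U x) + 2 * h * sqrt (measure lebesgue (closure \<Omega>)))"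
proof -
  define E where "E K = (LINT x|lborel. indicator (interior K) x * (norm (pgrad x))\<^sup>2)" for K
  define A where "A = measure lebesgue (closure \<Omega>)"
  define L where "L = band_length N P"
  define M where "M = interior (band_union N P Q)"
  define EB where "EB = (LINT x|lborel. indicator M x * (norm (pgrad x))\<^sup>2)"
  have E0: "0 \<le> E K" for K unfolding E_def by simp
  have N: "1 \<le> N" using band by (simp add: is_band_def)
  have h0: "0 \<le> h"
    using element_diameter[OF elements(1)[of 0] vertices_K(1) vertices_K(1)] by simp
  have area_le: "r\<^sup>2 * (norm (slope K - 2 *\<^sub>R P i))\<^sup>2 \<le> CK * (2 * E K + 8 * h\<^sup>2 * measure lebesgue K)"
    if K: "K \<in> \<T>" "P i \<in> K" "i \<in> {1..N}" "measure lebesgue (tri_Kt P Q i) \<le> CK * measure lebesgue K" for K i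
  proof -
    have "r\<^sup>2 \<le> (sqrt (measure lebesgue (tri_Kt P Q i)))\<^sup>2" using r that by (intro power_mono) auto
    then have "r\<^sup>2 \<le> CK * measure lebesgue K" using K(4) by simp
    then have "r\<^sup>2 * (norm (slope K - 2 *\<^sub>R P i))\<^sup>2 \<le> CK * measure lebesgue K * (norm (slope K - 2 *\<^sub>R P i))\<^sup>2"
      by (rule mult_right_mono) simp
    also have "\<dots> \<le> CK * (2 * E K + 8 * h\<^sup>2 * measure lebesgue K)"
      using mult_left_mono[OF element_estimate[OF K(1,2)], of CK] CK by (simp add: E_def mult.assoc)
    finally show ?thesis .
  qed
  define f where "f K = CK * (2 * E K + 8 * h\<^sup>2 * measure lebesgue K)" for K
  have f0: "0 \<le> f K" for K using CK E0[of K] by (simp add: f_def)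
  have kink: "\<mu>\<^sup>2 * r\<^sup>2 * (element_slope i - element_slope (i - 1))\<^sup>2
      \<le> 24 * (f (tri_K P Q i) + f (tri_Kt P Q i) + f (tri_K P Q (i - 1)))" if i: "i \<in> {1..N}" for i
  proof -
    let ?\<sigma> = "sin (pi - ang_Kt P Q i)"
    define X where "X = (norm (slope (tri_K P Q i) - 2 *\<^sub>R P i))\<^sup>2 + (norm (slope (tri_Kt P Q i) - 2 *\<^sub>R P i))\<^sup>2
        + (norm (slope (tri_K P Q (i - 1)) - 2 *\<^sub>R P i))\<^sup>2"
    have X0: "0 \<le> X" by (simp add: X_def)
    have \<sigma>: "0 < ?\<sigma>" by (rule kink_square_le(1)[OF i])
    have "\<mu> * ?\<sigma> \<le> 1" using \<mu>(2)[OF i] \<sigma> by (simp add: pos_le_divide_eq)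
    then have "(\<mu> * ?\<sigma>)\<^sup>2 \<le> 1" using \<mu>(1) \<sigma> by (simp add: power_le_one)
    have "\<mu>\<^sup>2 * r\<^sup>2 * (element_slope i - element_slope (i - 1))\<^sup>2 \<le> \<mu>\<^sup>2 * r\<^sup>2 * (24 * ?\<sigma>\<^sup>2 * X)"
      using kink_square_le(2)[OF i] unfolding X_def by (rule mult_left_mono) simp
    also have "\<dots> = (\<mu> * ?\<sigma>)\<^sup>2 * (24 * r\<^sup>2 * X)" by (simp only: power_mult_distrib) algebra
    also have "\<dots> \<le> 1 * (24 * r\<^sup>2 * X)"
      using \<open>(\<mu> * ?\<sigma>)\<^sup>2 \<le> 1\<close> X0 by (intro mult_right_mono) auto
    also have "\<dots> = 24 * (r\<^sup>2 * X)" by simp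
    also have "r\<^sup>2 * X \<le> f (tri_K P Q i) + f (tri_Kt P Q i) + f (tri_K P Q (i - 1))"
    proof -
      have "P i \<in> tri_K P Q (i - 1)" using vertices_K(2)[of "i - 1"] i by simp
      \<comment> \<open>By 1 \<le> CK the same area estimate covers the triangle
        \<open>tri_Kt\<close> itself.\<close>
      moreover have "measure lebesgue (tri_Kt P Q i) \<le> CK * measure lebesgue (tri_Kt P Q i)"
        using mult_right_mono[OF CK, of "measure lebesgue (tri_Kt P Q i)"] by simp
      ultimately show ?thesis
        unfolding X_def f_def distrib_left[of "r\<^sup>2"]
        using i by (intro add_mono area_le elements vertices_K vertices_Kt areas) auto
    qed
    finally show ?thesis by simp
  qed
  have sumE: "(\<Sum>K\<in>band_elements. E K) \<le> EB"
    unfolding E_def EB_def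
  proof (rule sum_element_integrals_le[OF band_elements_subset])
    show "M \<in> sets borel" by (simp add: M_def)
    show "interior K \<subseteq> M" if "K \<in> band_elements" for K
      using that unfolding M_def by (intro interior_mono) (auto simp: band_elements_def band_union_def)
  qed (use integrable_pgrad_power in auto)
  have sumA: "(\<Sum>K\<in>band_elements. measure lebesgue K) \<le> A"
    unfolding A_def by (rule sum_element_areas_le[OF band_elements_subset])
  have sumf: "(\<Sum>K\<in>band_elements. f K) \<le> CK * (2 * EB + 8 * h\<^sup>2 * A)"
  proof -
    have "(\<Sum>K\<in>band_elements. f K) = CK * (2 * (\<Sum>K\<in>band_elements. E K) + 8 * h\<^sup>2 * (\<Sum>K\<in>band_elements. measure lebesgue K))"
      by (simp add: f_def sum_distrib_left sum.distrib distrib_left)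
    also have "\<dots> \<le> CK * (2 * EB + 8 * h\<^sup>2 * A)"
      using CK sumE sumA by (intro mult_left_mono add_mono) auto
    finally show ?thesis .
  qed
  have "(L / 6)\<^sup>2 \<le> variation\<^sup>2"
    using var band_length_pos by (intro power_mono) (auto simp: L_def)
  also have "\<dots> \<le> (\<Sum>i=1..N. \<bar>element_slope i - element_slope (i - 1)\<bar>\<^sup>2) * (\<Sum>i=1..N. 1\<^sup>2)"
    using Cauchy_Schwarz_ineq_sum[of "\<lambda>i. \<bar>element_slope i - element_slope (i - 1)\<bar>" "\<lambda>_. 1" "{1..N}"]
    by (simp add: variation_def)
  finally have cs: "(L / 6)\<^sup>2 \<le> (\<Sum>i=1..N. (element_slope i - element_slope (i - 1))\<^sup>2) * real N"
    by simp
  have "\<mu>\<^sup>2 * r\<^sup>2 * (L / 6)\<^sup>2 \<le> \<mu>\<^sup>2 * r\<^sup>2 * ((\<Sum>i=1..N. (element_slope i - element_slope (i - 1))\<^sup>2) * real N)"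
    using cs by (rule mult_left_mono) simp
  also have "\<dots> = (\<Sum>i=1..N. \<mu>\<^sup>2 * r\<^sup>2 * (element_slope i - element_slope (i - 1))\<^sup>2) * real N"
    by (simp only: sum_distrib_left[symmetric] mult.assoc)
  also have "\<dots> \<le> (\<Sum>i=1..N. 24 * (f (tri_K P Q i) + f (tri_Kt P Q i) + f (tri_K P Q (i - 1)))) * real N"
    using kink by (intro mult_right_mono sum_mono) auto
  also have "\<dots> = 24 * (\<Sum>i=1..N. f (tri_K P Q i) + f (tri_Kt P Q i) + f (tri_K P Q (i - 1))) * real N"
    by (simp only: sum_distrib_left[symmetric])
  also have "\<dots> \<le> 24 * (2 * (CK * (2 * EB + 8 * h\<^sup>2 * A))) * real N"
    using sum_neighbours_le[of f, OF f0] sumf by (intro mult_right_mono mult_left_mono) auto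
  finally have main: "\<mu>\<^sup>2 * r\<^sup>2 * L\<^sup>2 \<le> 3456 * CK * (EB + 4 * h\<^sup>2 * A) * real N"
    by (simp add: power_divide algebra_simps)
  have EB0: "0 \<le> EB" by (simp add: EB_def)
  have A0: "0 \<le> A" by (simp add: A_def)
  have "EB + 4 * h\<^sup>2 * A \<le> (sqrt EB + 2 * h * sqrt A)\<^sup>2"
    using EB0 A0 h0 by (simp add: power2_sum power_mult_distrib)
  have "(\<mu> * r * L / sqrt (real N))\<^sup>2 = \<mu>\<^sup>2 * r\<^sup>2 * L\<^sup>2 / real N"
    by (simp add: power_mult_distrib power_divide)
  also have "\<dots> \<le> 3456 * CK * (EB + 4 * h\<^sup>2 * A)"
    using main N by (simp add: pos_divide_le_eq)
  also have "\<dots> \<le> 3456 * CK * (sqrt EB + 2 * h * sqrt A)\<^sup>2"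
    using CK \<open>EB + 4 * h\<^sup>2 * A \<le> _\<close> by (intro mult_left_mono) auto
  also have "\<dots> = (sqrt (3456 * CK) * (sqrt EB + 2 * h * sqrt A))\<^sup>2"
    using CK by (simp add: power_mult_distrib)
  finally have "\<mu> * r * L / sqrt (real N) \<le> sqrt (3456 * CK) * (sqrt EB + 2 * h * sqrt A)"
    by (rule power2_le_imp_le) (use CK EB0 A0 h0 in simp)
  moreover have "h1_seminorm M (\<lambda>x. u_quad x - U x) = sqrt EB"
    unfolding EB_def
  proof (rule h1_seminorm_pgrad(1))
    show "open M" by (simp add: M_def)
    have "tri_K P Q i \<subseteq> \<Union>\<T>" if "i \<in> {..N}" for i using elements(1)[of i] that by auto
    moreover have "tri_Kt P Q i \<subseteq> \<Union>\<T>" if "i \<in> {1..N}" for i using elements(2)[OF that] by auto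
    ultimately have "band_union N P Q \<subseteq> \<Union>\<T>"
      unfolding band_union_def by (intro Un_least UN_least)
    then show "M \<subseteq> \<Union>\<T>" unfolding M_def using interior_subset by blast
  qed
  ultimately show ?thesis by (simp only: M_def L_def A_def)
qed

end

section \<open>Choice of the constants and conclusion\<close>

theorem theorem1:
  fixes \<Omega> :: "plane set" and h0 Cu :: real
  assumes "polygonal_lipschitz_domain \<Omega>" and "0 < h0"
  shows "\<exists>CL0 :: real \<Rightarrow> real. \<forall>CK Ca :: real. \<exists>C1 > 0. \<exists>C2 > 0.
    \<forall>\<alpha> \<in> {0..1}. \<forall>CL > CL0 \<alpha>. \<forall>\<T> U.
      discrete_family \<Omega> h0 Cu \<alpha> \<T> U \<longrightarrow>
      (\<forall>h \<in> {0<..<h0}. \<forall>N P Q.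
         is_band (\<T> h) N P Q \<and> band_regular CK Ca N P Q \<and>
         band_length N P \<ge> CL * h powr (2 * \<alpha> / 5) \<longrightarrow>
         (\<exists>A1 A2 :: real.
            h1_seminorm (interior (band_union N P Q)) (\<lambda>x. u_quad x - U h x) \<ge> A1 - A2 \<and>
            A1 \<ge> C1 * Min ((\<lambda>i. 1 / sin (pi - ang_Kt P Q i)) ` {1..N})
                    * Min ((\<lambda>i. sqrt (measure lebesgue (tri_Kt P Q i))) ` {1..N})
                    * band_length N P / sqrt (real N) \<and>
            \<bar>A2\<bar> \<le> C2 * h powr \<alpha>))"
proof -
  \<comment> \<open>The summand 1 makes the bound on distances strict.\<close>
  define D1 where "D1 = diameter (closure \<Omega>) + 1"
  \<comment> \<open>The constant of \<open>trace_bound\<close>, with the error constant replaced by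
    \<bar>Cu\<bar> + 1, which is positive for every real \<open>Cu\<close>.\<close>
  define B where "B = 432 * sqrt D1 * (\<bar>Cu\<bar> + 1)"
  define H where "H = max 1 h0"
  define A where "A = measure lebesgue (closure \<Omega>)"
  have bnd: "bounded (closure \<Omega>)"
    using assms(1) by (simp add: polygonal_lipschitz_domain_def bounded_closure)
  have D1: "0 < D1" "\<And>x y. x \<in> closure \<Omega> \<Longrightarrow> y \<in> closure \<Omega> \<Longrightarrow> dist x y < D1"
    using diameter_bounded_bound[OF bnd] diameter_ge_0[OF bnd] by (force simp: D1_def)+
  have B: "0 < B" using D1 by (simp add: B_def)
  have H: "1 \<le> H" by (simp add: H_def)
  show ?thesis
  \<comment> \<open>The part \<open>9 * H\<close> makes L at least 9 h, enough for
    \<open>72 * h\<^sup>2 \<le> L\<^sup>2\<close>; the part \<open>B\<close> makes L too long for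
    the trace estimate when the variation is small. One threshold serves all \<alpha>.\<close>
  proof (rule exI[of _ "\<lambda>_. 9 * H + B"], intro allI)
    fix CK Ca :: real
    \<comment> \<open>\<open>CK\<close> is an arbitrary real, while \<open>band_estimate\<close>
      asks for at least 1; enlarging it only weakens the area conditions.\<close>
    define S where "S = sqrt (3456 * max 1 CK)"
    have S: "0 < S" by (simp add: S_def)
    show "\<exists>C1 > 0. \<exists>C2 > 0. \<forall>\<alpha> \<in> {0..1}. \<forall>CL > 9 * H + B. \<forall>\<T> U.
      discrete_family \<Omega> h0 Cu \<alpha> \<T> U \<longrightarrow>
      (\<forall>h \<in> {0<..<h0}. \<forall>N P Q.
         is_band (\<T> h) N P Q \<and> band_regular CK Ca N P Q \<and>
         band_length N P \<ge> CL * h powr (2 * \<alpha> / 5) \<longrightarrow>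
         (\<exists>A1 A2 :: real.
            h1_seminorm (interior (band_union N P Q)) (\<lambda>x. u_quad x - U h x) \<ge> A1 - A2 \<and>
            A1 \<ge> C1 * Min ((\<lambda>i. 1 / sin (pi - ang_Kt P Q i)) ` {1..N})
                    * Min ((\<lambda>i. sqrt (measure lebesgue (tri_Kt P Q i))) ` {1..N})
                    * band_length N P / sqrt (real N) \<and>
            \<bar>A2\<bar> \<le> C2 * h powr \<alpha>))"
    proof (rule exI[of _ "1 / S"], rule conjI, simp add: S, rule exI[of _ "2 * sqrt A * H + 1"], rule conjI,
        simp add: A_def H_def add_nonneg_pos, intro ballI allI impI)
      fix \<alpha> CL h :: real and \<T> U N P Q
      assume \<alpha>: "\<alpha> \<in> {0..1}" and CL: "9 * H + B < CL" and fam: "discrete_family \<Omega> h0 Cu \<alpha> \<T> U"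
        and h: "h \<in> {0<..<h0}"
        and asm: "is_band (\<T> h) N P Q \<and> band_regular CK Ca N P Q \<and> CL * h powr (2 * \<alpha> / 5) \<le> band_length N P"
      have hh: "0 < h" "h < h0" using h by auto
      have setting: "fe_setting \<Omega> (\<T> h) (U h) h"
        using fam h assms(1) unfolding fe_setting_def discrete_family_def by blast
      have "\<exists>d \<nu> t. norm d = 1 \<and> norm \<nu> = 1 \<and> d \<bullet> \<nu> = 0 \<and> strict_mono_on {..Suc N} t \<and>
        (\<forall>i \<le> Suc N. P i = P 0 + t i *\<^sub>R d) \<and> (\<forall>i \<le> N. 0 < (Q i - P 0) \<bullet> \<nu>)"
        using asm unfolding is_band_def by (elim conjE) assumption
      then obtain d \<nu> t where fr: "norm d = 1" "norm \<nu> = 1" "d \<bullet> \<nu> = 0" "strict_mono_on {..Suc N} t"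
        "\<forall>i \<le> Suc N. P i = P 0 + t i *\<^sub>R d" "\<forall>i \<le> N. 0 < (Q i - P 0) \<bullet> \<nu>"
        by (elim exE conjE)
      interpret fe_band \<Omega> "\<T> h" "U h" h N P Q d \<nu> t
      proof (intro fe_band.intro fe_band_axioms.intro setting)
        show "is_band (\<T> h) N P Q" using asm by (rule conjunct1)
        show "P i = P 0 + t i *\<^sub>R d" if "i \<le> Suc N" for i by (rule fr(5)[rule_format, OF that])
        show "0 < (Q i - P 0) \<bullet> \<nu>" if "i \<le> N" for i by (rule fr(6)[rule_format, OF that])
      qed (rule fr)+
      define L where "L = band_length N P"
      \<comment> \<open>With z = h^(\<alpha>/5) and y = sqrt L all exponents become integers: the
        length condition reads CL z^2 \<le> y^2, and \<open>large\<close> becomes B z^5 y <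
        y^6.\<close>
      define z where "z = h powr (\<alpha> / 5)"
      define y where "y = sqrt L"
      define c where "c = (\<bar>Cu\<bar> + 1) * h powr \<alpha>"
      have z: "0 < z" using hh by (simp add: z_def)
      have z2: "h powr (2 * \<alpha> / 5) = z\<^sup>2" and z5: "h powr \<alpha> = z ^ 5"
        using hh by (simp_all add: z_def powr_power)
      have c: "0 < c" using hh by (simp add: c_def)
      have h1c: "h1_seminorm \<Omega> (\<lambda>x. u_quad x - U h x) \<le> c"
      proof -
        have "h1_seminorm \<Omega> (\<lambda>x. u_quad x - U h x) \<le> Cu * h powr \<alpha>"
          using fam h unfolding discrete_family_def by blast
        also have "\<dots> \<le> c" unfolding c_def by (intro mult_right_mono) auto
        finally show ?thesis .
      qed
      have Lz: "CL * z\<^sup>2 \<le> L" using asm by (simp add: L_def z2)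
      have "0 < L" using band_length_pos by (simp add: L_def)
      have y: "0 < y" "y\<^sup>2 = L" using \<open>0 < L\<close> by (simp_all add: y_def)
      have CL': "1 \<le> CL" "9 * H \<le> CL" "B < CL" using CL B H by auto
      have hL: "72 * h\<^sup>2 \<le> L\<^sup>2"
      proof -
        have "h = h powr (2 * \<alpha> / 5) * h powr (1 - 2 * \<alpha> / 5)"
          using hh by (simp flip: powr_add)
        also have "\<dots> \<le> z\<^sup>2 * H"
          unfolding z2[symmetric] H_def using hh \<alpha> by (intro mult_left_mono powr_le_max_one) auto
        finally have "9 * h \<le> 9 * H * z\<^sup>2" by (simp add: mult.commute)
        also have "\<dots> \<le> CL * z\<^sup>2" using CL' by (intro mult_right_mono) auto
        finally have "9 * h \<le> L" using Lz by linarith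
        then have "(9 * h)\<^sup>2 \<le> L\<^sup>2" using hh by (intro power_mono) auto
        then have "81 * h\<^sup>2 \<le> L\<^sup>2" by (simp add: power_mult_distrib)
        then show ?thesis using zero_le_power2[of h] by linarith
      qed
      have large: "432 * (c * sqrt (L * D1)) < L ^ 3"
      proof -
        have "z\<^sup>2 \<le> CL * z\<^sup>2" using mult_right_mono[OF CL'(1), of "z\<^sup>2"] by simp
        have Ly: "CL * z\<^sup>2 \<le> y\<^sup>2" using Lz y(2) by simp
        with \<open>z\<^sup>2 \<le> CL * z\<^sup>2\<close> have "z\<^sup>2 \<le> y\<^sup>2" by linarith
        then have zy: "z \<le> y" by (rule power2_le_imp_le) (use y in simp)
        \<comment> \<open>One factor CL beats B and CL \<ge> 1 supplies a second, so both squares of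
          z can be replaced by y^2; the remaining z is at most y.\<close>
        have "B * z ^ 5 < CL * z ^ 5" using CL' z by simp
        also have "\<dots> \<le> CL * CL * z ^ 5" using CL' z by (intro mult_right_mono) auto
        also have "\<dots> = (CL * z\<^sup>2) * (CL * z\<^sup>2) * z" by (simp add: eval_nat_numeral)
        also have "\<dots> \<le> y\<^sup>2 * y\<^sup>2 * y"
          using Ly CL' z zy y(1) by (intro mult_mono mult_nonneg_nonneg zero_le_power2) auto
        finally have "B * z ^ 5 * y < y\<^sup>2 * y\<^sup>2 * y * y" using y by (intro mult_strict_right_mono) auto
        moreover have "432 * (c * sqrt (L * D1)) = B * z ^ 5 * y"
          by (simp add: B_def c_def z5 y_def real_sqrt_mult)
        moreover have "y\<^sup>2 * y\<^sup>2 * y * y = L ^ 3"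
          unfolding y(2)[symmetric] by (simp add: eval_nat_numeral)
        ultimately show ?thesis by simp
      qed
      have var: "band_length N P / 6 \<le> variation"
        by (rule variation_ge[OF D1(1) _ hL[unfolded L_def] c h1c large[unfolded L_def]])
           (use D1(2) union_elements in auto)
      define \<mu> where "\<mu> = Min ((\<lambda>i. 1 / sin (pi - ang_Kt P Q i)) ` {1..N})"
      define r where "r = Min ((\<lambda>i. sqrt (measure lebesgue (tri_Kt P Q i))) ` {1..N})"
      have N: "1 \<le> N" using asm by (simp add: is_band_def)
      have est: "\<mu> * r * L / sqrt (real N) \<le> S * (h1_seminorm (interior (band_union N P Q)) (\<lambda>x. u_quad x - U h x) + 2 * h * sqrt A)"
        unfolding L_def S_def A_def
      proof (rule band_estimate[OF _ _ _ _ _ _ _ var])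
        fix i assume i: "i \<in> {1..N}"
        have reg: "measure lebesgue (tri_Kt P Q i) \<le> CK * measure lebesgue (tri_K P Q i)"
          "measure lebesgue (tri_Kt P Q i) \<le> CK * measure lebesgue (tri_K P Q (i - 1))"
          using asm i unfolding band_regular_def by blast+
        show "measure lebesgue (tri_Kt P Q i) \<le> max 1 CK * measure lebesgue (tri_K P Q i)"
          by (rule order_trans[OF reg(1) mult_right_mono]) auto
        show "measure lebesgue (tri_Kt P Q i) \<le> max 1 CK * measure lebesgue (tri_K P Q (i - 1))"
          by (rule order_trans[OF reg(2) mult_right_mono]) auto
        show "\<mu> \<le> 1 / sin (pi - ang_Kt P Q i)"
          unfolding \<mu>_def using i by (intro Min_le) auto
        show "r \<le> sqrt (measure lebesgue (tri_Kt P Q i))"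
          unfolding r_def using i by (intro Min_le) auto
      next
        show "0 \<le> \<mu>" unfolding \<mu>_def
          using N kink_square_le(1) by (intro Min.boundedI) (auto intro: less_imp_le)
        show "0 \<le> r" unfolding r_def using N by (intro Min.boundedI) auto
      qed simp
      show "\<exists>A1 A2 :: real.
            A1 - A2 \<le> h1_seminorm (interior (band_union N P Q)) (\<lambda>x. u_quad x - U h x) \<and>
            1 / S * Min ((\<lambda>i. 1 / sin (pi - ang_Kt P Q i)) ` {1..N})
                    * Min ((\<lambda>i. sqrt (measure lebesgue (tri_Kt P Q i))) ` {1..N})
                    * band_length N P / sqrt (real N) \<le> A1 \<and>
            \<bar>A2\<bar> \<le> (2 * sqrt A * H + 1) * h powr \<alpha>"
      \<comment> \<open>A1 is the required lower bound itself. A2 stems from the variation of the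
        gradient of u within elements; it is of order h, and h = h^\<alpha> h^(1 - \<alpha>) \<le> H
        h^\<alpha>.\<close>
      proof (rule exI[of _ "1 / S * \<mu> * r * L / sqrt (real N)"], rule exI[of _ "2 * h * sqrt A"], intro conjI)
        have "1 / S * \<mu> * r * L / sqrt (real N) = (\<mu> * r * L / sqrt (real N)) / S" by simp
        also have "\<dots> \<le> h1_seminorm (interior (band_union N P Q)) (\<lambda>x. u_quad x - U h x) + 2 * h * sqrt A"
          using est by (simp only: pos_divide_le_eq[OF S] mult.commute[of S])
        finally show "1 / S * \<mu> * r * L / sqrt (real N) - 2 * h * sqrt A
            \<le> h1_seminorm (interior (band_union N P Q)) (\<lambda>x. u_quad x - U h x)" by simp
        show "1 / S * Min ((\<lambda>i. 1 / sin (pi - ang_Kt P Q i)) ` {1..N})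
                    * Min ((\<lambda>i. sqrt (measure lebesgue (tri_Kt P Q i))) ` {1..N})
                    * band_length N P / sqrt (real N) \<le> 1 / S * \<mu> * r * L / sqrt (real N)"
          by (simp add: \<mu>_def r_def L_def)
        have A0: "0 \<le> sqrt A" by (simp add: A_def)
        have "h = h powr \<alpha> * h powr (1 - \<alpha>)" using hh by (simp flip: powr_add)
        also have "\<dots> \<le> h powr \<alpha> * H"
          unfolding H_def using hh \<alpha> by (intro mult_left_mono powr_le_max_one) auto
        finally have "2 * sqrt A * h \<le> 2 * sqrt A * (h powr \<alpha> * H)" using A0 by (intro mult_left_mono) auto
        also have "\<dots> \<le> (2 * sqrt A * H + 1) * h powr \<alpha>" by (simp add: algebra_simps)
        finally have le: "2 * sqrt A * h \<le> (2 * sqrt A * H + 1) * h powr \<alpha>" .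
        have "\<bar>2 * h * sqrt A\<bar> = 2 * sqrt A * h" using hh A0 by (simp add: abs_mult)
        with le show "\<bar>2 * h * sqrt A\<bar> \<le> (2 * sqrt A * H + 1) * h powr \<alpha>" by (simp only:)
      qed
    qed
  qed
qed

end
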